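(* For any $c\in\mathbb{C}$ the classical limit $\mathcal V_{\mathrm{H}}(c)_0=\mathcal V_{\mathrm{H}}(c)/h\mathcal V_{\mathrm{H}}(c)$ of the quantum vertex algebra $\mathcal V_{\mathrm{H}}(c)$ is the Heisenberg vertex algebra $V_{\hat{\mathfrak h}}(c)$; that is, under the identification $\overline{x}_{ii}^{(-r)}\mapsto a_i(-r)$ of the underlying spaces described in the context, the two vertex algebra structures coincide.
   Context: **Conventions.** $N\geqslant 2$ is an integer, $h$ a formal parameter, $c\in\mathbb C$. A $\mathbb C[[h]]$-module is topologically free if it is torsion-free, separated and $h$-adically complete (equivalently $\cong V_0[[h]]$). Tensor products of $\mathbb C[[h]]$-modules are $h$-adically completed; $\mathrm{Hom}$ means $\mathbb C[[h]]$-module maps. For a $\mathbb C[[h]]$-module $V$, $V((u))_h$ is the module of series $\sum_{r\in\mathbb Z}a_ru^{-r-1}\in V[[u^{\pm1}]]$ with $a_r\to0$ $h$-adically as $r\to\infty$, $V[u^{-1}]_h$ the submodule of those in $V[[u^{-1}]]$; similarly in several variables (for $V=V_0[[h]]$, $V((u_1,\dots,u_n))_h=V_0((u_1,\dots,u_n))[[h]]$ with $V_0((u_1,\dots,u_n))=V_0[[u_1,\dots,u_n]][u_1^{-1},\dots,u_n^{-1}]$). Expressions $(x_1+\dots+x_n)^r$ with $r<0$ are expanded in nonnegative powers of $x_2,\dots,x_n$. Subscripts indicate tensor factors. **The series $S$.** Let $R(u)=I-\frac hu P$ on $\mathbb C^N\otimes\mathbb C^N$, $I$ the identity, $P=\sum_{i,j}e_{ij}\otimes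 e_{ji}$. There is a unique series $G(u,C)=1+\frac{C+N}{N}\frac{h^2}{u^2}-\dots\in\mathbb C[C][[h/u]]$ with $\mathrm{tr}_1(G(u,C)R(u)R(-u-hC)-I)=\mathrm{tr}_2(G(u,C)R(u)R(-u-hC)-I)=0$. Put $S(u)=h^{-2}(G(u,c)R(u)R(-u-hc)-I)$. **$\mathrm{H}^+_N$ and operators.** $\mathrm{H}^+_N$ is the quotient of $\mathbb C[x_{ij}^{(-r)}: i,j=1,\dots,N,\ r\geqslant1][[h]]$ by the $h$-adically complete ideal generated by $x_{11}^{(-r)}+\dots+x_{NN}^{(-r)}$, $r\geqslant1$; $\mathbf 1$ is its unit. Put $x^+_{ij}(u)=\sum_{r\geqslant1}x_{ij}^{(-r)}u^{r-1}$, $x^+(u)=\sum_{i,j}e_{ij}\otimes x^+_{ij}(u)$, $x^+_{[n]}(u_1,\dots,u_n)=x^+_1(u_1)\cdots x^+_n(u_n)$ ($x_k^+$ has its matrix part in the $k$-th factor of $(\mathrm{End}\,\mathbb C^N)^{\otimes n}$). $x^-(u)=\sum_{i,j}e_{ij}\otimes x^-_{ij}(u)$, $x^-_{ij}(u)=\sum_{r\geqslant1}x_{ij}^{(r-1)}u^{-r}$, is the unique element of $\mathrm{End}\,\mathbb C^N\otimes\mathrm{Hom}(\mathrm{H}^+_N,\mathrm{H}^+_N[u^{-1}]_h)$ with $x^-(u)\mathbf 1=0$ and $x^-_0(u_0)x^+_{[n]}(u)=-\sum_{j=1}^nS_{0j}(u_0-u_j)x_1^+(u_1)\cdots x_{j-1}^+(u_{j-1})x_{j+1}^+(u_{j+1})\cdots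 x_n^+(u_n)$ for all $n\geqslant1$. Put $x(u)=x^+(u)+x^-(u)$ ($x^+$ acting by multiplication). For $0\leqslant k\leqslant\lfloor n/2\rfloor$ let $I^n_k$ be the family of all sets of $k$ ordered pairs $(p,q)\in\{1,\dots,n\}^2$, $p<q$, with all coordinates in the set mutually distinct, and $i'$ the set of elements of $\{1,\dots,n\}$ not appearing in $i\in I^n_k$. Define $$x_{[n]}(u_1,\dots,u_n)=\sum_{k=0}^{\lfloor n/2\rfloor}\ \sum_{\substack{i=\{(i_1,j_1),\dots,(i_k,j_k)\}\in I^n_k\\ l_1<\dots<l_{n-2k}\in i'}}S_{i_1j_1}\cdots S_{i_kj_k}\,x_{l_1}(u_{l_1})\cdots x_{l_{n-2k}}(u_{l_{n-2k}}),\quad S_{ij}=S_{ij}(u_i-u_j),$$ an element of $(\mathrm{End}\,\mathbb C^N)^{\otimes n}\otimes\mathrm{Hom}(\mathrm{H}^+_N,\mathrm{H}^+_N((u_1,\dots,u_n))_h)$, and $x_{[n]}(z+u_1,\dots,z+u_n)$ by substituting $z+u_i$ for the $i$-th variable. **$\mathcal V_{\mathrm{H}}(c)$.** $\mathrm{H}^+_N$ is a quantum vertex algebra (in the sense of Etingof–Kazhdan) with vacuum $\mathbf 1$ and vertex operator map $Y(x^+_{[n]}(u_1,\dots,u_n),z)=x_{[n]}(z+u_1,\dots,z+u_n)$, and with a braiding $\mathcal S(z)=1+O(h)$. $\mathcal V_{\mathrm{H}}(c)$ is its quantum vertex subalgebra whose underlying module is the topologically free subalgebra generated by $\mathbf 1$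 and all $x_{ii}^{(-r)}$, $i=1,\dots,N$, $r\geqslant1$. The classical limit of a quantum vertex algebra $V$ is the vertex algebra $V/hV$ with vacuum and vertex operator map induced from those of $V$ by reduction modulo $h$. Let $\overline x_{ii}^{(-r)}$ be the image of $x_{ii}^{(-r)}$ in $\mathcal V_{\mathrm{H}}(c)_0$. **The Heisenberg vertex algebra.** $\mathfrak h$ is the abelian Lie algebra with generators $a_1,\dots,a_N$ and relation $a_1+\dots+a_N=0$, with form $\langle a_i,a_j\rangle=\delta_{ij}-\frac1N$. $\hat{\mathfrak h}=\mathfrak h\otimes\mathbb C[t,t^{-1}]\oplus\mathbb CC$ has brackets $[a(r),b(s)]=\langle a,b\rangle r\,\delta_{r+s,0}\,C$, $C$ central, $a(r)=a\otimes t^r$. $V_{\hat{\mathfrak h}}(c)=U(\hat{\mathfrak h})\otimes_{U(\mathfrak h\otimes\mathbb C[t]\oplus\mathbb CC)}\mathbb C_c$, where $\mathfrak h\otimes\mathbb C[t]$ acts on $\mathbb C_c=\mathbb C$ trivially and $C$ by $c$. $\mathfrak h$ embeds in $V_{\hat{\mathfrak h}}(c)$ via $a\mapsto a(-1)\mathbf 1$, $\mathbf 1=1\in\mathbb C_c$, and $V_{\hat{\mathfrak h}}(c)$ carries a unique vertex algebra structure with vacuum $\mathbf 1$ and $Y(a,z)=\sum_{r\in\mathbb Z}a(r)z^{-r-1}$ for all $a\in\mathfrak h$. **Identification.** As a vector space $V_{\hat{\mathfrak h}}(c)\cong U(\mathfrak h\otimes t^{-1}\mathbb C[t^{-1}])$,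 a commutative algebra; $\overline x_{ii}^{(-r)}\mapsto a_i(-r)$ ($i=1,\dots,N$, $r\geqslant1$) defines an isomorphism of commutative associative algebras $\mathcal V_{\mathrm{H}}(c)_0\to V_{\hat{\mathfrak h}}(c)$. *)

theory Defs
  imports
    "HOL-Analysis.Cartesian_Space"
    "HOL-Analysis.Elementary_Metric_Spaces"
    "HOL-Computational_Algebra.Polynomial"
    "HOL-Computational_Algebra.Formal_Power_Series"
    "HOL-Library.Poly_Mapping"
    "HOL-Algebra.Module"
    "HOL-Algebra.QuotRing"
begin

text \<open>
  The integer \<open>N\<close> is \<open>CARD('n)\<close> for a finite type \<open>'n\<close>, which also serves as the index set of
  the matrix units. Formal power series in \<open>h\<close> are of type \<open>_ fps\<close>; their metric is the
  \<open>h\<close>-adic one.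
\<close>

section \<open>The series \<open>S(u)\<close>\<close>

type_synonym ('a, 'n) mat2 = "'a ^ ('n \<times> 'n) ^ ('n \<times> 'n)"

text \<open>
  An element of \<open>End (C^N \<otimes> C^N)\<close> is a matrix \<open>M\<close> whose rows and columns are indexed by pairs; the
  coefficient of \<open>e_ij \<otimes> e_kl\<close> in it is \<open>M $ (i, k) $ (j, l)\<close>.
\<close>

definition tensor_entry :: "('a, 'n::finite) mat2 \<Rightarrow> 'n \<times> 'n \<Rightarrow> 'n \<times> 'n \<Rightarrow> 'a" where
  "tensor_entry M e f = M $ (fst e, fst f) $ (snd e, snd f)"

definition flip_mat :: "('a::zero_neq_one, 'n::finite) mat2" where
  "flip_mat = (\<chi> r s. if fst r = snd s \<and> snd r = fst s then 1 else 0)"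

definition scale_mat :: "'a::times \<Rightarrow> ('a, 'n::finite) mat2 \<Rightarrow> ('a, 'n) mat2" where
  "scale_mat a M = (\<chi> r s. a * M $ r $ s)"

definition partial_trace1 :: "('a::comm_monoid_add, 'n::finite) mat2 \<Rightarrow> 'a ^ 'n ^ 'n" where
  "partial_trace1 M = (\<chi> k l. \<Sum>i\<in>UNIV. M $ (i, k) $ (i, l))"

definition partial_trace2 :: "('a::comm_monoid_add, 'n::finite) mat2 \<Rightarrow> 'a ^ 'n ^ 'n" where
  "partial_trace2 M = (\<chi> i j. \<Sum>k\<in>UNIV. M $ (i, k) $ (j, k))"

text \<open>
  \<open>R_mat f\<close> is \<open>R(v) = I - (h/v) P\<close> with \<open>f\<close> the expansion of \<open>h/v\<close> in powers of \<open>t = h/u\<close>. For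
  \<open>v = u\<close> this is \<open>t\<close>, and for \<open>v = -u - hC\<close> it is \<open>-t (1 + C t)^(-1)\<close>.
\<close>

definition R_mat :: "'a::comm_ring_1 fps \<Rightarrow> ('a fps, 'n::finite) mat2" where
  "R_mat f = mat 1 - scale_mat f flip_mat"

definition shifted_arg :: "'a::comm_ring_1 \<Rightarrow> 'a fps" where
  "shifted_arg C = Abs_fps (\<lambda>k. if k = 0 then 0 else - ((- C) ^ (k - 1)))"

definition RR_mat :: "'a::comm_ring_1 \<Rightarrow> ('a fps, 'n::finite) mat2" where
  "RR_mat C = R_mat fps_X ** R_mat (shifted_arg C)"

definition G_condition :: "'n::finite itself \<Rightarrow> complex poly fps \<Rightarrow> bool" where
  "G_condition _ g \<longleftrightarrow>
     partial_trace1 (scale_mat g (RR_mat [:0, 1:]) - mat 1 :: (complex poly fps, 'n) mat2) = 0 \<and>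
     partial_trace2 (scale_mat g (RR_mat [:0, 1:]) - mat 1 :: (complex poly fps, 'n) mat2) = 0"

lemma shifted_arg_nz: "fps_nth (shifted_arg C) 0 = 0"
  by (simp add: shifted_arg_def)

lemma flip_mat_square: "(flip_mat :: ('a::comm_ring_1, 'n::finite) mat2) ** flip_mat = mat 1"
proof -
  have "(\<Sum>k\<in>UNIV. (flip_mat :: ('a, 'n) mat2) $ r $ k * flip_mat $ k $ s) = (mat 1 :: ('a, 'n) mat2) $ r $ s" for r s
  proof -
    have "(\<Sum>k\<in>UNIV. (flip_mat :: ('a, 'n) mat2) $ r $ k * flip_mat $ k $ s)
        = (\<Sum>k\<in>UNIV. if k = (snd r, fst r) then (if r = s then 1 else 0) else 0)"
      by (intro sum.cong) (auto simp: flip_mat_def prod_eq_iff)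
    then show ?thesis by (simp add: mat_def)
  qed
  then show ?thesis by (simp add: vec_eq_iff matrix_matrix_mult_def)
qed

lemma RR_mat_entry:
  "(RR_mat C :: ('a::comm_ring_1 fps, 'n::finite) mat2) $ r $ s
     = (1 + fps_X * shifted_arg C) * mat 1 $ r $ s - (fps_X + shifted_arg C) * flip_mat $ r $ s"
proof -
  let ?P = "flip_mat :: ('a fps, 'n) mat2" and ?f = "fps_X :: 'a fps" and ?g = "shifted_arg C"
  have "(RR_mat C :: ('a fps, 'n) mat2) $ r $ s
      = (\<Sum>k\<in>UNIV. (mat 1 $ r $ k - ?f * ?P $ r $ k) * (mat 1 $ k $ s - ?g * ?P $ k $ s))"
    by (simp add: RR_mat_def R_mat_def scale_mat_def matrix_matrix_mult_def)
  also have "\<dots> = (\<Sum>k\<in>UNIV. mat 1 $ r $ k * mat 1 $ k $ s) - ?g * (\<Sum>k\<in>UNIV. mat 1 $ r $ k * ?P $ k $ s)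
      - ?f * (\<Sum>k\<in>UNIV. ?P $ r $ k * mat 1 $ k $ s) + ?f * ?g * (\<Sum>k\<in>UNIV. ?P $ r $ k * ?P $ k $ s)"
    by (simp add: algebra_simps sum.distrib sum_subtractf sum_distrib_left)
  also have "(\<Sum>k\<in>UNIV. mat 1 $ r $ k * mat 1 $ k $ s) = (mat 1 :: ('a fps, 'n) mat2) $ r $ s"
    using arg_cong[OF matrix_mul_lid[of "mat 1 :: ('a fps, 'n) mat2"], of "\<lambda>M. M $ r $ s"]
    by (simp add: matrix_matrix_mult_def)
  also have "(\<Sum>k\<in>UNIV. mat 1 $ r $ k * ?P $ k $ s) = ?P $ r $ s"
    using arg_cong[OF matrix_mul_lid[of ?P], of "\<lambda>M. M $ r $ s"]
    by (simp add: matrix_matrix_mult_def)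
  also have "(\<Sum>k\<in>UNIV. ?P $ r $ k * mat 1 $ k $ s) = ?P $ r $ s"
    using arg_cong[OF matrix_mul_rid[of ?P], of "\<lambda>M. M $ r $ s"]
    by (simp add: matrix_matrix_mult_def)
  also have "(\<Sum>k\<in>UNIV. ?P $ r $ k * ?P $ k $ s) = (mat 1 :: ('a fps, 'n) mat2) $ r $ s"
    using arg_cong[OF flip_mat_square[where 'a = "'a fps" and 'n = 'n], of "\<lambda>M. M $ r $ s"]
    by (simp add: matrix_matrix_mult_def)
  finally show ?thesis by (simp add: algebra_simps)
qed

lemma G_condition_iff:
  "G_condition TYPE('n::finite) g \<longleftrightarrow>
     g * (of_nat CARD('n) * (1 + fps_X * shifted_arg [:0, 1:]) - (fps_X + shifted_arg [:0, 1:]))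
       = of_nat CARD('n)" (is "_ \<longleftrightarrow> g * ?D = ?N")
proof -
  let ?I = "mat 1 :: (complex poly fps, 'n) mat2" and ?P = "flip_mat :: (complex poly fps, 'n) mat2"
  let ?i = "mat 1 :: complex poly fps ^ 'n ^ 'n"
  let ?M = "scale_mat g (RR_mat [:0, 1:]) - ?I"
  define a b :: "complex poly fps"
    where "a = 1 + fps_X * shifted_arg [:0, 1:]" and "b = fps_X + shifted_arg [:0, 1:]"
  have M: "?M $ r $ s = (g * a - 1) * ?I $ r $ s - g * b * ?P $ r $ s" for r s
    by (simp add: scale_mat_def RR_mat_entry a_def b_def algebra_simps)
  have I1: "(\<Sum>i\<in>UNIV. ?I $ (i, k) $ (i, l)) = ?N * ?i $ k $ l"
    and I2: "(\<Sum>i\<in>UNIV. ?I $ (k, i) $ (l, i)) = ?N * ?i $ k $ l" for k l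
    by (auto simp: mat_def)
  have P1: "(\<Sum>i\<in>UNIV. ?P $ (i, k) $ (i, l)) = ?i $ k $ l"
    and P2: "(\<Sum>i\<in>UNIV. ?P $ (k, i) $ (l, i)) = ?i $ k $ l" for k l
  proof -
    have "(\<Sum>i\<in>UNIV. ?P $ (i, k) $ (i, l)) = (\<Sum>i\<in>UNIV. if i = l then ?i $ k $ l else 0)"
      by (intro sum.cong) (auto simp: flip_mat_def mat_def)
    then show "(\<Sum>i\<in>UNIV. ?P $ (i, k) $ (i, l)) = ?i $ k $ l" by simp
    have "(\<Sum>i\<in>UNIV. ?P $ (k, i) $ (l, i)) = (\<Sum>i\<in>UNIV. if i = l then ?i $ k $ l else 0)"
      by (intro sum.cong) (auto simp: flip_mat_def mat_def)
    then show "(\<Sum>i\<in>UNIV. ?P $ (k, i) $ (l, i)) = ?i $ k $ l" by simp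
  qed
  have T: "partial_trace1 ?M = (\<chi> k l. (g * ?D - ?N) * ?i $ k $ l)"
          "partial_trace2 ?M = (\<chi> k l. (g * ?D - ?N) * ?i $ k $ l)"
    unfolding partial_trace1_def partial_trace2_def M a_def[symmetric] b_def[symmetric]
    by (simp_all add: sum_subtractf flip: sum_distrib_left add: I1 I2 P1 P2)
       (simp_all add: vec_eq_iff algebra_simps)
  have "(\<chi> k l. (g * ?D - ?N) * ?i $ k $ l) = 0 \<longleftrightarrow> g * ?D = ?N"
    by (auto simp: vec_eq_iff mat_def)
  then show ?thesis unfolding G_condition_def T by simp
qed

lemma G_condition_ex1: "\<exists>!g. G_condition TYPE('n::finite) g"
proof -
  let ?N = "of_nat CARD('n) :: complex poly fps"
  let ?D = "?N * (1 + fps_X * shifted_arg [:0, 1:]) - (fps_X + shifted_arg [:0, 1:]) :: complex poly fps"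
  have N0: "fps_nth ?D 0 = [:of_nat CARD('n):]"
    by (simp add: shifted_arg_nz fps_of_nat[symmetric] of_nat_poly)
  have "fps_nth ?D 0 * [:1 / of_nat CARD('n):] = 1"
    unfolding N0 by (simp add: one_pCons)
  from fps_right_inverse[OF this] have inv: "?D * fps_right_inverse ?D [:1 / of_nat CARD('n):] = 1" .
  then have "?D \<noteq> 0" by force
  show ?thesis unfolding G_condition_iff
  proof (rule ex1I[of _ "?N * fps_right_inverse ?D [:1 / of_nat CARD('n):]"])
    show "?N * fps_right_inverse ?D [:1 / of_nat CARD('n):] * ?D = ?N"
      using inv by (simp add: mult.assoc mult.commute)
    then show "g = ?N * fps_right_inverse ?D [:1 / of_nat CARD('n):]" if "g * ?D = ?N" for g
      using that \<open>?D \<noteq> 0\<close> by (metis mult_right_cancel)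
  qed
qed

definition G_series :: "'n::finite itself \<Rightarrow> complex poly fps" where
  "G_series n = (THE g. G_condition n g)"

definition GRR_minus_I :: "complex \<Rightarrow> (complex fps, 'n::finite) mat2" where
  "GRR_minus_I c =
     scale_mat (Abs_fps (\<lambda>k. poly (fps_nth (G_series TYPE('n)) k) c)) (RR_mat c) - mat 1"

text \<open>
  Coefficient, in \<open>\<complex>[[h]]\<close>, of \<open>e \<otimes> f\<close> and \<open>u^(-m)\<close> in \<open>S(u)\<close>. As \<open>t = h/u\<close>, the coefficient of \<open>u^(-m)\<close> in
  \<open>G R R - I\<close> is \<open>h^m\<close> times that of \<open>t^m\<close>; the shift divides by \<open>h^2\<close>.
\<close>

definition S_coeff :: "complex \<Rightarrow> 'n::finite \<times> 'n \<Rightarrow> 'n \<times> 'n \<Rightarrow> nat \<Rightarrow> complex fps" where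
  "S_coeff c e f m =
     fps_shift 2 (fps_const (fps_nth (tensor_entry (GRR_minus_I c) e f) m) * fps_X ^ m)"

text \<open>
  Coefficient of \<open>u^a v^b\<close> in \<open>S(u - v)\<close>, expanded in nonnegative powers of \<open>v\<close>.
\<close>

definition S_diff_coeff :: "complex \<Rightarrow> 'n::finite \<times> 'n \<Rightarrow> 'n \<times> 'n \<Rightarrow> int \<Rightarrow> int \<Rightarrow> complex fps" where
  "S_diff_coeff c e f a b =
     (if b \<ge> 0 \<and> a + b \<le> 0
      then fps_const ((of_int (a + b) gchoose nat b) * (- 1) ^ nat b) * S_coeff c e f (nat (- (a + b)))
      else 0)"


section \<open>The algebra \<open>H\<^sup>+\<^sub>N\<close>\<close>

definition two_sided_ideal :: "'a::ring_1 set \<Rightarrow> bool" where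
  "two_sided_ideal J \<longleftrightarrow> 0 \<in> J \<and> (\<forall>x\<in>J. \<forall>y\<in>J. x + y \<in> J) \<and> (\<forall>a. \<forall>x\<in>J. a * x \<in> J \<and> x * a \<in> J)"

lemma two_sided_ideal_Inter: "(\<And>J. J \<in> \<J> \<Longrightarrow> two_sided_ideal J) \<Longrightarrow> two_sided_ideal (\<Inter>\<J>)"
  unfolding two_sided_ideal_def by blast

lemma two_sided_ideal_minus:
  assumes "two_sided_ideal J" "x \<in> J"
  shows "- x \<in> J"
proof -
  have "- 1 * x \<in> J" using assms unfolding two_sided_ideal_def by blast
  then show ?thesis by simp
qed

lemma two_sided_ideal_equivp:
  assumes "two_sided_ideal (J :: 'a::ring_1 set)"
  shows "equivp (\<lambda>x y. x - y \<in> J)"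
proof (rule equivpI)
  show "reflp (\<lambda>x y. x - y \<in> J)"
    using assms by (simp add: reflp_def two_sided_ideal_def)
  show "symp (\<lambda>x y. x - y \<in> J)"
    using two_sided_ideal_minus[OF assms, of "_ - _"] by (auto intro!: sympI)
  have "x - z \<in> J" if "x - y \<in> J" "y - z \<in> J" for x y z
  proof -
    have "(x - y) + (y - z) \<in> J" using that assms unfolding two_sided_ideal_def by blast
    then show ?thesis by simp
  qed
  then show "transp (\<lambda>x y. x - y \<in> J)" by (auto intro: transpI)
qed

lemma two_sided_ideal_cong:
  assumes J: "two_sided_ideal J" and xy: "x - x' \<in> J" "y - y' \<in> J"
  shows "(x + y) - (x' + y') \<in> J" "(x - y) - (x' - y') \<in> J" "- x - (- x') \<in> J"
    "x * y - x' * y' \<in> J"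
proof -
  have add: "a + b \<in> J" if "a \<in> J" "b \<in> J" for a b using J that unfolding two_sided_ideal_def by blast
  note minus = two_sided_ideal_minus[OF J]
  show "(x + y) - (x' + y') \<in> J" using add[OF xy] by (simp add: algebra_simps)
  show "(x - y) - (x' - y') \<in> J" using add[OF xy(1) minus[OF xy(2)]] by (simp add: algebra_simps)
  show "- x - (- x') \<in> J" using minus[OF xy(1)] by (simp add: algebra_simps)
  have "(x - x') * y \<in> J" using J xy(1) unfolding two_sided_ideal_def by simp
  moreover have "x' * (y - y') \<in> J" using J xy(2) unfolding two_sided_ideal_def by simp
  ultimately have "(x - x') * y + x' * (y - y') \<in> J" by (rule add)
  then show "x * y - x' * y' \<in> J" by (simp add: algebra_simps)
qed

lemma lookup_mult_zero:
  fixes p q :: "'m::monoid_add \<Rightarrow>\<^sub>0 'a::semiring_0"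
  assumes "\<And>k l :: 'm. k + l = 0 \<longleftrightarrow> k = 0 \<and> l = 0"
  shows "Poly_Mapping.lookup (p * q) 0 = Poly_Mapping.lookup p 0 * Poly_Mapping.lookup q 0"
proof -
  have "(Poly_Mapping.lookup q l when 0 = k + l) = ((Poly_Mapping.lookup q l when 0 = l) when k = 0)" for k l
    using assms[of k l] by (auto simp: when_def)
  then have *: "Sum_any (\<lambda>l. Poly_Mapping.lookup q l when 0 = k + l) = (Poly_Mapping.lookup q 0 when k = 0)" for k
    by (cases "k = 0") simp_all
  show ?thesis unfolding lookup_mult * mult_when by simp
qed

text \<open>
  The variable indexed by \<open>(i, j, k)\<close> is \<open>x_ij^(-k-1)\<close>, the coefficient of \<open>u^k\<close> in \<open>x\<^sup>+_ij(u)\<close>.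
\<close>

type_synonym 'n x_poly = "(('n \<times> 'n \<times> nat) \<Rightarrow>\<^sub>0 nat) \<Rightarrow>\<^sub>0 complex"

definition x_var :: "'n \<times> 'n \<Rightarrow> nat \<Rightarrow> 'n x_poly" where
  "x_var e k = Poly_Mapping.single (Poly_Mapping.single (fst e, snd e, k) 1) 1"

definition trace_ideal :: "'n::finite x_poly fps set" where
  "trace_ideal = \<Inter>{J. two_sided_ideal J \<and> complete J \<and> (\<forall>k. fps_const (\<Sum>i\<in>UNIV. x_var (i, i) k) \<in> J)}"

lemma trace_ideal_ideal: "two_sided_ideal trace_ideal"
  unfolding trace_ideal_def by (rule two_sided_ideal_Inter) simp

lemma x_monomial_add_eq_0: "k + l = 0 \<longleftrightarrow> k = 0 \<and> l = 0" for k l :: "'b \<Rightarrow>\<^sub>0 nat"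
  by (auto simp: poly_mapping_eq_iff lookup_add fun_eq_iff)

lemma one_notin_trace_ideal: "1 \<notin> (trace_ideal :: 'n::finite x_poly fps set)"
proof -
  let ?J = "{f :: 'n x_poly fps. Poly_Mapping.lookup (fps_nth f 0) 0 = 0}"
  have "two_sided_ideal ?J"
    by (auto simp: two_sided_ideal_def lookup_add lookup_mult_zero[OF x_monomial_add_eq_0])
  moreover have "closed ?J"
  proof (unfold closed_sequential_limits, intro allI impI)
    show "l \<in> ?J" if "(\<forall>n. s n \<in> ?J) \<and> s \<longlonglongrightarrow> l" for s l
    proof -
      from that have "\<forall>\<^sub>F n in sequentially. fps_nth (s n) 0 = fps_nth l 0"
        by (simp add: tendsto_fps_iff)
      then obtain n where "fps_nth (s n) 0 = fps_nth l 0"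
        by (auto simp: eventually_sequentially)
      then show ?thesis using that by (metis (mono_tags, lifting) mem_Collect_eq)
    qed
  qed
  then have "complete ?J" by (simp add: complete_eq_closed)
  moreover have "fps_const (\<Sum>i\<in>UNIV. x_var (i, i) k) \<in> ?J" for k
  proof -
    have "Poly_Mapping.single (i, i, k) (Suc 0) \<noteq> 0" for i :: 'n
      by (metis lookup_single_eq lookup_zero nat.distinct(1))
    then show ?thesis by (simp add: x_var_def lookup_sum lookup_single)
  qed
  moreover have "1 \<notin> ?J" by (simp add: lookup_one)
  ultimately show ?thesis unfolding trace_ideal_def by blast
qed

quotient_type (overloaded) 'n hplus =
  "'n::finite x_poly fps" / "\<lambda>f g. f - g \<in> trace_ideal"
  by (rule two_sided_ideal_equivp[OF trace_ideal_ideal])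

instantiation hplus :: (finite) comm_ring_1
begin

lift_definition zero_hplus :: "'a hplus" is 0 .
lift_definition one_hplus :: "'a hplus" is 1 .
lift_definition plus_hplus :: "'a hplus \<Rightarrow> 'a hplus \<Rightarrow> 'a hplus" is "(+)"
  by (rule two_sided_ideal_cong[OF trace_ideal_ideal])
lift_definition minus_hplus :: "'a hplus \<Rightarrow> 'a hplus \<Rightarrow> 'a hplus" is "(-)"
  by (rule two_sided_ideal_cong[OF trace_ideal_ideal])
lift_definition uminus_hplus :: "'a hplus \<Rightarrow> 'a hplus" is uminus
  by (rule two_sided_ideal_cong(3)[OF trace_ideal_ideal])
lift_definition times_hplus :: "'a hplus \<Rightarrow> 'a hplus \<Rightarrow> 'a hplus" is "(*)"
  by (rule two_sided_ideal_cong[OF trace_ideal_ideal])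

instance
proof -
  have eq: "x - y \<in> trace_ideal" if "x = y" for x y :: "'a x_poly fps"
    using that trace_ideal_ideal[where 'a = 'a] unfolding two_sided_ideal_def by simp
  have 1: "(0 :: 'a x_poly fps) - 1 \<notin> trace_ideal"
    using two_sided_ideal_minus[OF trace_ideal_ideal, of "- 1"] one_notin_trace_ideal by auto
  show "OFCLASS('a hplus, comm_ring_1_class)"
  proof
    show "(0 :: 'a hplus) \<noteq> 1"
      using 1 by transfer
  qed (transfer, rule eq, simp add: algebra_simps)+
qed

end

definition hscalar :: "complex fps \<Rightarrow> 'n::finite hplus" where
  "hscalar f = abs_hplus (Abs_fps (\<lambda>k. Poly_Mapping.single 0 (fps_nth f k)))"

definition hgen :: "'n \<times> 'n \<Rightarrow> nat \<Rightarrow> 'n::finite hplus" where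
  "hgen e k = abs_hplus (fps_const (x_var e k))"

definition h_times :: "nat \<Rightarrow> 'n::finite hplus set \<Rightarrow> 'n hplus set" where
  "h_times k B = (\<lambda>v. hscalar (fps_X ^ k) * v) ` B"

definition hlinear :: "('n::finite hplus \<Rightarrow> 'n hplus) \<Rightarrow> bool" where
  "hlinear F \<longleftrightarrow> (\<forall>f v w. F (hscalar f * v + w) = hscalar f * F v + F w)"

text \<open>Unconditional convergence of a family to a sum in the \<open>h\<close>-adic topology.\<close>

definition has_hadic_sum :: "('i \<Rightarrow> 'n::finite hplus) \<Rightarrow> 'i set \<Rightarrow> 'n hplus \<Rightarrow> bool" where
  "has_hadic_sum a A s \<longleftrightarrow>
     (\<forall>k. \<exists>F0. finite F0 \<and> F0 \<subseteq> A \<and>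
        (\<forall>F. finite F \<and> F0 \<subseteq> F \<and> F \<subseteq> A \<longrightarrow> s - (\<Sum>i\<in>F. a i) \<in> h_times k UNIV))"


section \<open>Vertex operators on \<open>H\<^sup>+\<^sub>N\<close>\<close>

text \<open>
  Matrices over tensor factors \<open>0, 1, \<dots>, n\<close> are described by their coefficients at
  \<open>e 0 \<otimes> e 1 \<otimes> \<dots> \<otimes> e n\<close>, where \<open>e l = (i, j)\<close> stands for the matrix unit \<open>e_ij\<close> in factor \<open>l\<close>. In
  all products below the matrix parts sit in pairwise different tensor factors, so that the
  coefficient of a product is the product of the coefficients of its factors.

  \<open>xm (i, j) m\<close> is the operator \<open>x_ij^(m)\<close>, the coefficient of \<open>u^(-m-1)\<close> in \<open>x\<^sup>-_ij(u)\<close>; the defining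
  relation is compared at \<open>u_0^(-m-1) u_1^(q 1) \<dots> u_n^(q n)\<close>.
\<close>

definition is_x_minus :: "complex \<Rightarrow> ('n::finite \<times> 'n \<Rightarrow> nat \<Rightarrow> 'n hplus \<Rightarrow> 'n hplus) \<Rightarrow> bool" where
  "is_x_minus c xm \<longleftrightarrow>
     (\<forall>e m. hlinear (xm e m)) \<and>
     (\<forall>e v k. \<exists>M. \<forall>m\<ge>M. xm e m v \<in> h_times k UNIV) \<and>
     (\<forall>e m. xm e m 1 = 0) \<and>
     (\<forall>n::nat\<ge>1. \<forall>e m q.
        xm (e 0) m (\<Prod>l\<in>{1..n}. hgen (e l) (q l)) =
        - (\<Sum>j\<in>{1..n}. hscalar (S_diff_coeff c (e 0) (e j) (- int m - 1) (int (q j))) *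
             (\<Prod>l\<in>{1..n} - {j}. hgen (e l) (q l))))"

text \<open>Coefficient of \<open>u^p\<close> in \<open>x_ij(u) = x\<^sup>+_ij(u) + x\<^sup>-_ij(u)\<close>.\<close>

definition x_op :: "('n::finite \<times> 'n \<Rightarrow> nat \<Rightarrow> 'n hplus \<Rightarrow> 'n hplus) \<Rightarrow> 'n \<times> 'n \<Rightarrow> int \<Rightarrow> 'n hplus \<Rightarrow> 'n hplus" where
  "x_op xm e p v = (if p \<ge> 0 then hgen e (nat p) * v else xm e (nat (- p - 1)) v)"

definition pairings :: "nat \<Rightarrow> nat \<Rightarrow> (nat \<times> nat) set set" where
  "pairings n k =
     {I. I \<subseteq> {1..n} \<times> {1..n} \<and> card I = k \<and> (\<forall>(p, q)\<in>I. p < q) \<and>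
         (\<forall>x\<in>I. \<forall>y\<in>I. x \<noteq> y \<longrightarrow> {fst x, snd x} \<inter> {fst y, snd y} = {})}"

text \<open>Coefficient of \<open>u_1^(p 1) \<dots> u_n^(p n)\<close> in \<open>x\<^bsub>[n]\<^esub>(u_1, \<dots>, u_n) w\<close>.\<close>

definition x_bracket ::
  "complex \<Rightarrow> ('n::finite \<times> 'n \<Rightarrow> nat \<Rightarrow> 'n hplus \<Rightarrow> 'n hplus) \<Rightarrow> nat \<Rightarrow>
     (nat \<Rightarrow> 'n \<times> 'n) \<Rightarrow> (nat \<Rightarrow> int) \<Rightarrow> 'n hplus \<Rightarrow> 'n hplus" where
  "x_bracket c xm n e p w =
     (\<Sum>k\<in>{0..n div 2}. \<Sum>I\<in>pairings n k.
        hscalar (\<Prod>(a, b)\<in>I. S_diff_coeff c (e a) (e b) (p a) (p b)) *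
        foldr (\<lambda>l. x_op xm (e l) (p l)) (sorted_list_of_set ({1..n} - (fst ` I \<union> snd ` I))) w)"

text \<open>
  \<open>Y v r w\<close> is the coefficient of \<open>z^(-r-1)\<close> in \<open>Y(v, z) w\<close>. The last clause is
  \<open>Y(x\<^sup>+\<^bsub>[n]\<^esub>(u_1, \<dots>, u_n), z) = x\<^bsub>[n]\<^esub>(z + u_1, \<dots>, z + u_n)\<close> at \<open>u_1^(q 1) \<dots> u_n^(q n) z^(-r-1)\<close>: a term
  \<open>v_1^(p 1) \<dots> v_n^(p n)\<close> of \<open>x\<^bsub>[n]\<^esub>(v_1, \<dots>, v_n)\<close> contributes, after \<open>v_l = z + u_l\<close>, the product of the
  binomial coefficients of \<open>p l\<close> over \<open>q l\<close>. The substitution applies to \<open>x\<^bsub>[n]\<^esub>\<close> as a whole; its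
  individual summands need not lie in \<open>Hom(H, H((u_1, \<dots>, u_n))\<^sub>h)\<close>.
\<close>

definition is_vertex_operator_map ::
  "complex \<Rightarrow> ('n::finite \<times> 'n \<Rightarrow> nat \<Rightarrow> 'n hplus \<Rightarrow> 'n hplus) \<Rightarrow>
     ('n hplus \<Rightarrow> int \<Rightarrow> 'n hplus \<Rightarrow> 'n hplus) \<Rightarrow> bool" where
  "is_vertex_operator_map c xm Y \<longleftrightarrow>
     (\<forall>r w. hlinear (\<lambda>v. Y v r w)) \<and>
     (\<forall>v r. hlinear (Y v r)) \<and>
     (\<forall>v w k. \<exists>M. \<forall>r\<ge>M. Y v r w \<in> h_times k UNIV) \<and>
     (\<forall>n e q r w.
        has_hadic_sum
          (\<lambda>p. hscalar (fps_const (\<Prod>l\<in>{1..n}. of_int (p l) gchoose q l)) * x_bracket c xm n e p w)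
          {p. (\<forall>l. l \<notin> {1..n} \<longrightarrow> p l = 0) \<and> (\<Sum>l\<in>{1..n}. p l - int (q l)) = - r - 1}
          (Y (\<Prod>l\<in>{1..n}. hgen (e l) (q l)) r w))"


section \<open>Quotient spaces and vertex algebras\<close>

definition complex_field :: "complex ring" where
  "complex_field = \<lparr>carrier = UNIV, monoid.mult = (*), one = 1, zero = 0, add = (+)\<rparr>"

definition coset :: "'a::plus set \<Rightarrow> 'a \<Rightarrow> 'a set" where
  "coset K x = (+) x ` K"

text \<open>
  \<open>V / K\<close> for subspaces \<open>K \<subseteq> V\<close>, with scalar action \<open>s\<close>, together with a multiplication and a
  unit (the underlying algebra structure).
\<close>

definition quotient_algebra ::
  "(complex \<Rightarrow> 'a \<Rightarrow> 'a) \<Rightarrow> 'a::ab_group_add set \<Rightarrow> 'a set \<Rightarrow> ('a set \<Rightarrow> 'a set \<Rightarrow> 'a set) \<Rightarrow> 'a set \<Rightarrow>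
     (complex, 'a set) module" where
  "quotient_algebra s V K mul e =
     \<lparr>carrier = coset K ` V, monoid.mult = mul, one = e, zero = K,
      add = (\<lambda>A B. \<Union>a\<in>A. \<Union>b\<in>B. coset K (a + b)),
      smult = (\<lambda>\<alpha> A. \<Union>a\<in>A. coset K (s \<alpha> a))\<rparr>"

text \<open>
  \<open>Y a n b\<close> is the coefficient \<open>a\<^sub>n b\<close> of \<open>z^(-n-1)\<close> in \<open>Y(a, z) b\<close>. The last axiom is the Jacobi identity
  in coefficients (the Borcherds identity); by truncation all its sums are finite.
\<close>

definition vertex_algebra :: "(complex, 'v) module \<Rightarrow> 'v \<Rightarrow> ('v \<Rightarrow> int \<Rightarrow> 'v \<Rightarrow> 'v) \<Rightarrow> bool" where
  "vertex_algebra M vac Y \<longleftrightarrow>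
     Module.module complex_field M \<and> vac \<in> carrier M \<and>
     (\<forall>a\<in>carrier M. \<forall>b\<in>carrier M. \<forall>n. Y a n b \<in> carrier M) \<and>
     (\<forall>\<alpha>. \<forall>a\<in>carrier M. \<forall>a'\<in>carrier M. \<forall>b\<in>carrier M. \<forall>n.
        Y (\<alpha> \<odot>\<^bsub>M\<^esub> a \<oplus>\<^bsub>M\<^esub> a') n b = \<alpha> \<odot>\<^bsub>M\<^esub> Y a n b \<oplus>\<^bsub>M\<^esub> Y a' n b \<and>
        Y b n (\<alpha> \<odot>\<^bsub>M\<^esub> a \<oplus>\<^bsub>M\<^esub> a') = \<alpha> \<odot>\<^bsub>M\<^esub> Y b n a \<oplus>\<^bsub>M\<^esub> Y b n a') \<and>
     (\<forall>a\<in>carrier M. \<forall>b\<in>carrier M. \<exists>n0. \<forall>n\<ge>n0. Y a n b = \<zero>\<^bsub>M\<^esub>) \<and>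
     (\<forall>b\<in>carrier M. \<forall>n. Y vac n b = (if n = - 1 then b else \<zero>\<^bsub>M\<^esub>)) \<and>
     (\<forall>a\<in>carrier M. Y a (- 1) vac = a \<and> (\<forall>n\<ge>0. Y a n vac = \<zero>\<^bsub>M\<^esub>)) \<and>
     (\<forall>a\<in>carrier M. \<forall>b\<in>carrier M. \<forall>d\<in>carrier M. \<forall>l m n :: int.
        \<exists>J0 :: nat. \<forall>J\<ge>J0.
          (\<Oplus>\<^bsub>M\<^esub>j\<in>{..J}. (of_int m gchoose j) \<odot>\<^bsub>M\<^esub> Y (Y a (l + int j) b) (m + n - int j) d) =
          (\<Oplus>\<^bsub>M\<^esub>j\<in>{..J}. ((- 1) ^ j * (of_int l gchoose j)) \<odot>\<^bsub>M\<^esub>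
             (Y a (m + l - int j) (Y b (n + int j) d) \<oplus>\<^bsub>M\<^esub>
              (- ((- 1) powi l)) \<odot>\<^bsub>M\<^esub> Y b (n + l - int j) (Y a (m + int j) d))))"

definition vertex_algebra_iso ::
  "(complex, 'v) module \<Rightarrow> 'v \<Rightarrow> ('v \<Rightarrow> int \<Rightarrow> 'v \<Rightarrow> 'v) \<Rightarrow>
   (complex, 'w) module \<Rightarrow> 'w \<Rightarrow> ('w \<Rightarrow> int \<Rightarrow> 'w \<Rightarrow> 'w) \<Rightarrow> ('v \<Rightarrow> 'w) \<Rightarrow> bool" where
  "vertex_algebra_iso M vac Y M' vac' Y' \<phi> \<longleftrightarrow>
     vertex_algebra M vac Y \<and> vertex_algebra M' vac' Y' \<and>
     bij_betw \<phi> (carrier M) (carrier M') \<and>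
     (\<forall>\<alpha>. \<forall>a\<in>carrier M. \<forall>b\<in>carrier M. \<phi> (\<alpha> \<odot>\<^bsub>M\<^esub> a \<oplus>\<^bsub>M\<^esub> b) = \<alpha> \<odot>\<^bsub>M'\<^esub> \<phi> a \<oplus>\<^bsub>M'\<^esub> \<phi> b) \<and>
     \<phi> vac = vac' \<and>
     (\<forall>a\<in>carrier M. \<forall>b\<in>carrier M. \<forall>n. \<phi> (Y a n b) = Y' (\<phi> a) n (\<phi> b))"

definition algebra_iso :: "(complex, 'v) module \<Rightarrow> (complex, 'w) module \<Rightarrow> ('v \<Rightarrow> 'w) \<Rightarrow> bool" where
  "algebra_iso M M' \<phi> \<longleftrightarrow>
     algebra complex_field M \<and> algebra complex_field M' \<and> \<phi> \<in> ring_iso M M' \<and>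
     (\<forall>\<alpha>. \<forall>a\<in>carrier M. \<phi> (\<alpha> \<odot>\<^bsub>M\<^esub> a) = \<alpha> \<odot>\<^bsub>M'\<^esub> \<phi> a)"


section \<open>The classical limit of \<open>V\<^sub>H(c)\<close>\<close>

definition topologically_free :: "'n::finite hplus set \<Rightarrow> bool" where
  "topologically_free B \<longleftrightarrow>
     (\<forall>f v. f \<noteq> 0 \<and> v \<in> B \<and> hscalar f * v = 0 \<longrightarrow> v = 0) \<and>
     (\<Inter>k. h_times k B) = {0} \<and>
     (\<forall>s :: nat \<Rightarrow> _. (\<forall>n. s n \<in> B) \<and> (\<forall>k. \<exists>M. \<forall>m\<ge>M. \<forall>n\<ge>M. s m - s n \<in> h_times k B) \<longrightarrow>
          (\<exists>l\<in>B. \<forall>k. \<exists>M. \<forall>n\<ge>M. s n - l \<in> h_times k B))"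

definition h_subalgebra :: "'n::finite hplus set \<Rightarrow> bool" where
  "h_subalgebra B \<longleftrightarrow> 1 \<in> B \<and> (\<forall>v\<in>B. \<forall>w\<in>B. v + w \<in> B \<and> v * w \<in> B) \<and> (\<forall>f. \<forall>v\<in>B. hscalar f * v \<in> B)"

definition VH :: "'n::finite hplus set" where
  "VH = \<Inter>{B. h_subalgebra B \<and> topologically_free B \<and> (\<forall>i k. hgen (i, i) k \<in> B)}"

abbreviation VH_class :: "'n::finite hplus \<Rightarrow> 'n hplus set" where
  "VH_class \<equiv> coset (h_times 1 VH)"

definition VH_limit :: "(complex, 'n::finite hplus set) module" where
  "VH_limit = quotient_algebra (\<lambda>\<alpha> v. hscalar (fps_const \<alpha>) * v) VH (h_times 1 VH)
     (\<lambda>A B. \<Union>a\<in>A. \<Union>b\<in>B. VH_class (a * b)) (VH_class 1)"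

definition limit_vertex_map ::
  "('n::finite hplus \<Rightarrow> int \<Rightarrow> 'n hplus \<Rightarrow> 'n hplus) \<Rightarrow> 'n hplus set \<Rightarrow> int \<Rightarrow> 'n hplus set \<Rightarrow> 'n hplus set" where
  "limit_vertex_map Y A r B = (\<Union>a\<in>A. \<Union>b\<in>B. VH_class (Y a r b))"


section \<open>The Heisenberg vertex algebra\<close>

text \<open>\<open>cartan\<close> is spanned by \<open>a_i\<close>, the class of \<open>axis i 1\<close>, with relation \<open>a_1 + \<dots> + a_N = 0\<close>.\<close>

quotient_type 'n cartan = "complex ^ 'n::finite" / "\<lambda>x y. \<exists>t. x - y = (\<chi> i. t)"
proof (rule equivpI)
  show "reflp (\<lambda>x y :: complex ^ 'n. \<exists>t. x - y = (\<chi> i. t))"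
    by (auto simp: reflp_def vec_eq_iff)
  have "\<exists>t. y - x = (\<chi> i. t)" if "x - y = (\<chi> i. t)" for x y :: "complex ^ 'n" and t
    using that by (intro exI[of _ "- t"]) (auto simp: vec_eq_iff algebra_simps)
  then show "symp (\<lambda>x y :: complex ^ 'n. \<exists>t. x - y = (\<chi> i. t))" by (auto intro: sympI)
  show "transp (\<lambda>x y :: complex ^ 'n. \<exists>t. x - y = (\<chi> i. t))"
  proof (rule transpI, elim exE)
    show "\<exists>t. x - z = (\<chi> i. t)" if "x - y = (\<chi> i. t)" "y - z = (\<chi> i. t')"
      for x y z :: "complex ^ 'n" and t t'
      using that by (intro exI[of _ "t + t'"]) (auto simp: vec_eq_iff algebra_simps)
  qed
qed

instantiation cartan :: (finite) ab_group_add
begin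

lift_definition zero_cartan :: "'a cartan" is 0 .
lift_definition plus_cartan :: "'a cartan \<Rightarrow> 'a cartan \<Rightarrow> 'a cartan" is "(+)"
proof -
  fix x x' y y' :: "complex ^ 'a"
  assume "\<exists>t. x - x' = (\<chi> i. t)" "\<exists>t. y - y' = (\<chi> i. t)"
  then obtain s t where "x - x' = (\<chi> i. s)" "y - y' = (\<chi> i. t)" by blast
  then show "\<exists>t. x + y - (x' + y') = (\<chi> i. t)"
    by (intro exI[of _ "s + t"]) (auto simp: vec_eq_iff algebra_simps)
qed
lift_definition uminus_cartan :: "'a cartan \<Rightarrow> 'a cartan" is uminus
proof -
  fix x x' :: "complex ^ 'a"
  assume "\<exists>t. x - x' = (\<chi> i. t)"
  then obtain s where "x - x' = (\<chi> i. s)" by blast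
  then show "\<exists>t. - x - (- x') = (\<chi> i. t)"
    by (intro exI[of _ "- s"]) (auto simp: vec_eq_iff algebra_simps)
qed
lift_definition minus_cartan :: "'a cartan \<Rightarrow> 'a cartan \<Rightarrow> 'a cartan" is "(-)"
proof -
  fix x x' y y' :: "complex ^ 'a"
  assume "\<exists>t. x - x' = (\<chi> i. t)" "\<exists>t. y - y' = (\<chi> i. t)"
  then obtain s t where "x - x' = (\<chi> i. s)" "y - y' = (\<chi> i. t)" by blast
  then show "\<exists>t. x - y - (x' - y') = (\<chi> i. t)"
    by (intro exI[of _ "s - t"]) (auto simp: vec_eq_iff algebra_simps)
qed

instance
  by standard (transfer; auto simp: vec_eq_iff algebra_simps intro!: exI[of _ 0])+

end

lift_definition cartan_scale :: "complex \<Rightarrow> 'n::finite cartan \<Rightarrow> 'n cartan" is "(*s)"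
proof -
  fix \<alpha> and x x' :: "complex ^ 'n"
  assume "\<exists>t. x - x' = (\<chi> i. t)"
  then obtain s where "x - x' = (\<chi> i. s)" by blast
  then show "\<exists>t. \<alpha> *s x - \<alpha> *s x' = (\<chi> i. t)"
    by (intro exI[of _ "\<alpha> * s"]) (auto simp: vec_eq_iff algebra_simps)
qed

lift_definition cartan_gen :: "'n::finite \<Rightarrow> 'n cartan" is "\<lambda>i. axis i 1" .

text \<open>The bilinear form with \<open>\<langle>a_i, a_j\<rangle> = \<delta>_ij - 1/N\<close>.\<close>

lift_definition cartan_form :: "'n::finite cartan \<Rightarrow> 'n cartan \<Rightarrow> complex" is
  "\<lambda>x y. \<Sum>i\<in>UNIV. \<Sum>j\<in>UNIV. x $ i * y $ j * ((if i = j then 1 else 0) - 1 / of_nat CARD('n))"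
proof -
  fix x x' y y' :: "complex ^ 'n"
  let ?b = "\<lambda>i j :: 'n. (if i = j then 1 else 0) - 1 / of_nat CARD('n) :: complex"
  assume "\<exists>t. x - x' = (\<chi> i. t)" "\<exists>t. y - y' = (\<chi> i. t)"
  then obtain s t where "x - x' = (\<chi> i. s)" "y - y' = (\<chi> i. t)" by blast
  then have x: "x $ i = x' $ i + s" and y: "y $ i = y' $ i + t" for i
    by (auto simp: vec_eq_iff algebra_simps)
  have b: "(\<Sum>j\<in>UNIV. ?b i j) = 0" "(\<Sum>j\<in>UNIV. ?b j i) = 0" for i
    by (simp_all add: sum_subtractf)
  have yy: "(\<Sum>j\<in>UNIV. y $ j * ?b i j) = (\<Sum>j\<in>UNIV. y' $ j * ?b i j)" for i
  proof -
    have "(\<Sum>j\<in>UNIV. y $ j * ?b i j) = (\<Sum>j\<in>UNIV. y' $ j * ?b i j) + t * (\<Sum>j\<in>UNIV. ?b i j)"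
      unfolding y by (simp only: distrib_right sum.distrib sum_distrib_left)
    then show ?thesis using b by simp
  qed
  have "(\<Sum>i\<in>UNIV. \<Sum>j\<in>UNIV. x $ i * y $ j * ?b i j) = (\<Sum>i\<in>UNIV. x $ i * (\<Sum>j\<in>UNIV. y' $ j * ?b i j))"
    by (simp only: mult.assoc flip: sum_distrib_left) (simp only: yy)
  also have "\<dots> = (\<Sum>i\<in>UNIV. x' $ i * (\<Sum>j\<in>UNIV. y' $ j * ?b i j)) + s * (\<Sum>i\<in>UNIV. \<Sum>j\<in>UNIV. y' $ j * ?b i j)"
    unfolding x by (simp only: distrib_right sum.distrib sum_distrib_left)
  also have "(\<Sum>i\<in>UNIV. \<Sum>j\<in>UNIV. y' $ j * ?b i j) = (\<Sum>j\<in>UNIV. y' $ j * (\<Sum>i\<in>UNIV. ?b i j))"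
    by (subst sum.swap) (simp only: sum_distrib_left)
  also have "\<dots> = 0" by (simp only: b mult_zero_right sum.neutral_const)
  finally show "(\<Sum>i\<in>UNIV. \<Sum>j\<in>UNIV. x $ i * y $ j * ?b i j) = (\<Sum>i\<in>UNIV. \<Sum>j\<in>UNIV. x' $ i * y' $ j * ?b i j)"
    by (simp only: mult.assoc mult_zero_right add_0_right flip: sum_distrib_left)
qed

text \<open>
  \<open>heis\<close> is the Lie algebra \<open>\<hh>\<otimes>\<complex>[t, t^(-1)] \<oplus> \<complex>C\<close>: the first component is a Laurent polynomial with
  coefficients in \<open>cartan\<close>, the second one the coefficient of \<open>C\<close>.
\<close>

type_synonym 'n heis = "(int \<Rightarrow>\<^sub>0 'n cartan) \<times> complex"

definition heis_scale :: "complex \<Rightarrow> 'n::finite heis \<Rightarrow> 'n heis" where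
  "heis_scale \<alpha> x = (Poly_Mapping.mapp (\<lambda>_. cartan_scale \<alpha>) (fst x), \<alpha> * snd x)"

definition heis_bracket :: "'n::finite heis \<Rightarrow> 'n heis \<Rightarrow> 'n heis" where
  "heis_bracket x y =
     (0, \<Sum>r\<in>Poly_Mapping.keys (fst x). \<Sum>s\<in>Poly_Mapping.keys (fst y).
           if r + s = 0 then cartan_form (Poly_Mapping.lookup (fst x) r) (Poly_Mapping.lookup (fst y) s) * of_int r else 0)"

definition heis_mode :: "'n::finite cartan \<Rightarrow> int \<Rightarrow> 'n heis" where
  "heis_mode a r = (Poly_Mapping.single r a, 0)"

text \<open>
  The universal enveloping algebra is the quotient of the free associative algebra on the set
  underlying the Lie algebra by linearity and by the bracket relations. The free algebra is the monoid
  algebra of the free monoid.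
\<close>

datatype 'a word = Word (letters: "'a list")

instantiation word :: (type) monoid_add
begin

definition "0 = Word []"
definition "v + w = Word (letters v @ letters w)"

instance
  by standard (simp_all add: zero_word_def plus_word_def)

end

type_synonym 'n heis_free = "'n heis word \<Rightarrow>\<^sub>0 complex"

definition free_gen :: "'n::finite heis \<Rightarrow> 'n heis_free" where
  "free_gen x = Poly_Mapping.single (Word [x]) 1"

definition uea_ideal :: "'n::finite heis_free set" where
  "uea_ideal = \<Inter>{J. two_sided_ideal J \<and>
     (\<forall>x y. free_gen (x + y) - free_gen x - free_gen y \<in> J) \<and>
     (\<forall>\<alpha> x. free_gen (heis_scale \<alpha> x) - Poly_Mapping.single 0 \<alpha> * free_gen x \<in> J) \<and>
     (\<forall>x y. free_gen x * free_gen y - free_gen y * free_gen x - free_gen (heis_bracket x y) \<in> J)}"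

lemma uea_ideal_ideal: "two_sided_ideal uea_ideal"
  unfolding uea_ideal_def by (rule two_sided_ideal_Inter) simp

lemma word_add_eq_0: "k + l = 0 \<longleftrightarrow> k = 0 \<and> l = 0" for k l :: "'a word"
  by (cases k; cases l) (auto simp: zero_word_def plus_word_def)

lemma one_notin_uea_ideal: "1 \<notin> (uea_ideal :: 'n::finite heis_free set)"
proof -
  let ?J = "{f :: 'n heis_free. Poly_Mapping.lookup f 0 = 0}"
  have gen: "Poly_Mapping.lookup (free_gen x) 0 = 0" for x :: "'n heis"
    by (simp add: free_gen_def lookup_single zero_word_def)
  have "two_sided_ideal ?J"
    by (auto simp: two_sided_ideal_def lookup_add lookup_mult_zero[OF word_add_eq_0])
  moreover have "1 \<notin> ?J" by (simp add: lookup_one)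
  moreover have "free_gen (x + y) - free_gen x - free_gen y \<in> ?J"
    "free_gen (heis_scale \<alpha> x) - Poly_Mapping.single 0 \<alpha> * free_gen x \<in> ?J"
    "free_gen x * free_gen y - free_gen y * free_gen x - free_gen (heis_bracket x y) \<in> ?J"
    for x y :: "'n heis" and \<alpha>
    by (simp_all only: mem_Collect_eq lookup_minus lookup_mult_zero[OF word_add_eq_0] gen) simp_all
  ultimately show ?thesis unfolding uea_ideal_def by blast
qed

quotient_type (overloaded) 'n uea = "'n::finite heis_free" / "\<lambda>f g. f - g \<in> uea_ideal"
  by (rule two_sided_ideal_equivp[OF uea_ideal_ideal])

instantiation uea :: (finite) ring_1
begin

lift_definition zero_uea :: "'a uea" is 0 .
lift_definition one_uea :: "'a uea" is 1 .
lift_definition plus_uea :: "'a uea \<Rightarrow> 'a uea \<Rightarrow> 'a uea" is "(+)"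
  by (rule two_sided_ideal_cong[OF uea_ideal_ideal])
lift_definition minus_uea :: "'a uea \<Rightarrow> 'a uea \<Rightarrow> 'a uea" is "(-)"
  by (rule two_sided_ideal_cong[OF uea_ideal_ideal])
lift_definition uminus_uea :: "'a uea \<Rightarrow> 'a uea" is uminus
  by (rule two_sided_ideal_cong(3)[OF uea_ideal_ideal])
lift_definition times_uea :: "'a uea \<Rightarrow> 'a uea \<Rightarrow> 'a uea" is "(*)"
  by (rule two_sided_ideal_cong[OF uea_ideal_ideal])

instance
proof -
  have eq: "x - y \<in> uea_ideal" if "x = y" for x y :: "'a heis_free"
    using that uea_ideal_ideal[where 'a = 'a] unfolding two_sided_ideal_def by simp
  have 1: "(0 :: 'a heis_free) - 1 \<notin> uea_ideal"
    using two_sided_ideal_minus[OF uea_ideal_ideal, of "- 1"] one_notin_uea_ideal by auto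
  show "OFCLASS('a uea, ring_1_class)"
  proof
    show "(0 :: 'a uea) \<noteq> 1"
      using 1 by transfer
  qed (transfer, rule eq, simp add: algebra_simps)+
qed

end

lift_definition uea_gen :: "'n::finite heis \<Rightarrow> 'n uea" is free_gen .

lift_definition uea_scalar :: "complex \<Rightarrow> 'n::finite uea" is "Poly_Mapping.single 0" .

text \<open>
  The induced module \<open>U(g) \<otimes>\<^bsub>U(b)\<^esub> \<complex>\<^sub>c\<close>, with \<open>b = \<hh>\<otimes>\<complex>[t] \<oplus> \<complex>C\<close> acting on \<open>\<complex>\<^sub>c = \<complex>\<close> by the character
  \<open>\<chi>\<close> that vanishes on \<open>\<hh>\<otimes>\<complex>[t]\<close> and sends \<open>C\<close> to \<open>c\<close>, is the quotient of \<open>U(g)\<close> by the left ideal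
  generated by the elements \<open>y - \<chi>(y)\<close> for \<open>y\<close> in \<open>b\<close>; the class of \<open>u\<close> is \<open>u \<otimes> 1\<close>.
\<close>

definition left_ideal :: "'a::ring_1 set \<Rightarrow> bool" where
  "left_ideal K \<longleftrightarrow> 0 \<in> K \<and> (\<forall>x\<in>K. \<forall>y\<in>K. x + y \<in> K) \<and> (\<forall>a. \<forall>x\<in>K. a * x \<in> K)"

definition induced_relations :: "complex \<Rightarrow> 'n::finite uea set" where
  "induced_relations c =
     \<Inter>{K. left_ideal K \<and> (\<forall>f z. Poly_Mapping.keys f \<subseteq> {0..} \<longrightarrow> uea_gen (f, z) - uea_scalar (c * z) \<in> K)}"

abbreviation heis_class :: "complex \<Rightarrow> 'n::finite uea \<Rightarrow> 'n uea set" where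
  "heis_class c \<equiv> coset (induced_relations c)"

text \<open>The image of \<open>U(\<hh>\<otimes>t^(-1)\<complex>[t^(-1)])\<close> in the enveloping algebra.\<close>

definition uea_negative :: "'n::finite uea set" where
  "uea_negative =
     \<Inter>{B. 1 \<in> B \<and> (\<forall>u\<in>B. \<forall>v\<in>B. u + v \<in> B \<and> u * v \<in> B) \<and> (\<forall>\<alpha>. \<forall>u\<in>B. uea_scalar \<alpha> * u \<in> B) \<and>
         (\<forall>f. Poly_Mapping.keys f \<subseteq> {..<0} \<longrightarrow> uea_gen (f, 0) \<in> B)}"

text \<open>
  The multiplication is the one of the commutative algebra \<open>U(\<hh>\<otimes>t^(-1)\<complex>[t^(-1)])\<close>, transported along the
  isomorphism \<open>u \<mapsto> u \<otimes> 1\<close>.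
\<close>

definition heis_space :: "complex \<Rightarrow> (complex, 'n::finite uea set) module" where
  "heis_space c = quotient_algebra (\<lambda>\<alpha> u. uea_scalar \<alpha> * u) UNIV (induced_relations c)
     (\<lambda>A B. \<Union>u\<in>A \<inter> uea_negative. \<Union>v\<in>B \<inter> uea_negative. heis_class c (u * v)) (heis_class c 1)"

definition is_heisenberg_vertex_map ::
  "complex \<Rightarrow> ('n::finite uea set \<Rightarrow> int \<Rightarrow> 'n uea set \<Rightarrow> 'n uea set) \<Rightarrow> bool" where
  "is_heisenberg_vertex_map c Y \<longleftrightarrow>
     vertex_algebra (heis_space c) (heis_class c 1) Y \<and>
     (\<forall>a r u. Y (heis_class c (uea_gen (heis_mode a (- 1)))) r (heis_class c u) =
        heis_class c (uea_gen (heis_mode a r) * u))"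

text \<open>
  The identification of the underlying spaces: the algebra isomorphism sending the class of
  \<open>x_ii^(-k-1)\<close> to \<open>a_i(-k-1) 1\<close>.
\<close>

definition is_identification :: "complex \<Rightarrow> ('n::finite hplus set \<Rightarrow> 'n uea set) \<Rightarrow> bool" where
  "is_identification c \<phi> \<longleftrightarrow>
     algebra_iso VH_limit (heis_space c) \<phi> \<and>
     (\<forall>i k. \<phi> (VH_class (hgen (i, i) k)) = heis_class c (uea_gen (heis_mode (cartan_gen i) (- int k - 1))))"

end

theory Submission
  imports Defs
begin

text \<open>
  Modulo \<open>h\<close> only the leading term \<open>c (I/N - P) u^(-2)\<close> of \<open>S(u)\<close> survives, so the coefficients of
  \<open>x_ii(u)\<close> satisfy the relations of the Heisenberg algebra on the reduction \<open>x_quot\<close> of \<open>H\<^sup>+\<^sub>N\<close> and make it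
  a Fock module. Acting on the vacuum embeds \<open>V(c)\<close> into \<open>x_quot\<close>, with the same image as the
  classical limit of \<open>V_H(c)\<close>. The coefficients of \<open>S\<close> are scalars, so that Wick's theorem holds
  even before reduction: \<open>x\<^bsub>[n]\<^esub>(u_1, \<dots>, u_n)\<close> is the normally ordered product of the \<open>x(u_i)\<close>. Hence
  the quantum vertex operators of monomials satisfy, modulo \<open>h\<close>, the recursion in the number of
  factors that the Borcherds identity imposes on the Heisenberg side. The axioms of a vertex
  algebra for the classical limit are then transported from the Heisenberg vertex algebra.
\<close>

section \<open>Evaluation of polynomial mappings\<close>

text \<open>What needs an argument is that acting on the vacuum is injective. No
  Poincare-Birkhoff-Witt theorem enters. Polynomials in the variables \<open>x_ij^(-r)\<close> are
  evaluated in the algebra of negative modes, which is commutative. Trace relations evaluate to 0,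
  so evaluation undoes the passage from a negative element to its value on the vacuum. Together with
  the reduction of every element of the enveloping algebra to a negative one, this identifies the
  induced relations as the kernel of the vacuum value. The form is never inverted, so the degenerate
  level c = 0 is no special case.

  Two obstacles shape the rest. Both carriers consist of cosets; embedding them in the commutative
  ring \<open>x_quot\<close>, with the same image, turns every law and every axiom into an equation
  between ring elements. And a coefficient of a quantum vertex operator is only an
  \<open>h\<close>-adically convergent sum; modulo \<open>h\<close> it equals every sufficiently
  large finite partial sum, which can be regrouped and compared with the truncated sums of the
  Borcherds identity.\<close>

lemma poly_mapping_single_induct [case_names zero add]:
  fixes f :: "'a \<Rightarrow>\<^sub>0 'b::comm_monoid_add"
  assumes "P 0" and "\<And>k a f. P f \<Longrightarrow> P (Poly_Mapping.single k a + f)"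
  shows "P f"
proof (induction f rule: update_induct)
  case (update f a b)
  have "Poly_Mapping.update a b f = Poly_Mapping.single a b + f"
    using update(1) by (intro poly_mapping_eqI) (auto simp: lookup_update lookup_add lookup_single in_keys_iff when_def)
  then show ?case using assms(2)[OF update(3)] by simp
qed fact

definition pm_sum :: "('k \<Rightarrow> 'a \<Rightarrow> 'c) \<Rightarrow> ('k \<Rightarrow>\<^sub>0 'a::zero) \<Rightarrow> 'c::comm_monoid_add" where
  "pm_sum F f = (\<Sum>k\<in>Poly_Mapping.keys f. F k (Poly_Mapping.lookup f k))"

lemma pm_sum_zero [simp]: "pm_sum F 0 = 0"
  by (simp add: pm_sum_def)

lemma pm_sum_add:
  assumes "\<And>k. F k 0 = 0" "\<And>k a b. F k (a + b) = F k a + F k b"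
  shows "pm_sum F (f + g) = pm_sum F f + pm_sum F g"
  unfolding pm_sum_def by (rule setsum_keys_plus_distrib) (use assms in auto)

lemma pm_sum_single [simp]:
  assumes "F k 0 = 0"
  shows "pm_sum F (Poly_Mapping.single k a) = F k a"
  using assms by (cases "a = 0") (auto simp: pm_sum_def)

definition monom_eval :: "('v \<Rightarrow> 'r) \<Rightarrow> ('v \<Rightarrow>\<^sub>0 nat) \<Rightarrow> 'r::comm_monoid_mult" where
  "monom_eval s m = (\<Prod>v\<in>Poly_Mapping.keys m. s v ^ Poly_Mapping.lookup m v)"

lemma monom_eval_superset:
  assumes "finite A" "Poly_Mapping.keys m \<subseteq> A"
  shows "monom_eval s m = (\<Prod>v\<in>A. s v ^ Poly_Mapping.lookup m v)"
  unfolding monom_eval_def using assms by (intro prod.mono_neutral_left) (auto simp: in_keys_iff)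

lemma monom_eval_zero [simp]: "monom_eval s 0 = 1"
  by (simp add: monom_eval_def)

lemma monom_eval_single [simp]: "monom_eval s (Poly_Mapping.single v 1) = s v"
  by (simp add: monom_eval_def)

lemma monom_eval_add: "monom_eval s (m + m') = monom_eval s m * monom_eval s m'"
proof -
  let ?A = "Poly_Mapping.keys m \<union> Poly_Mapping.keys m'"
  have "Poly_Mapping.keys (m + m') \<subseteq> ?A" by (rule keys_add)
  then show ?thesis
    by (simp add: monom_eval_superset[of ?A] lookup_add power_add prod.distrib)
qed

text \<open>Applied later with values in the ring of negative modes. The map \<open>\<kappa>\<close>
  embeds the scalars, so that the target only has to be a commutative ring.\<close>

locale poly_evaluation =
  fixes \<kappa> :: "'a::comm_ring_1 \<Rightarrow> 'r::comm_ring_1" and s :: "'v \<Rightarrow> 'r"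
  assumes scalar_one: "\<kappa> 1 = 1"
    and scalar_add: "\<kappa> (a + b) = \<kappa> a + \<kappa> b"
    and scalar_mult: "\<kappa> (a * b) = \<kappa> a * \<kappa> b"
begin

definition eval_poly :: "(('v \<Rightarrow>\<^sub>0 nat) \<Rightarrow>\<^sub>0 'a) \<Rightarrow> 'r" where
  "eval_poly p = pm_sum (\<lambda>m a. \<kappa> a * monom_eval s m) p"

lemma scalar_zero: "\<kappa> 0 = 0"
  using scalar_add[of 0 0] by simp

lemma eval_poly_zero: "eval_poly 0 = 0"
  by (simp add: eval_poly_def)

lemma eval_poly_add: "eval_poly (p + q) = eval_poly p + eval_poly q"
  unfolding eval_poly_def by (rule pm_sum_add) (simp_all add: scalar_zero scalar_add algebra_simps)

lemma eval_poly_sum: "eval_poly (sum f A) = (\<Sum>x\<in>A. eval_poly (f x))"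
  by (induction A rule: infinite_finite_induct) (simp_all add: eval_poly_zero eval_poly_add)

lemma eval_poly_single: "eval_poly (Poly_Mapping.single m a) = \<kappa> a * monom_eval s m"
  unfolding eval_poly_def by (rule pm_sum_single) (simp add: scalar_zero)

lemma eval_poly_mult: "eval_poly (p * q) = eval_poly p * eval_poly q"
proof (induction p rule: poly_mapping_single_induct)
  case (add k a f)
  have "eval_poly (Poly_Mapping.single k a * q) = eval_poly (Poly_Mapping.single k a) * eval_poly q"
    by (induction q rule: poly_mapping_single_induct)
      (simp_all add: eval_poly_zero eval_poly_add eval_poly_single distrib_left mult_single
        monom_eval_add scalar_mult mult_ac)
  with add show ?case by (simp add: distrib_right eval_poly_add)
qed (simp add: eval_poly_zero)

end


section \<open>The reduction of \<open>H\<^sup>+\<^sub>N\<close> modulo \<open>h\<close>\<close>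

text \<open>The constants in the ideal. As every coefficient of an element of the ideal is again
  such a constant, the quotient by the ideal becomes a ring of power series over the quotient by
  this set.\<close>

definition trace_ideal0 :: "'n::finite x_poly set" where
  "trace_ideal0 = {p. fps_const p \<in> trace_ideal}"

lemma trace_ideal0_ideal: "two_sided_ideal trace_ideal0"
proof -
  have "fps_const p + fps_const q \<in> trace_ideal" "fps_const a * fps_const p \<in> trace_ideal"
    "fps_const p * fps_const a \<in> trace_ideal"
    if "fps_const p \<in> trace_ideal" "fps_const q \<in> trace_ideal" for p q a :: "'a x_poly"
    using that trace_ideal_ideal[where 'a = 'a] unfolding two_sided_ideal_def by blast+
  then show ?thesis
    using trace_ideal_ideal[where 'a = 'a] unfolding two_sided_ideal_def trace_ideal0_def by simp
qed

lemma two_sided_ideal_mult: "two_sided_ideal J \<Longrightarrow> x \<in> J \<Longrightarrow> x * a \<in> J"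
  by (simp add: two_sided_ideal_def)

lemma two_sided_ideal_sum:
  assumes "two_sided_ideal J" "\<And>x. x \<in> A \<Longrightarrow> f x \<in> J"
  shows "sum f A \<in> J"
  using assms(2)
proof (induction A rule: infinite_finite_induct)
  case (insert x F)
  then show ?case using assms(1) unfolding two_sided_ideal_def by simp
qed (use assms(1) in \<open>simp_all add: two_sided_ideal_def\<close>)

text \<open>In the \<open>h\<close>-adic metric each coefficient of a convergent sequence is
  eventually constant.\<close>

lemma closed_fps_coeffs: "closed {f :: 'a::group_add fps. \<forall>k. fps_nth f k \<in> J}"
proof (unfold closed_sequential_limits, intro allI impI)
  fix s l
  assume sl: "(\<forall>n. s n \<in> {f. \<forall>k. fps_nth f k \<in> J}) \<and> s \<longlonglongrightarrow> l"
  have "fps_nth l k \<in> J" for k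
  proof -
    from sl have "\<forall>\<^sub>F n in sequentially. fps_nth (s n) k = fps_nth l k"
      by (simp add: tendsto_fps_iff)
    then obtain n where "fps_nth (s n) k = fps_nth l k"
      by (auto simp: eventually_sequentially)
    with sl show ?thesis by (metis mem_Collect_eq)
  qed
  then show "l \<in> {f. \<forall>k. fps_nth f k \<in> J}" by simp
qed

text \<open>The series with all coefficients in \<open>J\<close> form a complete ideal containing
  the traces, and \<open>trace_ideal\<close> is the smallest one. Besides
  \<open>trace_ideal0\<close>, the kernel of the evaluation at negative modes will take the place of
  \<open>J\<close>.\<close>

lemma trace_ideal_coeff:
  assumes J: "two_sided_ideal J" and tr: "\<And>k. (\<Sum>i\<in>UNIV. x_var (i, i) k) \<in> J"
    and f: "f \<in> trace_ideal"
  shows "fps_nth f k \<in> J"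
proof -
  let ?J = "{f. \<forall>k. fps_nth f k \<in> J}"
  have "two_sided_ideal ?J"
    unfolding two_sided_ideal_def
    by (auto simp: fps_mult_nth intro!: two_sided_ideal_sum[OF J])
      (use J in \<open>auto simp: two_sided_ideal_def\<close>)
  moreover have "complete ?J" by (simp add: complete_eq_closed closed_fps_coeffs)
  moreover have "fps_const (\<Sum>i\<in>UNIV. x_var (i, i) k) \<in> ?J" for k
    using J tr by (auto simp: two_sided_ideal_def)
  ultimately have "f \<in> ?J" using f unfolding trace_ideal_def by blast
  then show ?thesis by simp
qed

lemma trace_in_trace_ideal0: "(\<Sum>i\<in>UNIV. x_var (i, i) k) \<in> trace_ideal0"
  unfolding trace_ideal0_def trace_ideal_def by simp

lemma trace_ideal0_coeff: "f \<in> trace_ideal \<Longrightarrow> fps_nth f k \<in> trace_ideal0"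
  by (rule trace_ideal_coeff[OF trace_ideal0_ideal trace_in_trace_ideal0])

lemma closed_trace_ideal: "closed trace_ideal"
  unfolding trace_ideal_def by (rule closed_Inter) (auto simp: complete_eq_closed)

text \<open>If all coefficients lie in \<open>trace_ideal0\<close>, then the polynomial truncations
  of \<open>f\<close> lie in the ideal; they converge to \<open>f\<close>, and the ideal is
  closed.\<close>

lemma trace_ideal_iff: "f \<in> trace_ideal \<longleftrightarrow> (\<forall>k. fps_nth f k \<in> trace_ideal0)"
proof
  assume f: "\<forall>k. fps_nth f k \<in> trace_ideal0"
  have "(\<Sum>i=0..n. fps_const (fps_nth f i) * fps_X ^ i) \<in> trace_ideal" for n
    using f two_sided_ideal_mult[OF trace_ideal_ideal]
    by (intro two_sided_ideal_sum[OF trace_ideal_ideal]) (auto simp: trace_ideal0_def)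
  then show "f \<in> trace_ideal"
    using fps_notation[of f] by (rule closed_sequentially[OF closed_trace_ideal])
qed (simp add: trace_ideal0_coeff)

quotient_type (overloaded) 'n x_quot = "'n::finite x_poly" / "\<lambda>p q. p - q \<in> trace_ideal0"
  by (rule two_sided_ideal_equivp[OF trace_ideal0_ideal])

instantiation x_quot :: (finite) comm_ring_1
begin

lift_definition zero_x_quot :: "'a x_quot" is 0 .
lift_definition one_x_quot :: "'a x_quot" is 1 .
lift_definition plus_x_quot :: "'a x_quot \<Rightarrow> 'a x_quot \<Rightarrow> 'a x_quot" is "(+)"
  by (rule two_sided_ideal_cong[OF trace_ideal0_ideal])
lift_definition minus_x_quot :: "'a x_quot \<Rightarrow> 'a x_quot \<Rightarrow> 'a x_quot" is "(-)"
  by (rule two_sided_ideal_cong[OF trace_ideal0_ideal])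
lift_definition uminus_x_quot :: "'a x_quot \<Rightarrow> 'a x_quot" is uminus
  by (rule two_sided_ideal_cong(3)[OF trace_ideal0_ideal])
lift_definition times_x_quot :: "'a x_quot \<Rightarrow> 'a x_quot \<Rightarrow> 'a x_quot" is "(*)"
  by (rule two_sided_ideal_cong[OF trace_ideal0_ideal])

instance
proof -
  have eq: "x - y \<in> trace_ideal0" if "x = y" for x y :: "'a x_poly"
    using that trace_ideal0_ideal[where 'a = 'a] unfolding two_sided_ideal_def by simp
  have 1: "(0 :: 'a x_poly) - 1 \<notin> trace_ideal0"
    using two_sided_ideal_minus[OF trace_ideal0_ideal, of "- 1"] one_notin_trace_ideal
    by (auto simp: trace_ideal0_def)
  show "OFCLASS('a x_quot, comm_ring_1_class)"
  proof
    show "(0 :: 'a x_quot) \<noteq> 1"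
      using 1 by transfer
  qed (transfer, rule eq, simp add: algebra_simps)+
qed

end

lemma zero_in_trace_ideal0 [simp]: "(0 :: 'n::finite x_poly) \<in> trace_ideal0"
  using trace_ideal0_ideal[where 'a = 'n] by (simp add: two_sided_ideal_def)

lift_definition xq_scalar :: "complex \<Rightarrow> 'n::finite x_quot" is "Poly_Mapping.single 0" .

lift_definition xq_gen :: "'n \<times> 'n \<Rightarrow> nat \<Rightarrow> 'n::finite x_quot" is x_var .

lemma xq_scalar_0 [simp]: "xq_scalar 0 = 0"
  by transfer (simp)
lemma xq_scalar_1 [simp]: "xq_scalar 1 = 1"
  by transfer (simp)
lemma xq_scalar_add: "xq_scalar (a + b) = xq_scalar a + xq_scalar b"
  by transfer (simp add: single_add)
lemma xq_scalar_mult: "xq_scalar (a * b) = xq_scalar a * xq_scalar b"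
  by transfer (simp add: mult_single)
lemma xq_scalar_uminus: "xq_scalar (- a) = - xq_scalar a"
  using xq_scalar_add[of a "- a"] by (simp add: eq_neg_iff_add_eq_0 add.commute)
lemma xq_scalar_sum: "xq_scalar (sum f A) = (\<Sum>x\<in>A. xq_scalar (f x))"
  by (induction A rule: infinite_finite_induct) (simp_all add: xq_scalar_add)
lemma abs_x_quot_0 [simp]: "abs_x_quot 0 = 0"
  by (simp add: zero_x_quot_def)
lemma abs_x_quot_1 [simp]: "abs_x_quot 1 = 1"
  by (simp add: one_x_quot_def)
lemma abs_x_quot_add: "abs_x_quot (p + q) = abs_x_quot p + abs_x_quot q"
  by (simp add: plus_x_quot.abs_eq)
lemma abs_x_quot_mult: "abs_x_quot (p * q) = abs_x_quot p * abs_x_quot q"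
  by (simp add: times_x_quot.abs_eq)
lemma abs_x_quot_sum: "abs_x_quot (sum f A) = (\<Sum>x\<in>A. abs_x_quot (f x))"
  by (induction A rule: infinite_finite_induct) (simp_all add: abs_x_quot_add)
lemma abs_x_quot_eq: "abs_x_quot p = abs_x_quot q \<longleftrightarrow> p - q \<in> trace_ideal0"
  using x_quot.abs_eq_iff by blast

lemma xq_trace: "(\<Sum>i\<in>UNIV. xq_gen (i, i) k) = 0"
proof -
  have "(\<Sum>i\<in>UNIV. xq_gen (i, i) k :: 'a x_quot) = abs_x_quot (\<Sum>i\<in>UNIV. x_var (i, i) k)"
    by (simp add: abs_x_quot_sum xq_gen.abs_eq)
  also have "\<dots> = abs_x_quot 0"
    unfolding abs_x_quot_eq using trace_in_trace_ideal0[of k] by simp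
  finally show ?thesis by simp
qed

text \<open>With the injectivity and surjectivity proved below, this identifies \<open>H+\<close>
  with the power series ring over \<open>x_quot\<close>; questions of divisibility by
  \<open>h\<close> and of convergence become comparisons of coefficients.\<close>

lift_definition h_expansion :: "'n::finite hplus \<Rightarrow> 'n x_quot fps" is
  "\<lambda>f. Abs_fps (\<lambda>k. abs_x_quot (fps_nth f k))"
  by (auto simp: fps_eq_iff abs_x_quot_eq dest: trace_ideal0_coeff)

lift_definition h_const :: "'n::finite x_quot \<Rightarrow> 'n hplus" is fps_const
  by (simp add: trace_ideal0_def)

lemma h_expansion_0 [simp]: "h_expansion 0 = 0"
  by transfer (simp add: fps_eq_iff)
lemma h_expansion_1 [simp]: "h_expansion 1 = 1"
  by transfer (simp add: fps_eq_iff)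
lemma h_expansion_add: "h_expansion (v + w) = h_expansion v + h_expansion w"
  by transfer (simp add: fps_eq_iff abs_x_quot_add)
lemma h_expansion_mult: "h_expansion (v * w) = h_expansion v * h_expansion w"
  by transfer (simp add: fps_eq_iff fps_mult_nth abs_x_quot_sum abs_x_quot_mult)
lemma h_expansion_uminus: "h_expansion (- v) = - h_expansion v"
  using h_expansion_add[of v "- v"] by (simp add: eq_neg_iff_add_eq_0 add.commute)
lemma h_expansion_diff: "h_expansion (v - w) = h_expansion v - h_expansion w"
  using h_expansion_add[of v "- w"] by (simp add: h_expansion_uminus)
lemma h_expansion_sum: "h_expansion (sum f A) = (\<Sum>x\<in>A. h_expansion (f x))"
  by (induction A rule: infinite_finite_induct) (simp_all add: h_expansion_add)
lemma h_expansion_scalar: "h_expansion (hscalar f) = Abs_fps (\<lambda>k. xq_scalar (fps_nth f k))"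
  unfolding hscalar_def by (simp add: h_expansion.abs_eq fps_eq_iff xq_scalar.abs_eq)
lemma h_expansion_gen: "h_expansion (hgen e k) = fps_const (xq_gen e k)"
  unfolding hgen_def by (simp add: h_expansion.abs_eq fps_eq_iff xq_gen.abs_eq)
lemma h_expansion_const: "h_expansion (h_const q) = fps_const q"
  by (induction q rule: x_quot.abs_induct) (simp add: h_const.abs_eq h_expansion.abs_eq fps_eq_iff)

lemma h_expansion_inj: "h_expansion v = h_expansion w \<longleftrightarrow> v = w"
  by transfer (auto simp: fps_eq_iff abs_x_quot_eq trace_ideal_iff)

lemma h_expansion_surj: "\<exists>v. h_expansion v = f"
proof
  show "h_expansion (abs_hplus (Abs_fps (\<lambda>k. rep_x_quot (fps_nth f k)))) = f"
    by (simp add: h_expansion.abs_eq fps_eq_iff Quotient3_abs_rep[OF Quotient3_x_quot])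
qed

notation fps_nth (infixl "$$" 75)

section \<open>The \<open>h\<close>-adic topology and generation by monomials\<close>

lemma h_expansion_scalar_X [simp]: "h_expansion (hscalar (fps_X ^ k)) = fps_X ^ k"
  by (simp add: h_expansion_scalar fps_eq_iff)

lemma hscalar_0 [simp]: "hscalar 0 = 0"
  by (simp add: h_expansion_scalar fps_eq_iff flip: h_expansion_inj)
lemma hscalar_1 [simp]: "hscalar 1 = 1"
  by (simp add: h_expansion_scalar fps_eq_iff flip: h_expansion_inj)
lemma hscalar_add: "hscalar (f + g) = hscalar f + hscalar g"
  by (simp add: h_expansion_scalar h_expansion_add fps_eq_iff xq_scalar_add flip: h_expansion_inj)
lemma hscalar_mult: "hscalar (f * g) = hscalar f * hscalar g"
  by (simp add: h_expansion_scalar h_expansion_mult fps_eq_iff fps_mult_nth xq_scalar_sum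
      xq_scalar_mult flip: h_expansion_inj)
lemma hscalar_uminus: "hscalar (- f) = - hscalar f"
  using hscalar_add[of f "- f"] by (simp add: eq_neg_iff_add_eq_0 add.commute)
lemma h_expansion_scalar_mult:
  "h_expansion (hscalar f * v) $$ k = (\<Sum>i=0..k. xq_scalar (f $$ i) * h_expansion v $$ (k - i))"
  by (simp add: h_expansion_mult h_expansion_scalar fps_mult_nth)

lemma h_expansion_scalar_const: "h_expansion (hscalar (fps_const \<alpha>)) = fps_const (xq_scalar \<alpha>)"
  by (auto simp: h_expansion_scalar fps_eq_iff)

text \<open>The quotient by \<open>h^k\<close> is obtained by shifting the coefficients and lifting
  the shifted series back through \<open>h_expansion_surj\<close>.\<close>

lemma h_times_iff: "v \<in> h_times k UNIV \<longleftrightarrow> (\<forall>j<k. h_expansion v $$ j = 0)"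
proof
  show "\<forall>j<k. h_expansion v $$ j = 0" if "v \<in> h_times k UNIV"
    using that by (auto simp: h_times_def h_expansion_mult fps_X_power_mult_nth)
  assume *: "\<forall>j<k. h_expansion v $$ j = 0"
  obtain w where w: "h_expansion w = fps_shift k (h_expansion v)"
    using h_expansion_surj by blast
  have "h_expansion v = h_expansion (hscalar (fps_X ^ k) * w)"
    using * by (simp add: h_expansion_mult w fps_eq_iff fps_X_power_mult_nth)
  then show "v \<in> h_times k UNIV" unfolding h_times_def h_expansion_inj by blast
qed

lemma h_times_add: "v \<in> h_times k UNIV \<Longrightarrow> w \<in> h_times k UNIV \<Longrightarrow> v + w \<in> h_times k UNIV"
  by (simp add: h_times_iff h_expansion_add)
lemma h_times_diff: "v \<in> h_times k UNIV \<Longrightarrow> w \<in> h_times k UNIV \<Longrightarrow> v - w \<in> h_times k UNIV"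
  by (simp add: h_times_iff h_expansion_diff)

lemma h_times_eq_0:
  assumes "\<And>k. v \<in> h_times k UNIV"
  shows "v = 0"
proof -
  have "h_expansion v = h_expansion 0"
    using assms by (auto simp: h_times_iff fps_eq_iff)
  then show ?thesis by (simp only: h_expansion_inj)
qed

lemma hlinearD:
  assumes "hlinear F"
  shows "F 0 = 0" "F (v + w) = F v + F w" "F (hscalar f * v) = hscalar f * F v"
    "F (- v) = - F v" "F (v - w) = F v - F w"
proof -
  have L: "F (hscalar f * v + w) = hscalar f * F v + F w" for f v w
    using assms unfolding hlinear_def by blast
  show add: "F (v + w) = F v + F w" for v w using L[of 1 v w] by simp
  from add[of 0 0] show zero: "F 0 = 0" by simp
  show "F (hscalar f * v) = hscalar f * F v" using L[of f v 0] zero by simp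
  show minus: "F (- v) = - F v" for v
    using L[of "- 1" v 0] zero by (simp add: hscalar_uminus)
  show "F (v - w) = F v - F w" using add[of v "- w"] minus by simp
qed

lemma hlinear_sum: "hlinear F \<Longrightarrow> F (sum f A) = (\<Sum>x\<in>A. F (f x))"
  by (induction A rule: infinite_finite_induct) (simp_all add: hlinearD)

lemma hlinear_h_times: "hlinear F \<Longrightarrow> v \<in> h_times k UNIV \<Longrightarrow> F v \<in> h_times k UNIV"
  by (auto simp: h_times_def hlinearD)

section \<open>Spans of monomials in a chosen set of generators\<close>

definition xq_monoms :: "('n \<times> 'n) set \<Rightarrow> 'n::finite x_quot set" where
  "xq_monoms E = {\<Prod>l\<in>{1..n}. xq_gen (e l) (q l) |(n :: nat) e q. \<forall>l. e l \<in> E}"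

abbreviation h_monom :: "(nat \<Rightarrow> 'n \<times> 'n) \<Rightarrow> (nat \<Rightarrow> nat) \<Rightarrow> nat set \<Rightarrow> 'n::finite hplus" where
  "h_monom e q A \<equiv> \<Prod>l\<in>A. hgen (e l) (q l)"

text \<open>Products over \<open>{1..n}\<close> of indexed generators, not powers of distinct
  variables: this is the shape in which the operators \<open>x_minus\<close> and \<open>Y\<close>
  are specified. The set \<open>E\<close> will be everything for \<open>H+\<close> and the diagonal
  pairs for \<open>VH\<close>.\<close>

definition h_monoms :: "('n \<times> 'n) set \<Rightarrow> 'n::finite hplus set" where
  "h_monoms E = {\<Prod>l\<in>{1..n}. hgen (e l) (q l) |(n :: nat) e q. \<forall>l. e l \<in> E}"

lemma h_const_simps:
  "h_const 0 = 0" "h_const 1 = 1" "h_const (p + q) = h_const p + h_const q"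
  "h_const (p * q) = h_const p * h_const q" "h_const (xq_gen e k) = hgen e k"
  "h_const (xq_scalar \<alpha>) = hscalar (fps_const \<alpha>)"
  by (simp_all add: h_expansion_const h_expansion_add h_expansion_mult h_expansion_gen
      h_expansion_scalar_const flip: h_expansion_inj)

lemma h_const_prod: "h_const (prod f A) = (\<Prod>x\<in>A. h_const (f x))"
  by (induction A rule: infinite_finite_induct) (simp_all add: h_const_simps)

lemma h_const_monom: "m \<in> xq_monoms E \<Longrightarrow> h_const m \<in> h_monoms E"
proof -
  assume "m \<in> xq_monoms E"
  then obtain n :: nat and e q where e: "\<forall>l. e l \<in> E" and m: "m = (\<Prod>l\<in>{1..n}. xq_gen (e l) (q l))"
    unfolding xq_monoms_def by blast
  have "h_const m = h_monom e q {1..n}" by (simp add: m h_const_prod h_const_simps)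
  with e show ?thesis unfolding h_monoms_def by blast
qed

lemma xq_monoms_one: "E \<noteq> {} \<Longrightarrow> 1 \<in> xq_monoms E"
  unfolding xq_monoms_def by (auto intro!: exI[of _ "0::nat"])

lemma xq_monoms_step:
  assumes "m \<in> xq_monoms E" "a \<in> E"
  shows "m * xq_gen a k \<in> xq_monoms E"
proof -
  from assms(1) obtain n :: nat and e q where e: "\<forall>l. e l \<in> E" and m: "m = (\<Prod>l\<in>{1..n}. xq_gen (e l) (q l))"
    unfolding xq_monoms_def by blast
  have "m * xq_gen a k = (\<Prod>l\<in>{1..Suc n}. xq_gen ((e(Suc n := a)) l) ((q(Suc n := k)) l))"
    by (auto simp: m prod.nat_ivl_Suc' mult.commute intro!: prod.cong)
  moreover have "\<forall>l. (e(Suc n := a)) l \<in> E" using e assms(2) by simp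
  ultimately show ?thesis unfolding xq_monoms_def by blast
qed

lemma xq_monoms_induct [consumes 1, case_names one step]:
  assumes "m \<in> xq_monoms E" "P 1"
    and step: "\<And>m a k. m \<in> xq_monoms E \<Longrightarrow> P m \<Longrightarrow> a \<in> E \<Longrightarrow> P (m * xq_gen a k)"
  shows "P m"
proof -
  from assms(1) obtain n :: nat and e q where e: "\<forall>l. e l \<in> E" and m: "m = (\<Prod>l\<in>{1..n}. xq_gen (e l) (q l))"
    unfolding xq_monoms_def by blast
  have "P (\<Prod>l\<in>{1..n}. xq_gen (e l) (q l))"
  proof (induction n)
    case (Suc n)
    have "(\<Prod>l\<in>{1..n}. xq_gen (e l) (q l)) \<in> xq_monoms E"
      using e unfolding xq_monoms_def by blast
    from step[OF this Suc, of "e (Suc n)" "q (Suc n)"] e show ?case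
      by (simp add: prod.nat_ivl_Suc' mult.commute)
  qed (simp add: \<open>P 1\<close>)
  then show ?thesis by (simp add: m)
qed

inductive_set xq_span :: "('n \<times> 'n) set \<Rightarrow> 'n::finite x_quot set" for E where
  zero: "0 \<in> xq_span E"
| add: "m \<in> xq_monoms E \<Longrightarrow> q \<in> xq_span E \<Longrightarrow> xq_scalar \<alpha> * m + q \<in> xq_span E"

lemma xq_span_add:
  assumes "p \<in> xq_span E" "q \<in> xq_span E"
  shows "p + q \<in> xq_span E"
  using assms(1)
proof (induction rule: xq_span.induct)
  case (add m p \<alpha>)
  then show ?case using xq_span.add[of m E "p + q" \<alpha>] by (simp add: add.assoc)
qed (use assms(2) in simp)

lemma xq_span_scale: "p \<in> xq_span E \<Longrightarrow> xq_scalar \<alpha> * p \<in> xq_span E"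
  by (induction rule: xq_span.induct)
    (auto intro: xq_span.intros simp: distrib_left mult.assoc[symmetric] simp flip: xq_scalar_mult)

lemma xq_span_monom: "m \<in> xq_monoms E \<Longrightarrow> m \<in> xq_span E"
  using xq_span.add[of m E 0 1] by (simp add: xq_span.zero)

lemma xq_span_gen_mult: "p \<in> xq_span E \<Longrightarrow> a \<in> E \<Longrightarrow> p * xq_gen a k \<in> xq_span E"
  by (induction rule: xq_span.induct)
    (auto intro: xq_span.intros xq_monoms_step simp: distrib_right mult.assoc)

lemma xq_span_mult:
  assumes "p \<in> xq_span E" "q \<in> xq_span E"
  shows "p * q \<in> xq_span E"
proof -
  have *: "p * m \<in> xq_span E" if "m \<in> xq_monoms E" for m
    using that
    by (induction rule: xq_monoms_induct) (use assms(1) in \<open>auto simp: xq_span_gen_mult mult.assoc[symmetric]\<close>)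
  show ?thesis
    using assms(2)
    by (induction rule: xq_span.induct)
      (auto intro!: xq_span_add xq_span_scale * xq_span.zero simp: distrib_left mult.left_commute[of p])
qed

lemma xq_span_one: "E \<noteq> {} \<Longrightarrow> 1 \<in> xq_span E"
  by (simp add: xq_span_monom xq_monoms_one)

lemma xq_span_gen: "a \<in> E \<Longrightarrow> xq_gen a k \<in> xq_span E"
  using xq_span_gen_mult[OF xq_span_one, of E a k] by auto

lemma xq_span_uminus: "p \<in> xq_span E \<Longrightarrow> - p \<in> xq_span E"
  using xq_span_scale[of p E "- 1"] by (simp add: xq_scalar_uminus)

lemma xq_span_diff: "p \<in> xq_span E \<Longrightarrow> q \<in> xq_span E \<Longrightarrow> p - q \<in> xq_span E"
  using xq_span_add[of p E "- q"] by (simp add: xq_span_uminus)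

lemma xq_span_sum: "(\<And>x. x \<in> A \<Longrightarrow> f x \<in> xq_span E) \<Longrightarrow> sum f A \<in> xq_span E"
  by (induction A rule: infinite_finite_induct) (auto intro: xq_span_add xq_span.zero)

lemma xq_span_UNIV: "q \<in> xq_span (UNIV :: ('n::finite \<times> 'n) set)"
proof (induction q rule: x_quot.abs_induct)
  case (1 p)
  have pow: "abs_x_quot (Poly_Mapping.single (Poly_Mapping.single v n) 1) \<in> xq_span (UNIV :: ('n \<times> 'n) set)"
    for v :: "'n \<times> 'n \<times> nat" and n
  proof (induction n)
    case (Suc n)
    obtain i j k where v: "v = (i, j, k)" by (cases v)
    have "Poly_Mapping.single (Poly_Mapping.single v (Suc n)) (1 :: complex)
        = Poly_Mapping.single (Poly_Mapping.single v n) 1 * x_var (i, j) k"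
      by (simp add: x_var_def mult_single v flip: single_add)
    with xq_span_gen_mult[OF Suc, of "(i, j)" k] show ?case
      by (simp add: abs_x_quot_mult xq_gen.abs_eq)
  qed (simp add: xq_span_one)
  have mon: "abs_x_quot (Poly_Mapping.single m 1) \<in> xq_span (UNIV :: ('n \<times> 'n) set)"
    for m :: "('n \<times> 'n \<times> nat) \<Rightarrow>\<^sub>0 nat"
  proof (induction m rule: poly_mapping_single_induct)
    case (add v n m)
    have "Poly_Mapping.single (Poly_Mapping.single v n + m) (1 :: complex)
        = Poly_Mapping.single (Poly_Mapping.single v n) 1 * Poly_Mapping.single m 1"
      by (simp add: mult_single)
    then show ?case using xq_span_mult[OF pow add] by (simp add: abs_x_quot_mult)
  qed (simp add: xq_span_one)
  show ?case
  proof (induction p rule: poly_mapping_single_induct)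
    case (add m a p)
    have "Poly_Mapping.single m a = Poly_Mapping.single 0 a * Poly_Mapping.single m 1"
      by (simp add: mult_single)
    then have "abs_x_quot (Poly_Mapping.single m a) = xq_scalar a * abs_x_quot (Poly_Mapping.single m 1)"
      by (simp add: abs_x_quot_mult xq_scalar.abs_eq)
    then show ?case using add xq_span_scale[OF mon] by (simp add: abs_x_quot_add xq_span_add)
  qed (simp add: xq_span.zero)
qed

section \<open>Completed spans and the density of monomials\<close>

definition h_span :: "('n \<times> 'n) set \<Rightarrow> 'n::finite hplus set" where
  "h_span E = {v. \<forall>k. h_expansion v $$ k \<in> xq_span E}"

lemma h_span_UNIV [simp]: "h_span UNIV = UNIV"
  by (simp add: h_span_def xq_span_UNIV)

lemma h_span_add: "v \<in> h_span E \<Longrightarrow> w \<in> h_span E \<Longrightarrow> v + w \<in> h_span E"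
  by (simp add: h_span_def h_expansion_add xq_span_add)
lemma h_span_diff: "v \<in> h_span E \<Longrightarrow> w \<in> h_span E \<Longrightarrow> v - w \<in> h_span E"
  by (simp add: h_span_def h_expansion_diff xq_span_diff)
lemma h_span_mult: "v \<in> h_span E \<Longrightarrow> w \<in> h_span E \<Longrightarrow> v * w \<in> h_span E"
  by (auto simp: h_span_def h_expansion_mult fps_mult_nth intro!: xq_span_sum xq_span_mult)
lemma h_span_scale: "v \<in> h_span E \<Longrightarrow> hscalar f * v \<in> h_span E"
  by (auto simp: h_span_def h_expansion_scalar_mult intro!: xq_span_sum xq_span_scale)
lemma h_span_0: "0 \<in> h_span E"
  by (simp add: h_span_def xq_span.zero)
lemma h_span_1: "E \<noteq> {} \<Longrightarrow> 1 \<in> h_span E"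
  by (simp add: h_span_def xq_span.zero xq_span_one)
lemma h_span_gen: "a \<in> E \<Longrightarrow> hgen a k \<in> h_span E"
  by (simp add: h_span_def h_expansion_gen xq_span.zero xq_span_gen)
lemma h_span_const: "h_const q \<in> h_span E \<longleftrightarrow> q \<in> xq_span E"
  by (auto simp: h_span_def h_expansion_const xq_span.zero)
lemma h_span_sum: "(\<And>x. x \<in> A \<Longrightarrow> f x \<in> h_span E) \<Longrightarrow> sum f A \<in> h_span E"
  by (induction A rule: infinite_finite_induct) (auto intro: h_span_add h_span_0)
lemma h_span_prod: "E \<noteq> {} \<Longrightarrow> (\<And>x. x \<in> A \<Longrightarrow> f x \<in> h_span E) \<Longrightarrow> prod f A \<in> h_span E"
  by (induction A rule: infinite_finite_induct) (auto intro: h_span_mult h_span_1)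

lemma h_span_limit:
  assumes "\<And>k. \<exists>w\<in>h_span E. v - w \<in> h_times k UNIV"
  shows "v \<in> h_span E"
  unfolding h_span_def
proof (intro CollectI allI)
  fix k
  \<comment> \<open>The coefficient of \<open>h^k\<close> is determined modulo
    \<open>h^(k+1)\<close>.\<close>
  from assms[of "Suc k"] obtain w where "w \<in> h_span E" "v - w \<in> h_times (Suc k) UNIV" by blast
  then show "h_expansion v $$ k \<in> xq_span E"
    by (auto simp: h_times_iff h_expansion_diff h_span_def)
qed

text \<open>Membership in \<open>h_span\<close> is a condition on each coefficient separately, hence
  survives division by \<open>h^k\<close>. This saturation is what later makes the reduction of
  \<open>VH\<close> inject into that of \<open>H+\<close>.\<close>

lemma h_times_h_span: "h_times k (h_span E) = h_span E \<inter> h_times k UNIV"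
proof
  show "h_times k (h_span E) \<subseteq> h_span E \<inter> h_times k UNIV"
    by (auto simp: h_times_def h_span_scale)
  show "h_span E \<inter> h_times k UNIV \<subseteq> h_times k (h_span E)"
  proof
    fix v assume v: "v \<in> h_span E \<inter> h_times k UNIV"
    then obtain w where w: "v = hscalar (fps_X ^ k) * w" unfolding h_times_def by blast
    have "h_expansion w $$ j = h_expansion v $$ (j + k)" for j
      by (simp add: w h_expansion_mult fps_X_power_mult_nth)
    then have "w \<in> h_span E" using v by (simp add: h_span_def)
    with w show "v \<in> h_times k (h_span E)" unfolding h_times_def by blast
  qed
qed

definition h_trunc :: "nat \<Rightarrow> 'n::finite hplus \<Rightarrow> 'n hplus" where
  "h_trunc k v = (\<Sum>j<k. hscalar (fps_X ^ j) * h_const (h_expansion v $$ j))"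

lemma h_expansion_trunc: "h_expansion (h_trunc k v) $$ i = (if i < k then h_expansion v $$ i else 0)"
proof -
  have "h_expansion (h_trunc k v) $$ i = (\<Sum>j<k. if i = j then h_expansion v $$ j else 0)"
    unfolding h_trunc_def h_expansion_sum fps_sum_nth
    by (intro sum.cong) (auto simp: h_expansion_mult h_expansion_const)
  then show ?thesis by simp
qed

lemma h_trunc_diff: "v - h_trunc k v \<in> h_times k UNIV"
  by (simp add: h_times_iff h_expansion_diff h_expansion_trunc)

lemma h_const_span_closed:
  assumes "q \<in> xq_span E" "h_monoms E \<subseteq> B" "0 \<in> B"
    and "\<And>v w. v \<in> B \<Longrightarrow> w \<in> B \<Longrightarrow> v + w \<in> B" "\<And>f v. v \<in> B \<Longrightarrow> hscalar f * v \<in> B"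
  shows "h_const q \<in> B"
  using assms(1)
proof (induction rule: xq_span.induct)
  case (add m q \<alpha>)
  have "h_const m \<in> B" using h_const_monom[OF add(1)] assms(2) by blast
  then show ?case using assms(4)[OF assms(5) add(3)] by (simp add: h_const_simps)
qed (use assms(3) in \<open>simp add: h_const_simps\<close>)

text \<open>Each truncation is a finite combination of monomials, so the first three cases reach it,
  and the limit case reaches \<open>v\<close> from its truncations.\<close>

lemma h_span_induct [consumes 2, case_names monom add scale limit]:
  assumes v: "v \<in> h_span E" and E: "E \<noteq> {}"
    and monom: "\<And>m. m \<in> h_monoms E \<Longrightarrow> P m"
    and add: "\<And>v w. P v \<Longrightarrow> P w \<Longrightarrow> P (v + w)"
    and scale: "\<And>f v. P v \<Longrightarrow> P (hscalar f * v)"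
    and limit: "\<And>v. (\<And>k. \<exists>w. P w \<and> v - w \<in> h_times k UNIV) \<Longrightarrow> P v"
  shows "P v"
proof (rule limit)
  fix k
  have zero: "P 0"
    using scale[OF monom[OF h_const_monom[OF xq_monoms_one[OF E]]], of 0] by simp
  have "P (h_const (h_expansion v $$ j))" for j
  proof -
    have "h_expansion v $$ j \<in> xq_span E" using v by (simp add: h_span_def)
    then have "h_const (h_expansion v $$ j) \<in> Collect P"
      by (rule h_const_span_closed) (use zero monom add scale in auto)
    then show ?thesis by simp
  qed
  then have "P (\<Sum>j<k. hscalar (fps_X ^ j) * h_const (h_expansion v $$ j))"
    by (induction k) (auto intro: add scale zero)
  then show "\<exists>w. P w \<and> v - w \<in> h_times k UNIV"
    using h_trunc_diff unfolding h_trunc_def by blast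
qed

text \<open>An \<open>h\<close>-linear map preserves multiples of \<open>h^k\<close>, so it is
  automatically \<open>h\<close>-adically continuous and determined by its values on
  monomials.\<close>

lemma hlinear_eqI:
  assumes "hlinear F" "hlinear G" "\<And>m. m \<in> h_monoms E \<Longrightarrow> F m = G m" "v \<in> h_span E" "E \<noteq> {}"
  shows "F v = G v"
  using assms(4,5)
proof (induction rule: h_span_induct)
  case (limit v)
  have "F v - G v \<in> h_times k UNIV" for k
  proof -
    obtain w where w: "F w = G w" "v - w \<in> h_times k UNIV" using limit by blast
    have "F (v - w) - G (v - w) \<in> h_times k UNIV"
      by (rule h_times_diff[OF hlinear_h_times[OF assms(1) w(2)] hlinear_h_times[OF assms(2) w(2)]])
    then show ?thesis using w(1) by (simp add: hlinearD[OF assms(1)] hlinearD[OF assms(2)])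
  qed
  then show ?case using h_times_eq_0[of "F v - G v"] by simp
qed (simp_all add: assms(3) hlinearD[OF assms(1)] hlinearD[OF assms(2)])

lemma hlinear_closed:
  assumes "hlinear F" "\<And>m. m \<in> h_monoms E \<Longrightarrow> F m \<in> h_span E'" "v \<in> h_span E" "E \<noteq> {}"
  shows "F v \<in> h_span E'"
  using assms(3,4)
proof (induction rule: h_span_induct)
  case (limit v)
  show ?case
  proof (rule h_span_limit)
    fix k
    obtain w where w: "F w \<in> h_span E'" "v - w \<in> h_times k UNIV" using limit by blast
    from hlinear_h_times[OF assms(1) w(2)] w(1) show "\<exists>w\<in>h_span E'. F v - w \<in> h_times k UNIV"
      by (auto simp: hlinearD[OF assms(1)])
  qed
qed (simp_all add: assms(2) hlinearD[OF assms(1)] h_span_add h_span_scale)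

section \<open>The subalgebra generated by the diagonal variables\<close>

definition diag :: "('n \<times> 'n) set" where
  "diag = range (\<lambda>i. (i, i))"

lemma diag_nonempty [simp]: "diag \<noteq> {}"
  by (simp add: diag_def)

text \<open>A nonzero scalar is a unit times a power of \<open>h\<close>, and multiplication by a
  power of \<open>h\<close> only shifts coefficients.\<close>

lemma hscalar_mult_eq_0:
  assumes "f \<noteq> 0" "hscalar f * v = 0"
  shows "v = 0"
proof -
  have "hscalar (fps_X ^ subdegree f) * v = 0"
  proof -
    let ?u = "fps_shift (subdegree f) f"
    have "?u $$ 0 \<noteq> 0" using assms(1) by simp
    then have "inverse ?u * (?u * fps_X ^ subdegree f) = fps_X ^ subdegree f"
      by (simp add: mult.assoc[symmetric] inverse_mult_eq_1)
    then have "fps_X ^ subdegree f = inverse ?u * f"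
      by (simp only: subdegree_decompose[of f, symmetric])
    then show ?thesis using assms(2) by (simp add: hscalar_mult mult.assoc)
  qed
  then have "fps_X ^ subdegree f * h_expansion v = 0"
    using h_expansion_mult[of "hscalar (fps_X ^ subdegree f)" v] by simp
  then have "h_expansion v $$ k = 0" for k
    using fps_X_power_mult_nth[of "subdegree f" "h_expansion v" "k + subdegree f"] by simp
  then have "h_expansion v = h_expansion 0" by (simp add: fps_eq_iff)
  then show ?thesis by (simp only: h_expansion_inj)
qed

lemma h_subalgebra_h_span: "E \<noteq> {} \<Longrightarrow> h_subalgebra (h_span E)"
  by (simp add: h_subalgebra_def h_span_1 h_span_add h_span_mult h_span_scale)

lemma topologically_free_h_span: "topologically_free (h_span E)"
  unfolding topologically_free_def
proof (intro conjI allI impI)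
  show "v = 0" if "f \<noteq> 0 \<and> v \<in> h_span E \<and> hscalar f * v = 0" for f v
    using that hscalar_mult_eq_0 by blast
  have "0 \<in> (\<Inter>k. h_times k (h_span E))"
    by (simp add: h_times_h_span h_span_0 h_times_iff)
  then show "(\<Inter>k. h_times k (h_span E)) = {0}"
    using h_times_eq_0 by (auto simp: h_times_h_span)
  fix s :: "nat \<Rightarrow> 'a hplus"
  assume s: "(\<forall>n. s n \<in> h_span E) \<and> (\<forall>k. \<exists>M. \<forall>m\<ge>M. \<forall>n\<ge>M. s m - s n \<in> h_times k (h_span E))"
  then obtain M where M: "s m - s n \<in> h_times k (h_span E)" if "m \<ge> M k" "n \<ge> M k" for m n k
    by metis
  \<comment> \<open>The coefficient of \<open>h^k\<close> has stabilised from index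
    \<open>M (Suc k)\<close> on, since there the sequence is constant modulo
    \<open>h^(k+1)\<close>.\<close>
  obtain l where l: "h_expansion l = Abs_fps (\<lambda>k. h_expansion (s (M (Suc k))) $$ k)"
    using h_expansion_surj by blast
  have L: "l \<in> h_span E" using s by (simp add: h_span_def l)
  \<comment> \<open>The sum of the thresholds serves as a common bound for those of all coefficients
    below \<open>k\<close>.\<close>
  have "s n - l \<in> h_times k (h_span E)" if n: "n \<ge> (\<Sum>j\<le>k. M j)" for n k
  proof -
    have "h_expansion (s n) $$ j = h_expansion l $$ j" if "j < k" for j
    proof -
      have "M (Suc j) \<le> (\<Sum>j\<le>k. M j)" using that by (intro member_le_sum) auto
      with M[of "Suc j" n "M (Suc j)"] n show ?thesis
        by (auto simp: h_times_h_span h_times_iff h_expansion_diff l)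
    qed
    then show ?thesis using s L by (simp add: h_times_h_span h_span_diff h_times_iff h_expansion_diff)
  qed
  with L show "\<exists>l\<in>h_span E. \<forall>k. \<exists>M. \<forall>n\<ge>M. s n - l \<in> h_times k (h_span E)" by blast
qed

text \<open>The truncations of \<open>v\<close> are finite combinations of monomials, hence lie in
  \<open>B\<close>, and completeness of \<open>B\<close> gives them a limit there, which must be
  \<open>v\<close>. Completeness refers to \<open>h_times k B\<close>, so differences of truncations
  have to be divided by powers of \<open>h\<close> inside \<open>B\<close>.\<close>

lemma h_span_subset:
  assumes B: "h_subalgebra B" "topologically_free B" and gen: "\<And>a k. a \<in> E \<Longrightarrow> hgen a k \<in> B"
  shows "h_span E \<subseteq> B"
proof
  fix v assume v: "v \<in> h_span E"
  have alg: "1 \<in> B" "\<And>v w. v \<in> B \<Longrightarrow> w \<in> B \<Longrightarrow> v + w \<in> B" "\<And>v w. v \<in> B \<Longrightarrow> w \<in> B \<Longrightarrow> v * w \<in> B"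
    "\<And>f v. v \<in> B \<Longrightarrow> hscalar f * v \<in> B"
    using B(1) unfolding h_subalgebra_def by auto
  have zero: "0 \<in> B" using alg(4)[OF alg(1), of 0] by simp
  have prod: "(\<Prod>l\<in>A. f l) \<in> B" if "\<And>l. f l \<in> B" for f and A :: "nat set"
    by (induction A rule: infinite_finite_induct) (use alg(1,3) that in simp_all)
  have mon: "h_monoms E \<subseteq> B"
  proof
    fix m assume "m \<in> h_monoms E"
    then obtain n :: nat and e q where "\<forall>l. e l \<in> E" and m: "m = h_monom e q {1..n}"
      unfolding h_monoms_def by blast
    with gen show "m \<in> B" unfolding m by (intro prod) blast
  qed
  have const: "h_const (h_expansion v $$ j) \<in> B" for j
    using h_const_span_closed[OF _ mon zero alg(2) alg(4)] v by (simp add: h_span_def)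
  have uminus: "- w \<in> B" if "w \<in> B" for w
    using alg(4)[OF that, of "- 1"] by (simp add: hscalar_uminus)
  have sum: "(\<Sum>j\<in>A. f j) \<in> B" if "\<And>j. f j \<in> B" for f and A :: "nat set"
    by (induction A rule: infinite_finite_induct) (use alg(2) zero that in simp_all)
  have trunc: "h_trunc n v \<in> B" for n
    unfolding h_trunc_def by (intro sum alg(4) const)
  have step: "h_trunc m v - h_trunc n v \<in> h_times n B" if "n \<le> m" for m n
  proof -
    have "h_trunc m v - h_trunc n v = (\<Sum>j\<in>{n..<m}. hscalar (fps_X ^ j) * h_const (h_expansion v $$ j))"
      using that unfolding h_trunc_def
      by (simp add: sum_diff_nat_ivl lessThan_atLeast0)
    also have "\<dots> = hscalar (fps_X ^ n) * (\<Sum>j\<in>{n..<m}. hscalar (fps_X ^ (j - n)) * h_const (h_expansion v $$ j))"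
      unfolding sum_distrib_left
      by (intro sum.cong) (auto simp: mult.assoc[symmetric] simp flip: hscalar_mult power_add)
    finally have *: "h_trunc m v - h_trunc n v = \<dots>" .
    have "(\<Sum>j\<in>{n..<m}. hscalar (fps_X ^ (j - n)) * h_const (h_expansion v $$ j)) \<in> B"
      by (intro sum alg(4) const)
    then show ?thesis unfolding h_times_def * by (rule imageI)
  qed
  have cauchy: "\<forall>k. \<exists>M. \<forall>m\<ge>M. \<forall>n\<ge>M. h_trunc m v - h_trunc n v \<in> h_times k B"
  proof (intro allI exI impI)
    fix k m n :: nat assume mn: "k \<le> m" "k \<le> n"
    have "(h_trunc m v - h_trunc k v) - (h_trunc n v - h_trunc k v) \<in> h_times k B"
    proof -
      obtain a b where ab: "a \<in> B" "b \<in> B" "h_trunc m v - h_trunc k v = hscalar (fps_X ^ k) * a"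
        "h_trunc n v - h_trunc k v = hscalar (fps_X ^ k) * b"
        using step[OF mn(1)] step[OF mn(2)] unfolding h_times_def by blast
      have "hscalar (fps_X ^ k) * (a + - b) \<in> h_times k B"
        unfolding h_times_def using alg(2)[OF ab(1) uminus[OF ab(2)]] by blast
      then show ?thesis by (simp only: ab(3,4) right_diff_distrib) (simp add: algebra_simps)
    qed
    then show "h_trunc m v - h_trunc n v \<in> h_times k B" by simp
  qed
  note complete = conjunct2[OF conjunct2[OF B(2)[unfolded topologically_free_def]], THEN spec, of "\<lambda>n. h_trunc n v"]
  have "\<exists>l\<in>B. \<forall>k. \<exists>M. \<forall>n\<ge>M. h_trunc n v - l \<in> h_times k B"
    by (rule mp[OF complete], rule conjI[OF allI[OF trunc] cauchy])
  then obtain l where l: "l \<in> B" "\<And>k. \<exists>M. \<forall>n\<ge>M. h_trunc n v - l \<in> h_times k B"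
    by blast
  have "v - l \<in> h_times k UNIV" for k
  proof -
    from l(2) obtain M where M: "\<And>n. n \<ge> M \<Longrightarrow> h_trunc n v - l \<in> h_times k B" by blast
    then have "h_trunc (max M k) v - l \<in> h_times k B" by simp
    then have "h_trunc (max M k) v - l \<in> h_times k UNIV" by (auto simp: h_times_def)
    moreover have "v - h_trunc (max M k) v \<in> h_times k UNIV"
      using h_trunc_diff[of v "max M k"] by (simp add: h_times_iff)
    ultimately have "(v - h_trunc (max M k) v) + (h_trunc (max M k) v - l) \<in> h_times k UNIV"
      by (rule h_times_add[rotated])
    then show ?thesis by simp
  qed
  then have "v - l = 0" by (rule h_times_eq_0)
  with l(1) show "v \<in> B" by simp
qed

text \<open>\<open>h_span diag\<close> is itself one of the sets being intersected, and it is
  contained in each of them.\<close>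

lemma VH_eq: "VH = h_span diag"
proof
  have "hgen (i, i) k \<in> h_span diag" for i :: 'a and k
    by (rule h_span_gen) (auto simp: diag_def)
  then show "VH \<subseteq> (h_span diag :: 'a hplus set)"
    unfolding VH_def using h_subalgebra_h_span[OF diag_nonempty] topologically_free_h_span by blast
  show "(h_span diag :: 'a hplus set) \<subseteq> VH"
    unfolding VH_def
  proof (rule Inter_greatest)
    fix B :: "'a hplus set"
    assume "B \<in> {B. h_subalgebra B \<and> topologically_free B \<and> (\<forall>i k. hgen (i, i) k \<in> B)}"
    then show "h_span diag \<subseteq> B" by (intro h_span_subset) (auto simp: diag_def)
  qed
qed

section \<open>The coefficients of \<open>S\<close>\<close>

lemma S_diff_coeff_neg: "b < 0 \<Longrightarrow> S_diff_coeff c e f a b = 0"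
  by (simp add: S_diff_coeff_def)

lemma S_coeff_0: "S_coeff c e f 0 = 0"
  by (simp add: S_coeff_def fps_eq_iff)

text \<open>\<open>S(u)\<close> has no constant term, so \<open>S(u - v)\<close> contains only
  negative powers of \<open>u\<close>. In the Wick formula this removes the contractions whose left
  factor is a creation operator.\<close>

lemma S_diff_coeff_nonneg:
  assumes "a \<ge> 0"
  shows "S_diff_coeff c e f a b = 0"
proof (cases "b \<ge> 0 \<and> a + b \<le> 0")
  case True
  with assms have "a = 0" "b = 0" by auto
  then show ?thesis by (simp add: S_diff_coeff_def S_coeff_0)
qed (auto simp: S_diff_coeff_def)

text \<open>The trace conditions say that \<open>g\<close> times
  \<open>D = N (1 + t s) - (t + s)\<close> equals \<open>N\<close>, where
  \<open>s = -t + C t^2 - ...\<close> is the shifted argument; the coefficients of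
  \<open>t^0\<close>, \<open>t^1\<close>, \<open>t^2\<close> are compared.\<close>

lemma G_series_coeffs:
  defines "g \<equiv> G_series TYPE('n::finite)"
  shows "g $$ 0 = 1" "g $$ 1 = 0" "g $$ 2 = [:1, 1 / of_nat CARD('n):]"
proof -
  define N :: "complex poly" where "N = of_nat CARD('n)"
  define D :: "complex poly fps"
    where "D = of_nat CARD('n) * (1 + fps_X * shifted_arg [:0, 1:]) - (fps_X + shifted_arg [:0, 1:])"
  have "G_condition TYPE('n) g"
    unfolding g_def G_series_def by (rule theI'[OF G_condition_ex1])
  then have gD: "g * D = fps_const N"
    by (simp add: G_condition_iff D_def N_def fps_of_nat)
  have D: "D = fps_const N * (1 + fps_X * shifted_arg [:0, 1:]) - (fps_X + shifted_arg [:0, 1:])"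
    by (simp add: D_def N_def fps_of_nat)
  have D0: "D $$ 0 = N" and D1: "D $$ 1 = 0" and D2: "D $$ 2 = - N - [:0, 1:]"
    by (simp_all add: D shifted_arg_def numeral_2_eq_2)
  have nz: "N \<noteq> 0" by (simp add: N_def)
  have "(g * D) $$ 0 = g $$ 0 * D $$ 0" by simp
  then show g0: "g $$ 0 = 1" using nz by (simp add: gD D0)
  have "(g * D) $$ 1 = g $$ 0 * D $$ 1 + g $$ 1 * D $$ 0" by (simp add: fps_mult_nth)
  then show g1: "g $$ 1 = 0" using nz D1 by (simp add: gD D0)
  have "(g * D) $$ 2 = g $$ 0 * D $$ 2 + g $$ 1 * D $$ 1 + g $$ 2 * D $$ 0"
    by (simp add: fps_mult_nth numeral_2_eq_2)
  moreover have "(g * D) $$ 2 = 0" by (simp add: gD)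
  ultimately have "g $$ 2 * N = N + [:0, 1:]"
    using g0 g1 by (simp add: D0 D2 algebra_simps)
  also have "\<dots> = [:1, 1 / of_nat CARD('n):] * N"
    by (simp add: N_def of_nat_poly)
  finally show "g $$ 2 = [:1, 1 / of_nat CARD('n):]"
    using mult_right_cancel[OF nz] by blast
qed

abbreviation gram :: "'n::finite \<Rightarrow> 'n \<Rightarrow> complex" where
  "gram i j \<equiv> (if i = j then 1 else 0) - 1 / of_nat CARD('n)"

text \<open>At \<open>t^2\<close> the factor \<open>G\<close> contributes \<open>1 + c/N\<close>,
  while the product of the two \<open>R\<close> contributes \<open>-1\<close> from the identity and
  \<open>-c\<close> from the flip. The latter has a coefficient at
  \<open>e_ii \<otimes> e_jj\<close> only for \<open>i = j\<close>.\<close>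

lemma GRR_minus_I_coeff_2:
  "tensor_entry (GRR_minus_I c) (i, i) (j, j) $$ 2 =
     - c * (gram i j)" for i j :: "'n::finite"
proof -
  define g where "g = Abs_fps (\<lambda>k. poly (fps_nth (G_series TYPE('n)) k) c)"
  define U where "U = (1 + fps_X * shifted_arg c) - fps_const (if i = j then 1 else 0) * (fps_X + shifted_arg c)"
  have "tensor_entry (GRR_minus_I c) (i, i) (j, j) = g * U - 1"
    by (simp add: tensor_entry_def GRR_minus_I_def scale_mat_def RR_mat_entry g_def U_def)
      (simp add: mat_def flip_mat_def)
  then have "tensor_entry (GRR_minus_I c) (i, i) (j, j) $$ 2 = (g * U) $$ 2" by simp
  also have "(g * U) $$ 2 = g $$ 0 * U $$ 2 + g $$ 1 * U $$ 1 + g $$ 2 * U $$ 0"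
    by (simp add: fps_mult_nth numeral_2_eq_2)
  finally have "tensor_entry (GRR_minus_I c) (i, i) (j, j) $$ 2 = g $$ 0 * U $$ 2 + g $$ 1 * U $$ 1 + g $$ 2 * U $$ 0" .
  moreover have "U $$ 0 = 1" "U $$ 1 = 0" "U $$ 2 = - 1 - (if i = j then c else 0)"
    by (simp_all add: U_def shifted_arg_def numeral_2_eq_2)
  moreover have "g $$ 0 = 1" "g $$ 1 = 0" "g $$ 2 = 1 + c / of_nat CARD('n)"
    by (simp_all add: g_def G_series_coeffs G_series_coeffs[unfolded One_nat_def])
  ultimately show ?thesis by (cases "i = j") (simp_all add: algebra_simps)
qed

text \<open>The coefficients in the expansion of \<open>(u - v)^(-2)\<close> in powers of
  \<open>v\<close>. They produce the factor \<open>r\<close> in the Heisenberg bracket.\<close>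

lemma gbinomial_minus_two: "((- 2 :: complex) gchoose k) * (- 1) ^ k = of_nat (Suc k)"
proof -
  have "((- 2 :: complex) gchoose k) = (- 1) ^ k * (of_nat (Suc k) gchoose k)"
    using gbinomial_minus[of "2 :: complex" k] by (simp add: algebra_simps)
  also have "(of_nat (Suc k) gchoose k) = (of_nat (Suc k choose k) :: complex)"
    by (rule binomial_gbinomial[symmetric])
  also have "Suc k choose k = Suc k" by simp
  finally show ?thesis by (simp flip: power_add mult.assoc)
qed

text \<open>Modulo \<open>h\<close> only the term \<open>c (I/N - P) u^(-2)\<close> of \<open>S(u)\<close> survives.\<close>

lemma S_diff_coeff_mod_h:
  "S_diff_coeff c (i, i) (j, j) (- int m - 1) (int k) $$ 0 =
     (if m = Suc k then - c * of_nat m * (gram i j) else 0)"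
  for i j :: "'n::finite"
proof -
  \<comment> \<open>The coefficient of \<open>u^(-n)\<close> carries \<open>h^n\<close> divided by
    \<open>h^2\<close>, so only \<open>n = 2\<close> reaches \<open>h^0\<close>.\<close>
  have S: "S_coeff c (i, i) (j, j) n $$ 0 = (if n = 2 then tensor_entry (GRR_minus_I c) (i, i) (j, j) $$ 2 else 0)" for n
    by (auto simp: S_coeff_def)
  show ?thesis
  proof (cases "k \<le> Suc m")
    case True
    then have n: "nat (- (- int m - 1 + int k)) = Suc m - k" by linarith
    have "S_diff_coeff c (i, i) (j, j) (- int m - 1) (int k) $$ 0
      = ((of_int (- int m - 1 + int k) gchoose k) * (- 1) ^ k) * S_coeff c (i, i) (j, j) (Suc m - k) $$ 0"
      using True unfolding S_diff_coeff_def n by simp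
    also have "\<dots> = (if m = Suc k then - c * of_nat m * (gram i j) else 0)"
    proof (cases "m = Suc k")
      case mk: True
      have "of_int (- int m - 1 + int k) = (- 2 :: complex)" by (simp add: mk)
      then show ?thesis
        using mk by (simp only: S GRR_minus_I_coeff_2 gbinomial_minus_two) simp
    next
      case False
      then have "Suc m - k \<noteq> 2" using True by auto
      with False show ?thesis by (simp add: S)
    qed
    finally show ?thesis .
  qed (auto simp: S_diff_coeff_def)
qed


section \<open>Normal ordering\<close>

lemma hlinear_mult_right: "hlinear F \<Longrightarrow> hlinear (\<lambda>v. F v * w)"
  by (simp add: hlinear_def algebra_simps)
lemma hlinear_mult_left: "hlinear F \<Longrightarrow> hlinear (\<lambda>v. w * F v)"
  by (simp add: hlinear_def algebra_simps)
lemma hlinear_id: "hlinear (\<lambda>v. v)"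
  by (simp add: hlinear_def)
lemma hlinear_diff: "hlinear F \<Longrightarrow> hlinear G \<Longrightarrow> hlinear (\<lambda>v. F v - G v)"
  by (simp add: hlinear_def algebra_simps)
lemma hlinear_comp: "hlinear F \<Longrightarrow> hlinear G \<Longrightarrow> hlinear (\<lambda>v. F (G v))"
  by (simp add: hlinear_def)

section \<open>Partial matchings of an index set\<close>

definition matchings :: "nat set \<Rightarrow> (nat \<times> nat) set set" where
  "matchings A = {I. I \<subseteq> A \<times> A \<and> (\<forall>(p, q)\<in>I. p < q) \<and>
     (\<forall>x\<in>I. \<forall>y\<in>I. x \<noteq> y \<longrightarrow> {fst x, snd x} \<inter> {fst y, snd y} = {})}"

lemma matchingsI:
  assumes "I \<subseteq> A \<times> A" "\<And>p q. (p, q) \<in> I \<Longrightarrow> p < q"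
    "\<And>x y. x \<in> I \<Longrightarrow> y \<in> I \<Longrightarrow> x \<noteq> y \<Longrightarrow> {fst x, snd x} \<inter> {fst y, snd y} = {}"
  shows "I \<in> matchings A"
proof -
  have "\<forall>(p, q)\<in>I. p < q" using assms(2) by auto
  moreover have "\<forall>x\<in>I. \<forall>y\<in>I. x \<noteq> y \<longrightarrow> {fst x, snd x} \<inter> {fst y, snd y} = {}"
    by (intro ballI impI) (rule assms(3))
  ultimately show ?thesis using assms(1) unfolding matchings_def by blast
qed

lemma matchingsD:
  assumes "I \<in> matchings A"
  shows "I \<subseteq> A \<times> A" "\<And>p q. (p, q) \<in> I \<Longrightarrow> p < q"
    "\<And>x y. x \<in> I \<Longrightarrow> y \<in> I \<Longrightarrow> x \<noteq> y \<Longrightarrow> {fst x, snd x} \<inter> {fst y, snd y} = {}"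
  using assms unfolding matchings_def by blast+

lemma matchings_mono: "A \<subseteq> B \<Longrightarrow> matchings A \<subseteq> matchings B"
  unfolding matchings_def by blast

lemma finite_matchings: "finite A \<Longrightarrow> finite (matchings A)"
  unfolding matchings_def by (rule finite_subset[of _ "Pow (A \<times> A)"]) auto

text \<open>The pairs are disjoint two-element subsets of \<open>A\<close>. Hence the bound
  \<open>n div 2\<close> on the number of pairs in the definition of the bracket loses no
  matching.\<close>

lemma card_matching_le:
  assumes "finite A" "I \<in> matchings A"
  shows "2 * card I \<le> card A"
proof -
  note I = matchingsD[OF assms(2)]
  have fin: "finite I" using I(1) assms(1) by (meson finite_SigmaI finite_subset)
  have "2 * card I = (\<Sum>x\<in>I. card {fst x, snd x})"
  proof -
    have "card {fst x, snd x} = 2" if "x \<in> I" for x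
      using I(2)[of "fst x" "snd x"] that by (cases x) auto
    then show ?thesis by simp
  qed
  also have "\<dots> = card (\<Union>x\<in>I. {fst x, snd x})"
    using fin I(3) by (subst card_UN_disjoint) auto
  also have "\<dots> \<le> card A"
    using I(1) assms(1) by (intro card_mono) auto
  finally show ?thesis .
qed

lemma matchings_empty [simp]: "matchings {} = {{}}"
  by (auto simp: matchings_def)

text \<open>The minimum is either unmatched or the left entry of exactly one pair; it can never be a
  right entry.\<close>

lemma matchings_insert_Min:
  assumes m: "\<And>x. x \<in> A \<Longrightarrow> m < x"
  shows "matchings (insert m A) = matchings A \<union> (\<Union>j\<in>A. insert (m, j) ` matchings (A - {j}))"
    (is "?L = ?R1 \<union> ?R2")
proof (intro equalityI subsetI)
  fix I assume I: "I \<in> ?L"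
  note sub = matchingsD(1)[OF I] and lt = matchingsD(2)[OF I] and dis = matchingsD(3)[OF I]
  show "I \<in> ?R1 \<union> ?R2"
  proof (cases "\<exists>j. (m, j) \<in> I")
    case True
    then obtain j where j: "(m, j) \<in> I" by blast
    then have jA: "j \<in> A" using lt[OF j] sub by auto
    have "I - {(m, j)} \<subseteq> (A - {j}) \<times> (A - {j})"
    proof
      fix x assume x: "x \<in> I - {(m, j)}"
      then have "{fst x, snd x} \<inter> {m, j} = {}" using dis[of x "(m, j)"] j by auto
      with x sub show "x \<in> (A - {j}) \<times> (A - {j})" by (cases x) auto
    qed
    then have "I - {(m, j)} \<in> matchings (A - {j})"
      by (rule matchingsI) (use lt in blast, rule dis, auto)
    moreover have "I = insert (m, j) (I - {(m, j)})" using j by blast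
    ultimately show ?thesis using jA by blast
  next
    case False
    have "I \<subseteq> A \<times> A"
    proof
      fix x assume x: "x \<in> I"
      obtain p q where pq: "x = (p, q)" by (cases x)
      from x pq False have "p \<noteq> m" by auto
      then have "p \<in> A" using sub x pq by auto
      moreover have "q \<noteq> m" using lt[of p q] m[OF \<open>p \<in> A\<close>] x pq by auto
      ultimately show "x \<in> A \<times> A" using sub x pq by auto
    qed
    then have "I \<in> matchings A" using lt dis by (rule matchingsI)
    then show ?thesis by blast
  qed
next
  fix I assume "I \<in> ?R1 \<union> ?R2"
  then show "I \<in> ?L"
  proof
    show "I \<in> ?R1 \<Longrightarrow> I \<in> ?L" using matchings_mono[of A "insert m A"] by blast
    assume "I \<in> ?R2"
    then obtain j I' where j: "j \<in> A" and I': "I' \<in> matchings (A - {j})" and I: "I = insert (m, j) I'" by blast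
    note sub = matchingsD(1)[OF I'] and lt = matchingsD(2)[OF I'] and dis = matchingsD(3)[OF I']
    have mA: "m \<notin> A" using m by blast
    have new: "{fst x, snd x} \<inter> {m, j} = {}" if "x \<in> I'" for x
      using sub that mA by auto
    have "{fst x, snd x} \<inter> {fst y, snd y} = {}" if "x \<in> I" "y \<in> I" "x \<noteq> y" for x y
      using that new[of x] new[of y] dis[of x y] unfolding I by auto
    moreover have "I \<subseteq> insert m A \<times> insert m A" using sub j unfolding I by blast
    moreover have "p < q" if "(p, q) \<in> I" for p q using lt m[OF j] that unfolding I by auto
    ultimately show "I \<in> ?L" by (intro matchingsI)
  qed
qed

section \<open>Commutation relations of the annihilation operators\<close>

locale x_minus =
  fixes c :: complex and xm :: "'n::finite \<times> 'n \<Rightarrow> nat \<Rightarrow> 'n hplus \<Rightarrow> 'n hplus"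
  assumes x_minus: "is_x_minus c xm"
begin

lemma xm_hlinear: "hlinear (xm e m)"
  using x_minus unfolding is_x_minus_def by blast

lemma xm_one [simp]: "xm e m 1 = 0"
  using x_minus unfolding is_x_minus_def by blast

lemma xm_monom:
  "xm a m (h_monom e q {1..n}) =
     - (\<Sum>j\<in>{1..n}. hscalar (S_diff_coeff c a (e j) (- int m - 1) (int (q j))) *
          (h_monom e q ({1..n} - {j})))"
proof (cases "n \<ge> 1")
  case True
  \<comment> \<open>The defining relation reads the index of the acting operator from
    \<open>e 0\<close>, a slot that the products over \<open>{1..n}\<close> do not see.\<close>
  let ?e = "e(0 := a)"
  have "xm (?e 0) m (\<Prod>l\<in>{1..n}. hgen (?e l) (q l)) =
     - (\<Sum>j\<in>{1..n}. hscalar (S_diff_coeff c (?e 0) (?e j) (- int m - 1) (int (q j))) *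
          (\<Prod>l\<in>{1..n} - {j}. hgen (?e l) (q l)))"
    using x_minus True unfolding is_x_minus_def by blast
  moreover have "(\<Prod>l\<in>{1..n} - X. hgen (?e l) (q l)) = (\<Prod>l\<in>{1..n} - X. hgen (e l) (q l))" for X
    by (intro prod.cong) auto
  from this this[of "{}"] have "(\<Prod>l\<in>{1..n} - X. hgen (?e l) (q l)) = (\<Prod>l\<in>{1..n} - X. hgen (e l) (q l))"
    "(\<Prod>l\<in>{1..n}. hgen (?e l) (q l)) = h_monom e q {1..n}" for X
    by simp_all
  ultimately show ?thesis by (auto simp: intro!: sum.cong)
next
  case False
  then have "n = 0" by simp
  then show ?thesis by simp
qed

text \<open>In the defining relation for a monomial with one more factor, the summand of that factor
  is the scalar term, and all other summands keep the factor. Continuity extends this from monomials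
  to all of \<open>H+\<close>.\<close>

lemma xm_commutator:
  "xm a m (v * hgen b k) = xm a m v * hgen b k - hscalar (S_diff_coeff c a b (- int m - 1) (int k)) * v"
proof (rule hlinear_eqI[where E = UNIV and F = "\<lambda>v. xm a m (v * hgen b k)" and
      G = "\<lambda>v. xm a m v * hgen b k - hscalar (S_diff_coeff c a b (- int m - 1) (int k)) * v"])
  show "hlinear (\<lambda>v. xm a m (v * hgen b k))"
    by (rule hlinear_comp[OF xm_hlinear hlinear_mult_right[OF hlinear_id]])
  show "hlinear (\<lambda>v. xm a m v * hgen b k - hscalar (S_diff_coeff c a b (- int m - 1) (int k)) * v)"
    by (intro hlinear_diff hlinear_mult_right xm_hlinear hlinear_mult_left hlinear_id)
  fix v :: "'n hplus" assume "v \<in> h_monoms UNIV"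
  then obtain n :: nat and e q where v: "v = h_monom e q {1..n}"
    unfolding h_monoms_def by blast
  let ?e = "e(Suc n := b)" and ?q = "q(Suc n := k)"
  let ?g = "\<lambda>l. hgen (?e l) (?q l)"
  have vg: "v * hgen b k = (\<Prod>l\<in>{1..Suc n}. ?g l)"
    by (auto simp: v prod.nat_ivl_Suc' mult.commute intro!: prod.cong)
  have p: "(\<Prod>l\<in>{1..Suc n} - {j}. ?g l) = (h_monom e q ({1..n} - {j})) * hgen b k" if "j \<in> {1..n}" for j
  proof -
    have "{1..Suc n} - {j} = insert (Suc n) ({1..n} - {j})" using that by auto
    then have "(\<Prod>l\<in>{1..Suc n} - {j}. ?g l) = hgen b k * (\<Prod>l\<in>{1..n} - {j}. ?g l)" by simp
    also have "(\<Prod>l\<in>{1..n} - {j}. ?g l) = (h_monom e q ({1..n} - {j}))"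
      by (intro prod.cong) auto
    finally show ?thesis by (simp add: mult.commute)
  qed
  have p': "(\<Prod>l\<in>{1..Suc n} - {Suc n}. ?g l) = v"
  proof -
    have "{1..Suc n} - {Suc n} = {1..n}" by auto
    then show ?thesis unfolding v by (intro prod.cong) auto
  qed
  let ?S = "\<lambda>j. hscalar (S_diff_coeff c a (?e j) (- int m - 1) (int (?q j)))"
  have split: "(\<Sum>j\<in>{1..Suc n}. F j) = F (Suc n) + (\<Sum>j\<in>{1..n}. F j)" for F :: "nat \<Rightarrow> 'n hplus"
    by (simp add: add.commute)
  have "xm a m (v * hgen b k) = - (\<Sum>j\<in>{1..Suc n}. ?S j * (\<Prod>l\<in>{1..Suc n} - {j}. ?g l))"
    unfolding vg xm_monom ..
  also have "(\<Sum>j\<in>{1..Suc n}. ?S j * (\<Prod>l\<in>{1..Suc n} - {j}. ?g l))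
     = ?S (Suc n) * v + (\<Sum>j\<in>{1..n}. ?S j * (\<Prod>l\<in>{1..Suc n} - {j}. ?g l))"
    unfolding split p' ..
  also have "(\<Sum>j\<in>{1..n}. ?S j * (\<Prod>l\<in>{1..Suc n} - {j}. ?g l))
     = (\<Sum>j\<in>{1..n}. hscalar (S_diff_coeff c a (e j) (- int m - 1) (int (q j))) *
          (h_monom e q ({1..n} - {j}))) * hgen b k"
    unfolding sum_distrib_right
  proof (rule sum.cong[OF refl])
    fix j assume j: "j \<in> {1..n}"
    then have "(?S j :: 'n hplus) = hscalar (S_diff_coeff c a (e j) (- int m - 1) (int (q j)))" by auto
    then show "?S j * (\<Prod>l\<in>{1..Suc n} - {j}. ?g l) = hscalar (S_diff_coeff c a (e j) (- int m - 1) (int (q j))) *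
        (h_monom e q ({1..n} - {j})) * hgen b k"
      by (simp only: p[OF j] mult.assoc)
  qed
  also have "\<dots> = - xm a m v * hgen b k" unfolding v xm_monom by simp
  finally show "xm a m (v * hgen b k) = xm a m v * hgen b k - hscalar (S_diff_coeff c a b (- int m - 1) (int k)) * v"
    by simp
qed auto

text \<open>Both operators kill 1 and have scalar commutators with the generators; hence their
  commutator commutes with every generator and vanishes on monomials by induction on the
  length.\<close>

lemma xm_commute: "xm a m (xm b m' v) = xm b m' (xm a m v)"
proof (rule hlinear_eqI[where E = UNIV and F = "\<lambda>v. xm a m (xm b m' v)" and G = "\<lambda>v. xm b m' (xm a m v)"])
  show "hlinear (\<lambda>v. xm a m (xm b m' v))" "hlinear (\<lambda>v. xm b m' (xm a m v))"
    by (auto intro: hlinear_comp xm_hlinear)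
  fix v :: "'n hplus" assume "v \<in> h_monoms UNIV"
  then obtain n :: nat and e q where v: "v = h_monom e q {1..n}"
    unfolding h_monoms_def by blast
  show "xm a m (xm b m' v) = xm b m' (xm a m v)"
    unfolding v
  proof (induction n)
    case (Suc n)
    have "(h_monom e q {1..Suc n}) = (h_monom e q {1..n}) * hgen (e (Suc n)) (q (Suc n))"
      by (simp add: prod.nat_ivl_Suc' mult.commute)
    with Suc show ?case
      by (simp only: xm_commutator hlinearD[OF xm_hlinear]) simp
  qed (simp add: hlinearD[OF xm_hlinear])
qed auto

lemma xm_diag_h_span: "a \<in> diag \<Longrightarrow> v \<in> h_span diag \<Longrightarrow> xm a m v \<in> h_span diag"
proof (rule hlinear_closed[OF xm_hlinear, where E = diag])
  fix v :: "'n hplus" assume "v \<in> h_monoms diag"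
  then obtain n :: nat and e q where e: "\<forall>l. e l \<in> diag" and v: "v = h_monom e q {1..n}"
    unfolding h_monoms_def by blast
  have "(\<Sum>j\<in>{1..n}. hscalar (S_diff_coeff c a (e j) (- int m - 1) (int (q j))) *
          (h_monom e q ({1..n} - {j}))) \<in> h_span diag"
    using e by (intro h_span_sum h_span_scale h_span_prod h_span_gen) auto
  from h_span_diff[OF h_span_0 this] show "xm a m v \<in> h_span diag"
    unfolding v xm_monom by simp
qed auto

text \<open>The normally ordered product: factors with nonnegative exponent multiply from outside,
  while the others are pushed into the argument and so act before every multiplication.\<close>

primrec normal_op :: "(nat \<Rightarrow> 'n \<times> 'n) \<Rightarrow> (nat \<Rightarrow> int) \<Rightarrow> nat list \<Rightarrow> 'n hplus \<Rightarrow> 'n hplus" where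
  "normal_op e p [] w = w"
| "normal_op e p (l # ls) w =
     (if p l \<ge> 0 then hgen (e l) (nat (p l)) * normal_op e p ls w
      else normal_op e p ls (xm (e l) (nat (- p l - 1)) w))"

lemma normal_op_cong: "(\<And>l. l \<in> set ls \<Longrightarrow> p l = p' l) \<Longrightarrow> normal_op e p ls w = normal_op e p' ls w"
  by (induction ls arbitrary: w) simp_all

text \<open>Creation operators commute with each other, and so do annihilation operators; thus a
  factor can also be split off at the end of the list. The recursion for \<open>Y\<close> removes
  the last factor, the Wick induction the first.\<close>

lemma normal_op_snoc:
  "normal_op e p (ls @ [l]) w =
     (if p l \<ge> 0 then hgen (e l) (nat (p l)) * normal_op e p ls w
      else normal_op e p ls (xm (e l) (nat (- p l - 1)) w))"
  by (induction ls arbitrary: w) (simp_all add: mult.left_commute xm_commute)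

lemma normal_op_h_span:
  "(\<And>l. e l \<in> diag) \<Longrightarrow> w \<in> h_span diag \<Longrightarrow> normal_op e p ls w \<in> h_span diag"
  by (induction ls arbitrary: w) (auto intro: h_span_mult h_span_gen xm_diag_h_span)

text \<open>Moving an annihilation operator inwards past the multiplications costs one contraction
  per creation factor.\<close>

lemma xm_normal_op:
  assumes "distinct ls"
  shows "xm a m (normal_op e p ls w) = normal_op e p ls (xm a m w) -
    (\<Sum>j\<in>set ls. hscalar (S_diff_coeff c a (e j) (- int m - 1) (p j)) * normal_op e p (remove1 j ls) w)"
  using assms
proof (induction ls arbitrary: w)
  case (Cons l ls)
  let ?S = "\<lambda>j. hscalar (S_diff_coeff c a (e j) (- int m - 1) (p j))"
  have l: "l \<notin> set ls" and dist: "distinct ls" using Cons.prems by auto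
  note IH = Cons.IH[OF dist]
  have sum: "(\<Sum>j\<in>set (l # ls). ?S j * normal_op e p (remove1 j (l # ls)) w)
      = ?S l * normal_op e p ls w + (\<Sum>j\<in>set ls. ?S j * normal_op e p (l # remove1 j ls) w)"
  proof -
    have "(\<Sum>j\<in>set ls. ?S j * normal_op e p (remove1 j (l # ls)) w)
        = (\<Sum>j\<in>set ls. ?S j * normal_op e p (l # remove1 j ls) w)"
      using l by (intro sum.cong) auto
    then show ?thesis using l by simp
  qed
  show ?case
  proof (cases "p l \<ge> 0")
    case True
    let ?g = "hgen (e l) (nat (p l))"
    have "xm a m (normal_op e p (l # ls) w) = xm a m (normal_op e p ls w) * ?g - ?S l * normal_op e p ls w"
      using True xm_commutator[of a m "normal_op e p ls w" "e l" "nat (p l)"] by (simp add: mult.commute)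
    moreover have "(\<Sum>j\<in>set ls. ?S j * normal_op e p (l # remove1 j ls) w)
        = (\<Sum>j\<in>set ls. ?S j * normal_op e p (remove1 j ls) w) * ?g"
      unfolding sum_distrib_right using True by (intro sum.cong) (auto simp: mult_ac)
    ultimately show ?thesis unfolding sum IH using True by (simp add: algebra_simps)
  next
    case False
    \<comment> \<open>An annihilation factor has a negative exponent, and \<open>S\<close> is
      expanded in nonnegative powers of its second variable, so no contraction arises.\<close>
    then have z: "?S l = 0" by (simp add: S_diff_coeff_neg)
    show ?thesis unfolding sum z using False by (simp add: IH xm_commute[of a])
  qed
qed simp

text \<open>The bracket over an arbitrary index set, with all numbers of pairs collected in one sum,
  so that an induction may delete any index.\<close>

definition bracket_on :: "(nat \<Rightarrow> 'n \<times> 'n) \<Rightarrow> (nat \<Rightarrow> int) \<Rightarrow> nat set \<Rightarrow> 'n hplus \<Rightarrow> 'n hplus" where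
  "bracket_on e p A w =
     (\<Sum>I\<in>matchings A. hscalar (\<Prod>(a, b)\<in>I. S_diff_coeff c (e a) (e b) (p a) (p b)) *
        foldr (\<lambda>l. x_op xm (e l) (p l)) (sorted_list_of_set (A - (fst ` I \<union> snd ` I))) w)"

lemma x_bracket_eq_bracket_on: "x_bracket c xm n e p w = bracket_on e p {1..n} w"
proof -
  let ?f = "\<lambda>I. hscalar (\<Prod>(a, b)\<in>I. S_diff_coeff c (e a) (e b) (p a) (p b)) *
        foldr (\<lambda>l. x_op xm (e l) (p l)) (sorted_list_of_set ({1..n} - (fst ` I \<union> snd ` I))) w"
  have "x_bracket c xm n e p w = (\<Sum>k\<in>{0..n div 2}. \<Sum>I\<in>{I \<in> matchings {1..n}. card I = k}. ?f I)"
  proof -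
    have "pairings n k = {I \<in> matchings {1..n}. card I = k}" for k
      unfolding pairings_def matchings_def by blast
    then show ?thesis unfolding x_bracket_def by simp
  qed
  also have "\<dots> = (\<Sum>I\<in>matchings {1..n}. ?f I)"
  proof (rule sum.group)
    have "card I \<le> n div 2" if "I \<in> matchings {1..n}" for I
      using card_matching_le[OF _ that] by simp
    then show "card ` matchings {1..n} \<subseteq> {0..n div 2}" by auto
  qed (simp_all add: finite_matchings)
  finally show ?thesis unfolding bracket_on_def .
qed

lemma x_op_hlinear: "hlinear (x_op xm e p)"
  unfolding x_op_def by (cases "p \<ge> 0") (simp_all add: hlinear_mult_left hlinear_id xm_hlinear)

text \<open>The smallest index comes first in the sorted list and first in any pair containing it.
  So it is either the outermost operator or contracted with a single \<open>j\<close>, and in the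
  latter case both indices disappear.\<close>

lemma bracket_on_insert_Min:
  assumes A: "finite A" and m: "\<And>x. x \<in> A \<Longrightarrow> m < x"
  shows "bracket_on e p (insert m A) w = x_op xm (e m) (p m) (bracket_on e p A w) +
    (\<Sum>j\<in>A. hscalar (S_diff_coeff c (e m) (e j) (p m) (p j)) * bracket_on e p (A - {j}) w)"
proof -
  let ?s = "\<lambda>(a, b). S_diff_coeff c (e a) (e b) (p a) (p b)"
  let ?f = "\<lambda>A I. hscalar (\<Prod>x\<in>I. ?s x) *
        foldr (\<lambda>l. x_op xm (e l) (p l)) (sorted_list_of_set (A - (fst ` I \<union> snd ` I))) w"
  have mA: "m \<notin> A" using m by blast
  have sub: "I \<subseteq> A \<times> A" if "I \<in> matchings A" for I A
    using that unfolding matchings_def by blast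
  let ?R = "\<lambda>j. insert (m, j) ` matchings (A - {j})"
  have "bracket_on e p (insert m A) w = (\<Sum>I\<in>matchings A \<union> (\<Union>j\<in>A. ?R j). ?f (insert m A) I)"
  proof -
    have "matchings (insert m A) = matchings A \<union> (\<Union>j\<in>A. ?R j)"
      by (rule matchings_insert_Min) (rule m)
    then show ?thesis unfolding bracket_on_def by simp
  qed
  also have "\<dots> = (\<Sum>I\<in>matchings A. ?f (insert m A) I) + (\<Sum>I\<in>(\<Union>j\<in>A. ?R j). ?f (insert m A) I)"
    using A mA by (intro sum.union_disjoint) (auto simp: finite_matchings dest: sub)
  also have "(\<Sum>I\<in>(\<Union>j\<in>A. ?R j). ?f (insert m A) I) = (\<Sum>j\<in>A. \<Sum>I\<in>?R j. ?f (insert m A) I)"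
  proof (rule sum.UNION_disjoint)
    show "\<forall>i\<in>A. \<forall>j\<in>A. i \<noteq> j \<longrightarrow> ?R i \<inter> ?R j = {}"
    proof (intro ballI impI equals0I)
      fix i j I assume ij: "i \<in> A" "j \<in> A" "i \<noteq> j" "I \<in> ?R i \<inter> ?R j"
      then obtain I' where "I' \<in> matchings (A - {j})" "(m, i) \<in> insert (m, j) I'" by blast
      with sub[of I' "A - {j}"] ij(3) mA show False by auto
    qed
  qed (use A in \<open>auto simp: finite_matchings\<close>)
  also have "(\<Sum>j\<in>A. \<Sum>I\<in>?R j. ?f (insert m A) I)
      = (\<Sum>j\<in>A. hscalar (?s (m, j)) * bracket_on e p (A - {j}) w)"
  proof (rule sum.cong[OF refl])
    fix j assume j: "j \<in> A"
    have notin: "(m, j) \<notin> I" if "I \<in> matchings (A - {j})" for I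
      using sub[OF that] by blast
    then have "inj_on (insert (m, j)) (matchings (A - {j}))"
      unfolding inj_on_def by (metis Diff_insert_absorb)
    then have "(\<Sum>I\<in>?R j. ?f (insert m A) I) = (\<Sum>I\<in>matchings (A - {j}). ?f (insert m A) (insert (m, j) I))"
      by (simp add: sum.reindex)
    also have "\<dots> = (\<Sum>I\<in>matchings (A - {j}). hscalar (?s (m, j)) * ?f (A - {j}) I)"
    proof (rule sum.cong[OF refl])
      fix I assume I: "I \<in> matchings (A - {j})"
      have "finite I" using sub[OF I] A by (meson finite_Diff finite_SigmaI finite_subset)
      then have "(\<Prod>x\<in>insert (m, j) I. ?s x) = ?s (m, j) * (\<Prod>x\<in>I. ?s x)"
        using notin[OF I] by simp
      moreover have "insert m A - (fst ` insert (m, j) I \<union> snd ` insert (m, j) I) = (A - {j}) - (fst ` I \<union> snd ` I)"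
        using mA by auto
      ultimately show "?f (insert m A) (insert (m, j) I) = hscalar (?s (m, j)) * ?f (A - {j}) I"
        by (simp only: hscalar_mult mult.assoc)
    qed
    also have "\<dots> = hscalar (?s (m, j)) * bracket_on e p (A - {j}) w"
      unfolding bracket_on_def sum_distrib_left ..
    finally show "(\<Sum>I\<in>?R j. ?f (insert m A) I) = hscalar (?s (m, j)) * bracket_on e p (A - {j}) w" .
  qed
  also have "(\<Sum>I\<in>matchings A. ?f (insert m A) I) = (\<Sum>I\<in>matchings A. x_op xm (e m) (p m) (?f A I))"
  proof (rule sum.cong[OF refl])
    fix I assume I: "I \<in> matchings A"
    let ?B = "A - (fst ` I \<union> snd ` I)"
    have "insert m A - (fst ` I \<union> snd ` I) = insert m ?B"
      using sub[OF I] mA by force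
    moreover have "sorted_list_of_set (insert m ?B) = m # sorted_list_of_set ?B"
    proof -
      have "Min (insert m ?B) = m" using A m by (intro Min_eqI) (auto intro: less_imp_le)
      moreover have "insert m ?B - {m} = ?B" using mA by auto
      ultimately show ?thesis using A sorted_list_of_set_nonempty[of "insert m ?B"] by simp
    qed
    ultimately show "?f (insert m A) I = x_op xm (e m) (p m) (?f A I)"
      by (simp add: hlinearD[OF x_op_hlinear])
  qed
  also have "\<dots> = x_op xm (e m) (p m) (bracket_on e p A w)"
    unfolding bracket_on_def by (simp add: hlinear_sum[OF x_op_hlinear])
  finally show ?thesis by simp
qed

text \<open>The Wick formula: the contractions in \<open>x\<^bsub>[n]\<^esub>\<close> turn the product of the \<open>x(u_i)\<close> into the normally
  ordered product.\<close>

lemma bracket_on_eq_normal_op: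
  "finite A \<Longrightarrow> bracket_on e p A w = normal_op e p (sorted_list_of_set A) w"
proof (induction "card A" arbitrary: A rule: less_induct)
  case less
  show ?case
  proof (cases "A = {}")
    case True
    then show ?thesis by (simp add: bracket_on_def)
  next
    case False
    define m B where "m = Min A" and "B = A - {m}"
    have A: "A = insert m B" "m \<notin> B" "finite B" and m: "\<And>x. x \<in> B \<Longrightarrow> m < x"
      using Min_in[OF less.prems False] less.prems by (auto simp: m_def B_def intro: le_neq_implies_less)
    have slos: "sorted_list_of_set A = m # sorted_list_of_set B"
      using sorted_list_of_set_nonempty[OF less.prems False] by (simp add: m_def B_def)
    \<comment> \<open>Needed for \<open>B\<close> and for every \<open>B - {j}\<close>, which is why
      the induction runs over the cardinality.\<close>
    have IH: "bracket_on e p C w = normal_op e p (sorted_list_of_set C) w" if "C \<subseteq> B" for C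
      using that A by (intro less.hyps psubset_card_mono) (auto intro: finite_subset)
    have rem: "sorted_list_of_set (B - {j}) = remove1 j (sorted_list_of_set B)" for j
      using A(3) by (rule sorted_list_of_set_remove)
    have eq: "bracket_on e p A w = x_op xm (e m) (p m) (normal_op e p (sorted_list_of_set B) w) +
      (\<Sum>j\<in>B. hscalar (S_diff_coeff c (e m) (e j) (p m) (p j)) * normal_op e p (remove1 j (sorted_list_of_set B)) w)"
      unfolding A(1) using bracket_on_insert_Min[OF A(3), of m e p w] m by (simp add: IH rem)
    show ?thesis
    proof (cases "p m \<ge> 0")
      case True
      then show ?thesis unfolding eq slos by (simp add: S_diff_coeff_nonneg x_op_def)
    next
      case neg: False
      define k where "k = nat (- p m - 1)"
      have k: "- int k - 1 = p m" using neg by (simp add: k_def)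
      \<comment> \<open>The contractions of \<open>m\<close> with the remaining indices are exactly
        the terms that \<open>xm_normal_op\<close> subtracts, so they cancel and only the normally
        ordered term is left.\<close>
      have "x_op xm (e m) (p m) v = xm (e m) k v" for v
        using neg by (simp add: x_op_def k_def)
      moreover have "normal_op e p (sorted_list_of_set A) w = normal_op e p (sorted_list_of_set B) (xm (e m) k w)"
        using neg by (simp add: slos k_def)
      ultimately show ?thesis unfolding eq
        using xm_normal_op[of "sorted_list_of_set B" "e m" k e p w] A(3) by (simp add: k)
    qed
  qed
qed

lemma x_bracket_eq_normal_op: "x_bracket c xm n e p w = normal_op e p [1..<Suc n] w"
proof -
  have "sorted_list_of_set {1..n} = [1..<Suc n]"
    using sorted_list_of_set_range[of 1 "Suc n"] by (simp add: atLeastLessThanSuc_atLeastAtMost)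
  then show ?thesis by (simp add: x_bracket_eq_bracket_on bracket_on_eq_normal_op)
qed

end

section \<open>Reduction modulo \<open>h\<close>\<close>

definition reduce :: "'n::finite hplus \<Rightarrow> 'n x_quot" where
  "reduce v = h_expansion v $$ 0"

lemma reduce_simps [simp]:
  "reduce 0 = 0" "reduce 1 = 1" "reduce (hgen e k) = xq_gen e k" "reduce (h_const q) = q"
  by (simp_all add: reduce_def h_expansion_gen h_expansion_const)
lemma reduce_add: "reduce (v + w) = reduce v + reduce w"
  by (simp add: reduce_def h_expansion_add)
lemma reduce_diff: "reduce (v - w) = reduce v - reduce w"
  by (simp add: reduce_def h_expansion_diff)
lemma reduce_mult: "reduce (v * w) = reduce v * reduce w"
  by (simp add: reduce_def h_expansion_mult)
lemma reduce_scale: "reduce (hscalar f * v) = xq_scalar (f $$ 0) * reduce v"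
  by (simp add: reduce_def h_expansion_scalar_mult)
lemma reduce_sum: "reduce (sum f A) = (\<Sum>x\<in>A. reduce (f x))"
  by (simp add: reduce_def h_expansion_sum fps_sum_nth)
lemma reduce_prod: "reduce (prod f A) = (\<Prod>x\<in>A. reduce (f x))"
  by (induction A rule: infinite_finite_induct) (simp_all add: reduce_mult)
lemma reduce_eq_0_iff: "reduce v = 0 \<longleftrightarrow> v \<in> h_times (Suc 0) UNIV"
  by (simp add: h_times_iff reduce_def)
lemma reduce_h_span: "v \<in> h_span E \<Longrightarrow> reduce v \<in> xq_span E"
  by (simp add: h_span_def reduce_def)

text \<open>An \<open>h\<close>-linear map sends multiples of \<open>h\<close> to multiples of
  \<open>h\<close>, so it descends to the reduction.\<close>

lemma reduce_hlinear_cong: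
  assumes "hlinear F" "reduce v = reduce w"
  shows "reduce (F v) = reduce (F w)"
proof -
  have "v - w \<in> h_times (Suc 0) UNIV" using assms(2) by (simp add: reduce_diff flip: reduce_eq_0_iff)
  from hlinear_h_times[OF assms(1) this] have "reduce (F v - F w) = 0"
    by (simp add: hlinearD[OF assms(1)] flip: reduce_eq_0_iff)
  then show ?thesis by (simp add: reduce_diff)
qed

text \<open>Brings the binomial coefficient from the substitution \<open>v = z + u\<close> into the
  form that the Borcherds identity has for \<open>l = -q-1\<close>. This is the case of a creation
  exponent \<open>q + j\<close>.\<close>

lemma gbinomial_shifted: "((of_int (int q + int j) :: complex) gchoose q) = (- 1) ^ j * (of_int (- int q - 1) gchoose j)"
proof -
  have "of_int (- int q - 1) = (- of_nat (Suc q) :: complex)" by simp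
  then have "(of_int (- int q - 1) gchoose j) = (- (of_nat (Suc q)) gchoose j :: complex)" by (simp only:)
  also have "\<dots> = (- 1) ^ j * (of_nat (Suc q) + of_nat j - 1 gchoose j)"
    by (rule gbinomial_minus)
  also have "(of_nat (Suc q) + of_nat j - 1 :: complex) = of_nat (q + j)" by simp
  also have "(of_nat (q + j) gchoose j :: complex) = of_nat ((q + j) choose j)"
    by (rule binomial_gbinomial[symmetric])
  also have "(q + j) choose j = (q + j) choose q"
    using binomial_symmetric[of q "q + j"] by simp
  also have "of_nat ((q + j) choose q) = (of_nat (q + j) gchoose q :: complex)"
    by (rule binomial_gbinomial)
  also have "of_nat (q + j) = (of_int (int q + int j) :: complex)" by simp
  finally show ?thesis by (simp only: minus_one_mult_self mult.assoc[symmetric] mult_1_left)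
qed

text \<open>The same for the annihilation exponent \<open>-j-1\<close>. The extra sign
  \<open>(-1)^q\<close> is the factor \<open>-(-1)^l\<close> of the Borcherds identity for
  \<open>l = -q-1\<close>.\<close>

lemma gbinomial_negative: "((of_int (- int j - 1) :: complex) gchoose q) = (- 1) ^ (q + j) * (of_int (- int q - 1) gchoose j)"
proof -
  have sym: "((of_int (int j + int q) :: complex) gchoose j) = (of_int (int q + int j) gchoose q)"
  proof -
    have "(of_nat (j + q) gchoose j :: complex) = of_nat ((j + q) choose j)"
      by (rule binomial_gbinomial[symmetric])
    also have "(j + q) choose j = (j + q) choose q"
      using binomial_symmetric[of j "j + q"] by simp
    also have "of_nat ((j + q) choose q) = (of_nat (j + q) gchoose q :: complex)"
      by (rule binomial_gbinomial)
    finally show ?thesis by (simp add: add.commute)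
  qed
  have "(of_int (- int j - 1) gchoose q :: complex) = (- 1) ^ q * ((- 1) ^ q * (of_int (- int j - 1) gchoose q))"
    by (simp only: minus_one_mult_self mult.assoc[symmetric] mult_1_left)
  also have "\<dots> = (- 1) ^ q * ((- 1) ^ j * (of_int (- int q - 1) gchoose j))"
    using sym gbinomial_shifted[of j q] gbinomial_shifted[of q j] by (simp only:)
  finally show ?thesis by (simp only: power_add mult.assoc)
qed

lemma has_hadic_sumE:
  assumes "has_hadic_sum a A s"
  obtains F0 where "finite F0" "F0 \<subseteq> A"
    "\<And>F. finite F \<Longrightarrow> F0 \<subseteq> F \<Longrightarrow> F \<subseteq> A \<Longrightarrow> s - sum a F \<in> h_times k UNIV"
proof -
  obtain F0 where F0: "finite F0 \<and> F0 \<subseteq> A \<and>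
      (\<forall>F. finite F \<and> F0 \<subseteq> F \<and> F \<subseteq> A \<longrightarrow> s - (\<Sum>i\<in>F. a i) \<in> h_times k UNIV)"
    using assms[unfolded has_hadic_sum_def, THEN spec, of k] by (elim exE)
  show thesis by (rule that[of F0]) (use F0 in auto)
qed

section \<open>Vertex operators of monomials modulo \<open>h\<close>\<close>

locale quantum_vertex = x_minus c xm
  for c :: complex and xm :: "'n::finite \<times> 'n \<Rightarrow> nat \<Rightarrow> 'n hplus \<Rightarrow> 'n hplus" +
  fixes Y :: "'n hplus \<Rightarrow> int \<Rightarrow> 'n hplus \<Rightarrow> 'n hplus"
  assumes vertex_operator_map: "is_vertex_operator_map c xm Y"
begin

lemma Y_hlinear_left: "hlinear (\<lambda>v. Y v r w)"
  using vertex_operator_map unfolding is_vertex_operator_map_def by blast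

lemma Y_hlinear_right: "hlinear (Y v r)"
  using vertex_operator_map unfolding is_vertex_operator_map_def by blast

definition exps :: "nat \<Rightarrow> (nat \<Rightarrow> nat) \<Rightarrow> int \<Rightarrow> (nat \<Rightarrow> int) set" where
  "exps n q r = {p. (\<forall>l. l \<notin> {1..n} \<longrightarrow> p l = 0) \<and> (\<Sum>l\<in>{1..n}. p l - int (q l)) = - r - 1}"

lemma Y_monom_has_sum:
  "has_hadic_sum
     (\<lambda>p. hscalar (fps_const (\<Prod>l\<in>{1..n}. of_int (p l) gchoose q l)) * normal_op e p [1..<Suc n] w)
     (exps n q r) (Y (h_monom e q {1..n}) r w)"
proof -
  have "has_hadic_sum
     (\<lambda>p. hscalar (fps_const (\<Prod>l\<in>{1..n}. of_int (p l) gchoose q l)) * x_bracket c xm n e p w)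
     (exps n q r) (Y (h_monom e q {1..n}) r w)"
    using vertex_operator_map unfolding is_vertex_operator_map_def exps_def by blast
  then show ?thesis unfolding x_bracket_eq_normal_op .
qed

text \<open>Every summand of the convergent sum for a monomial preserves the diagonal span, and that
  span is closed under \<open>h\<close>-adic limits.\<close>

lemma Y_h_span:
  assumes "v \<in> h_span diag" "w \<in> h_span diag"
  shows "Y v r w \<in> h_span diag"
proof (rule hlinear_closed[where F = "\<lambda>v. Y v r w", OF Y_hlinear_left _ assms(1)])
  fix m :: "'n hplus" assume "m \<in> h_monoms diag"
  then obtain n :: nat and e q where e: "\<And>l. e l \<in> diag" and m: "m = h_monom e q {1..n}"
    unfolding h_monoms_def by blast
  let ?f = "\<lambda>p. hscalar (fps_const (\<Prod>l\<in>{1..n}. of_int (p l) gchoose q l)) * normal_op e p [1..<Suc n] w"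
  have trm: "?f p \<in> h_span diag" for p
    by (rule h_span_scale[OF normal_op_h_span[OF e assms(2)]])
  show "Y m r w \<in> h_span diag"
  proof (rule h_span_limit)
    fix k
    from Y_monom_has_sum[where n = n and q = q and e = e and w = w and r = r] obtain F0 where F0: "finite F0" "F0 \<subseteq> exps n q r"
      "Y m r w - sum ?f F0 \<in> h_times k UNIV"
      unfolding has_hadic_sum_def m by blast
    moreover have "sum ?f F0 \<in> h_span diag" by (intro h_span_sum trm)
    ultimately show "\<exists>u\<in>h_span diag. Y m r w - u \<in> h_times k UNIV" by blast
  qed
qed simp

text \<open>Modulo \<open>h\<close> convergence means equality with every finite partial sum beyond
  some \<open>F0\<close>. The freedom to choose \<open>F\<close> is what allows the regrouping in
  the next step.\<close>

lemma reduce_Y_monom: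
  obtains F0 where "finite F0" "F0 \<subseteq> exps n q r"
    "\<And>F. finite F \<Longrightarrow> F0 \<subseteq> F \<Longrightarrow> F \<subseteq> exps n q r \<Longrightarrow>
       reduce (Y (h_monom e q {1..n}) r w) =
       (\<Sum>p\<in>F. xq_scalar (\<Prod>l\<in>{1..n}. of_int (p l) gchoose q l) * reduce (normal_op e p [1..<Suc n] w))"
proof -
  from Y_monom_has_sum[where n = n and q = q and e = e and w = w and r = r] obtain F0 where F0: "finite F0" "F0 \<subseteq> exps n q r"
    and sum: "\<And>F. finite F \<Longrightarrow> F0 \<subseteq> F \<Longrightarrow> F \<subseteq> exps n q r \<Longrightarrow> Y (h_monom e q {1..n}) r w -
       (\<Sum>p\<in>F. hscalar (fps_const (\<Prod>l\<in>{1..n}. of_int (p l) gchoose q l)) * normal_op e p [1..<Suc n] w)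
       \<in> h_times 1 UNIV"
    by (rule has_hadic_sumE[where k = 1]) blast
  show thesis
  proof (rule that[OF F0])
    fix F assume "finite F" "F0 \<subseteq> F" "F \<subseteq> exps n q r"
    with sum[of F] show "reduce (Y (h_monom e q {1..n}) r w) =
       (\<Sum>p\<in>F. xq_scalar (\<Prod>l\<in>{1..n}. of_int (p l) gchoose q l) * reduce (normal_op e p [1..<Suc n] w))"
      by (simp add: reduce_diff reduce_sum reduce_scale flip: reduce_eq_0_iff)
  qed
qed

text \<open>The contribution of those exponents whose last entry is \<open>t\<close>. Fixing it
  changes the sum condition for the first \<open>n\<close> entries, hence the mode
  \<open>r + t - q (Suc n)\<close>.\<close>

definition Y_term :: "nat \<Rightarrow> (nat \<Rightarrow> 'n \<times> 'n) \<Rightarrow> (nat \<Rightarrow> nat) \<Rightarrow> int \<Rightarrow> 'n hplus \<Rightarrow> int \<Rightarrow> 'n x_quot" where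
  "Y_term n e q r w t =
     (if t \<ge> 0
      then xq_gen (e (Suc n)) (nat t) * reduce (Y (h_monom e q {1..n}) (r + t - int (q (Suc n))) w)
      else reduce (Y (h_monom e q {1..n}) (r + t - int (q (Suc n))) (xm (e (Suc n)) (nat (- t - 1)) w)))"

text \<open>The sum over exponents is grouped by the last exponent. The last factor of the normally
  ordered product either multiplies from outside or acts on \<open>w\<close>, so each group is a
  coefficient of the vertex operator of the shorter monomial.\<close>

lemma reduce_Y_step:
  obtains T0 where "finite T0"
    "\<And>T. finite T \<Longrightarrow> T0 \<subseteq> T \<Longrightarrow>
       reduce (Y (h_monom e q {1..Suc n}) r w) =
       (\<Sum>t\<in>T. xq_scalar (of_int t gchoose q (Suc n)) * Y_term n e q r w t)"
proof -
  let ?k = "Suc n"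
  let ?\<beta> = "\<lambda>n p. xq_scalar (\<Prod>l\<in>{1..n}. (of_int (p l) :: complex) gchoose q l) :: 'n x_quot"
  define w' where "w' t = (if t \<ge> 0 then w else xm (e ?k) (nat (- t - 1)) w)" for t :: int
  define r' where "r' t = r + t - int (q ?k)" for t
  define y where "y t = reduce (Y (h_monom e q {1..n}) (r' t) (w' t))" for t
  define \<gamma> where "\<gamma> t = (if t \<ge> 0 then xq_gen (e ?k) (nat t) else 1)" for t
  have Y_term: "Y_term n e q r w t = \<gamma> t * y t" for t
    by (simp add: Y_term_def y_def \<gamma>_def w'_def r'_def)
  obtain F0 where F0: "finite F0" "F0 \<subseteq> exps ?k q r"
    and F0_sum: "\<And>F. finite F \<Longrightarrow> F0 \<subseteq> F \<Longrightarrow> F \<subseteq> exps ?k q r \<Longrightarrow>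
       reduce (Y (h_monom e q {1..?k}) r w) =
       (\<Sum>p\<in>F. ?\<beta> ?k p * reduce (normal_op e p [1..<Suc ?k] w))"
    by (rule reduce_Y_monom[where n = ?k and q = q and e = e and w = w and r = r]) blast
  have "\<forall>t. \<exists>F1. finite F1 \<and> F1 \<subseteq> exps n q (r' t) \<and>
      (\<forall>F. finite F \<longrightarrow> F1 \<subseteq> F \<longrightarrow> F \<subseteq> exps n q (r' t) \<longrightarrow>
       y t = (\<Sum>p\<in>F. ?\<beta> n p * reduce (normal_op e p [1..<Suc n] (w' t))))"
  proof
    fix t
    show "\<exists>F1. finite F1 \<and> F1 \<subseteq> exps n q (r' t) \<and>
      (\<forall>F. finite F \<longrightarrow> F1 \<subseteq> F \<longrightarrow> F \<subseteq> exps n q (r' t) \<longrightarrow>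
       y t = (\<Sum>p\<in>F. ?\<beta> n p * reduce (normal_op e p [1..<Suc n] (w' t))))"
      unfolding y_def by (rule reduce_Y_monom[where n = n and q = q and e = e and w = "w' t" and r = "r' t"]) blast
  qed
  from choice[OF this] obtain F1 where F1_all: "\<forall>t. finite (F1 t) \<and> F1 t \<subseteq> exps n q (r' t) \<and>
      (\<forall>F. finite F \<longrightarrow> F1 t \<subseteq> F \<longrightarrow> F \<subseteq> exps n q (r' t) \<longrightarrow>
       y t = (\<Sum>p\<in>F. ?\<beta> n p * reduce (normal_op e p [1..<Suc n] (w' t))))"
    by (elim exE)
  have F1: "finite (F1 t)" "F1 t \<subseteq> exps n q (r' t)"
    and F1_sum: "\<And>F. finite F \<Longrightarrow> F1 t \<subseteq> F \<Longrightarrow> F \<subseteq> exps n q (r' t) \<Longrightarrow>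
       y t = (\<Sum>p\<in>F. ?\<beta> n p * reduce (normal_op e p [1..<Suc n] (w' t)))" for t
    using F1_all[THEN spec, of t] by simp_all
  have Suc_ivl: "{1..?k} = insert ?k {1..n}" by auto
  \<comment> \<open>Exponents with last entry \<open>t\<close> correspond to exponents of length
    \<open>n\<close>; 0 is the value that \<open>exps n\<close> prescribes outside
    \<open>{1..n}\<close>.\<close>
  have restrict: "p(?k := 0) \<in> exps n q (r' (p ?k))" if "p \<in> exps ?k q r" for p
  proof -
    have "(\<Sum>l\<in>{1..n}. (p(?k := 0)) l - int (q l)) = (\<Sum>l\<in>{1..n}. p l - int (q l))"
      by (intro sum.cong) auto
    with that show ?thesis by (auto simp: exps_def r'_def)
  qed
  have extend: "f(?k := t) \<in> exps ?k q r" if "f \<in> exps n q (r' t)" for f t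
  proof -
    have "(\<Sum>l\<in>{1..n}. (f(?k := t)) l - int (q l)) = (\<Sum>l\<in>{1..n}. f l - int (q l))"
      by (intro sum.cong) auto
    with that show ?thesis by (auto simp: exps_def r'_def)
  qed
  have zero: "f ?k = 0" if "f \<in> exps n q s" for f s
    using that by (simp add: exps_def)
  have trm: "?\<beta> ?k (f(?k := t)) * reduce (normal_op e (f(?k := t)) [1..<Suc ?k] w)
     = xq_scalar (of_int t gchoose q ?k) * (\<gamma> t * (?\<beta> n f * reduce (normal_op e f [1..<Suc n] (w' t))))" for f t
  proof -
    have "(\<Prod>l\<in>{1..n}. (of_int ((f(?k := t)) l) :: complex) gchoose q l) = (\<Prod>l\<in>{1..n}. of_int (f l) gchoose q l)"
      by (intro prod.cong) auto
    then have \<beta>: "?\<beta> ?k (f(?k := t)) = xq_scalar (of_int t gchoose q ?k) * ?\<beta> n f"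
      unfolding Suc_ivl by (simp add: xq_scalar_mult)
    have "normal_op e (f(?k := t)) [1..<Suc n] v = normal_op e f [1..<Suc n] v" for v
      by (rule normal_op_cong) auto
    moreover have "[1..<Suc ?k] = [1..<Suc n] @ [?k]" by simp
    ultimately have "reduce (normal_op e (f(?k := t)) [1..<Suc ?k] w) = \<gamma> t * reduce (normal_op e f [1..<Suc n] (w' t))"
      by (simp only: normal_op_snoc) (simp add: w'_def \<gamma>_def reduce_mult)
    with \<beta> show ?thesis by (simp only: mult_ac)
  qed
  show thesis
  proof (rule that[of "(\<lambda>p. p ?k) ` F0"])
    show "finite ((\<lambda>p. p ?k) ` F0)" using F0 by simp
    fix T assume T: "finite T" "(\<lambda>p. p ?k) ` F0 \<subseteq> T"
    \<comment> \<open>Containing \<open>F1 t\<close> makes the inner sum equal to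
      \<open>y t\<close>; containing the restrictions of \<open>F0\<close> makes the union of the
      groups large enough for the outer sum.\<close>
    define F2 where "F2 t = F1 t \<union> (\<lambda>p. p(?k := 0)) ` {p \<in> F0. p ?k = t}" for t
    have F2: "finite (F2 t)" "F1 t \<subseteq> F2 t" "F2 t \<subseteq> exps n q (r' t)" for t
      using F1 F0 restrict by (auto simp: F2_def)
    let ?E = "\<lambda>t. (\<lambda>f. f(?k := t)) ` F2 t"
    have inj: "inj_on (\<lambda>f. f(?k := t)) (F2 t)" for t
    proof (rule inj_on_inverseI)
      fix f assume "f \<in> F2 t"
      with zero F2(3) show "(\<lambda>g. g(?k := 0)) (f(?k := t)) = f" by fastforce
    qed
    have "reduce (Y (h_monom e q {1..?k}) r w) =
       (\<Sum>p\<in>(\<Union>t\<in>T. ?E t). ?\<beta> ?k p * reduce (normal_op e p [1..<Suc ?k] w))"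
    proof (rule F0_sum)
      show "finite (\<Union>t\<in>T. ?E t)" using T F2 by auto
      show "F0 \<subseteq> (\<Union>t\<in>T. ?E t)"
      proof
        fix p assume p: "p \<in> F0"
        then have "p(?k := 0) \<in> F2 (p ?k)" by (auto simp: F2_def)
        then have "(p(?k := 0))(?k := p ?k) \<in> ?E (p ?k)" by blast
        with p T(2) show "p \<in> (\<Union>t\<in>T. ?E t)" by auto
      qed
      show "(\<Union>t\<in>T. ?E t) \<subseteq> exps ?k q r" using F2(3) extend by blast
    qed
    also have "\<dots> = (\<Sum>t\<in>T. \<Sum>p\<in>?E t. ?\<beta> ?k p * reduce (normal_op e p [1..<Suc ?k] w))"
    proof (rule sum.UNION_disjoint)
      show "\<forall>s\<in>T. \<forall>t\<in>T. s \<noteq> t \<longrightarrow> ?E s \<inter> ?E t = {}"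
      proof (intro ballI impI equals0I)
        fix s t p assume "s \<noteq> t" "p \<in> ?E s \<inter> ?E t"
        then obtain f f' where p: "p = f(?k := s)" "p = f'(?k := t)" by blast
        from p(1) have "p ?k = s" by simp
        moreover from p(2) have "p ?k = t" by simp
        ultimately have "s = t" by (rule trans[OF sym])
        with \<open>s \<noteq> t\<close> show False by simp
      qed
    qed (use T F2 in auto)
    also have "\<dots> = (\<Sum>t\<in>T. xq_scalar (of_int t gchoose q ?k) * Y_term n e q r w t)"
    proof (rule sum.cong[OF refl])
      fix t
      have "(\<Sum>p\<in>?E t. ?\<beta> ?k p * reduce (normal_op e p [1..<Suc ?k] w))
        = (\<Sum>f\<in>F2 t. ?\<beta> ?k (f(?k := t)) * reduce (normal_op e (f(?k := t)) [1..<Suc ?k] w))"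
        using inj[of t] by (simp only: sum.reindex o_def)
      also have "\<dots> = xq_scalar (of_int t gchoose q ?k) * (\<gamma> t * (\<Sum>f\<in>F2 t. ?\<beta> n f * reduce (normal_op e f [1..<Suc n] (w' t))))"
        unfolding trm sum_distrib_left ..
      also have "\<dots> = xq_scalar (of_int t gchoose q ?k) * Y_term n e q r w t"
        unfolding Y_term using F1_sum[OF F2(1) F2(2) F2(3)] by simp
      finally show "(\<Sum>p\<in>?E t. ?\<beta> ?k p * reduce (normal_op e p [1..<Suc ?k] w)) = \<dots>" .
    qed
    finally show "reduce (Y (h_monom e q {1..?k}) r w) =
       (\<Sum>t\<in>T. xq_scalar (of_int t gchoose q ?k) * Y_term n e q r w t)" .
  qed
qed

text \<open>The last exponent is \<open>k + j\<close> or \<open>-j-1\<close>, giving the two kinds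
  of terms in the Borcherds identity with \<open>m = 0\<close> and \<open>l = -k-1\<close>; for
  exponents from 0 to \<open>k - 1\<close> the binomial coefficient vanishes.\<close>

lemma reduce_Y_Suc:
  fixes e q n
  defines "b \<equiv> \<Prod>l\<in>{1..n}. hgen (e l) (q l)" and "k \<equiv> q (Suc n)" and "a \<equiv> e (Suc n)"
  obtains J0 :: nat where "\<And>J. J \<ge> J0 \<Longrightarrow>
    reduce (Y (b * hgen a k) r w) =
    (\<Sum>j\<in>{..J}. xq_scalar ((- 1) ^ j * (of_int (- int k - 1) gchoose j)) *
       (xq_gen a (k + j) * reduce (Y b (r + int j) w) +
        xq_scalar ((- 1) ^ k) * reduce (Y b (r - int k - 1 - int j) (xm a j w))))"
proof -
  let ?z = "\<lambda>j. xq_scalar ((- 1) ^ j * (of_int (- int k - 1) gchoose j))"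
  let ?c = "\<lambda>j. xq_gen a (k + j) * reduce (Y b (r + int j) w)"
    and ?d = "\<lambda>j. xq_scalar ((- 1) ^ k) * reduce (Y b (r - int k - 1 - int j) (xm a j w))"
  obtain T0 where T0: "finite T0"
    "\<And>T. finite T \<Longrightarrow> T0 \<subseteq> T \<Longrightarrow>
       reduce (Y (h_monom e q {1..Suc n}) r w) =
       (\<Sum>t\<in>T. xq_scalar (of_int t gchoose k) * Y_term n e q r w t)"
    unfolding k_def by (rule reduce_Y_step[where n = n and q = q and e = e and w = w and r = r]) blast
  let ?h = "\<lambda>t. xq_scalar (of_int t gchoose k) * Y_term n e q r w t"
  have bY: "(h_monom e q {1..Suc n}) = b * hgen a k"
    by (simp add: b_def a_def k_def prod.nat_ivl_Suc' mult.commute)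
  \<comment> \<open>The sum of absolute values bounds every element of \<open>T0\<close>, so both
    ranges of exponents cover it from this cutoff on.\<close>
  show thesis
  proof (rule that[of "nat (\<Sum>t\<in>T0. \<bar>t\<bar>)"])
    fix J assume J: "nat (\<Sum>t\<in>T0. \<bar>t\<bar>) \<le> J"
    let ?A = "(\<lambda>j. int k + int j) ` {..J}" and ?B = "(\<lambda>j. - int j - 1) ` {..J}" and ?C = "{0..<int k}"
    have "T0 \<subseteq> ?A \<union> ?B \<union> ?C"
    proof
      fix t assume "t \<in> T0"
      then have "\<bar>t\<bar> \<le> (\<Sum>t\<in>T0. \<bar>t\<bar>)" using T0(1) by (intro member_le_sum) auto
      with J have t: "\<bar>t\<bar> \<le> int J" by linarith
      consider "t < 0" | "0 \<le> t" "t < int k" | "int k \<le> t" by linarith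
      then show "t \<in> ?A \<union> ?B \<union> ?C"
      proof cases
        case 1
        then have "t = - int (nat (- t - 1)) - 1" "nat (- t - 1) \<le> J" using t by auto
        then show ?thesis by blast
      next
        case 3
        then have "t = int k + int (nat (t - int k))" "nat (t - int k) \<le> J" using t by auto
        then show ?thesis by blast
      qed auto
    qed
    then have "reduce (Y (b * hgen a k) r w) = sum ?h (?A \<union> ?B \<union> ?C)"
      using T0(2)[of "?A \<union> ?B \<union> ?C"] unfolding bY by simp
    also have "\<dots> = sum ?h ?A + sum ?h ?B + sum ?h ?C"
      by (subst sum.union_disjoint, auto)+
    also have "sum ?h ?C = 0"
    proof (intro sum.neutral ballI)
      fix t assume "t \<in> ?C"
      then obtain m where "t = int m" "m < k" by (metis atLeastLessThan_iff int_eq_iff of_nat_less_iff)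
      then show "?h t = 0" by (simp add: binomial_eq_0 flip: binomial_gbinomial)
    qed
    also have "sum ?h ?A = (\<Sum>j\<in>{..J}. ?z j * ?c j)"
    proof -
      have "?h (int k + int j) = ?z j * ?c j" for j
        unfolding gbinomial_shifted by (simp add: Y_term_def b_def k_def a_def nat_add_distrib)
      then show ?thesis by (subst sum.reindex) (auto simp: inj_on_def)
    qed
    also have "sum ?h ?B = (\<Sum>j\<in>{..J}. ?z j * ?d j)"
    proof -
      have "?h (- int j - 1) = ?z j * ?d j" for j
      proof -
        have "r + (- int j - 1) - int k = r - int k - 1 - int j" by simp
        moreover have "Y_term n e q r w (- int j - 1) = reduce (Y b (r + (- int j - 1) - int k) (xm a j w))"
          by (simp add: Y_term_def b_def k_def a_def)
        ultimately have "Y_term n e q r w (- int j - 1) = reduce (Y b (r - int k - 1 - int j) (xm a j w))"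
          by (simp only:)
        then show ?thesis by (simp only: gbinomial_negative[of j k] power_add xq_scalar_mult mult_ac)
      qed
      then show ?thesis by (subst sum.reindex) (auto simp: inj_on_def)
    qed
    finally show "reduce (Y (b * hgen a k) r w) = (\<Sum>j\<in>{..J}. ?z j * (?c j + ?d j))"
      by (simp add: sum.distrib distrib_left)
  qed
qed

text \<open>For the empty product the zero function is the only possible exponent, and it satisfies
  the sum condition precisely for \<open>r = -1\<close>.\<close>

lemma reduce_Y_one: "reduce (Y 1 r w) = (if r = - 1 then reduce w else 0)"
proof -
  obtain F0 where F0: "finite F0" "F0 \<subseteq> exps 0 (\<lambda>_. 0) r"
    "\<And>F. finite F \<Longrightarrow> F0 \<subseteq> F \<Longrightarrow> F \<subseteq> exps 0 (\<lambda>_. 0) r \<Longrightarrow>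
       reduce (Y (\<Prod>l\<in>{1..0::nat}. hgen undefined 0) r w) =
       (\<Sum>p\<in>F. xq_scalar (\<Prod>l\<in>{1..0::nat}. of_int (p l) gchoose 0) * reduce (normal_op (\<lambda>_. undefined) p [1..<Suc 0] w))"
    by (rule reduce_Y_monom[where n = 0 and q = "\<lambda>_. 0" and e = "\<lambda>_. undefined" and w = w and r = r]) blast
  have "exps 0 (\<lambda>_. 0) r = (if r = - 1 then {\<lambda>_. 0} else {})"
    by (auto simp: exps_def)
  with F0(3)[of "exps 0 (\<lambda>_. 0) r"] F0(2) show ?thesis by auto
qed

end

section \<open>The Fock representation\<close>

lemma pm_sum_superset:
  assumes "finite A" "Poly_Mapping.keys f \<subseteq> A" "\<And>k. F k 0 = 0"
  shows "pm_sum F f = (\<Sum>k\<in>A. F k (Poly_Mapping.lookup f k))"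
  unfolding pm_sum_def using assms by (intro sum.mono_neutral_left) (auto simp: in_keys_iff)

text \<open>Neither the identity nor the flip has a coefficient at
  \<open>e_ii \<otimes> e_kl\<close> with \<open>k\<close> and \<open>l\<close> different. Diagonal
  annihilation operators therefore commute with off-diagonal variables.\<close>

lemma S_diff_coeff_offdiag:
  assumes "k \<noteq> l"
  shows "S_diff_coeff c (i, i) (k, l) a b = 0"
proof -
  have "tensor_entry (GRR_minus_I c) (i, i) (k, l) = 0"
    using assms by (simp add: tensor_entry_def GRR_minus_I_def scale_mat_def RR_mat_entry)
      (auto simp add: mat_def flip_mat_def)
  then show ?thesis by (simp add: S_diff_coeff_def S_coeff_def)
qed

lemma cartan_form_rep:
  "cartan_form a b = (\<Sum>i\<in>UNIV. \<Sum>j\<in>UNIV. rep_cartan a $ i * rep_cartan b $ j *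
     (gram i j))" for a b :: "'n::finite cartan"
proof -
  have "cartan_form a b = cartan_form (abs_cartan (rep_cartan a)) (abs_cartan (rep_cartan b))"
    by (simp add: Quotient3_abs_rep[OF Quotient3_cartan])
  then show ?thesis by (simp only: cartan_form.abs_eq)
qed

section \<open>Annihilation and creation modes on \<open>x_quot\<close>\<close>

context x_minus
begin

text \<open>The nonnegative modes are read off from \<open>x\<^sup>-(u)\<close> modulo \<open>h\<close>, which spares the construction of
  derivations on \<open>x_quot\<close>.\<close>

definition ann :: "'n \<times> 'n \<Rightarrow> nat \<Rightarrow> 'n x_quot \<Rightarrow> 'n x_quot" where
  "ann a m q = reduce (xm a m (h_const q))"

lemma reduce_xm: "reduce (xm a m v) = ann a m (reduce v)"
  unfolding ann_def by (rule reduce_hlinear_cong[OF xm_hlinear]) simp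

lemma ann_add: "ann a m (p + q) = ann a m p + ann a m q"
  by (simp add: ann_def h_const_simps hlinearD[OF xm_hlinear] reduce_add)
lemma ann_scale: "ann a m (xq_scalar \<alpha> * q) = xq_scalar \<alpha> * ann a m q"
  by (simp add: ann_def h_const_simps hlinearD[OF xm_hlinear] reduce_scale)
lemma ann_zero [simp]: "ann a m 0 = 0"
  using ann_scale[of a m 0 0] by simp
lemma ann_one [simp]: "ann a m 1 = 0"
  by (simp add: ann_def h_const_simps)
lemma ann_mult_gen:
  "ann a m (q * xq_gen b k) =
     ann a m q * xq_gen b k - xq_scalar (S_diff_coeff c a b (- int m - 1) (int k) $$ 0) * q"
  by (simp add: ann_def h_const_simps xm_commutator reduce_diff reduce_mult[of _ "hgen b k"] reduce_scale)
lemma ann_commute: "ann a m (ann b m' q) = ann b m' (ann a m q)"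
proof -
  have "ann a m (ann b m' q) = reduce (xm a m (xm b m' (h_const q)))" for a m b m'
    by (simp add: reduce_xm)
  then show ?thesis by (simp only: xm_commute)
qed

text \<open>By induction on monomials: the scalars in the commutators sum to 0, because the columns
  of the Gram matrix do and off-diagonal variables give no scalar. The relation
  \<open>a_1 + ... + a_N = 0\<close> thus holds for the operators, so that the quotient
  \<open>cartan\<close> can act.\<close>

lemma ann_trace: "(\<Sum>i\<in>UNIV. ann (i, i) m q) = 0"
proof -
  have mono: "(\<Sum>i\<in>UNIV. ann (i, i) m q) = 0" if "q \<in> xq_monoms UNIV" for q
    using that
  proof (induction rule: xq_monoms_induct)
    case (step q b k)
    have S: "(\<Sum>i\<in>UNIV. S_diff_coeff c (i, i) b (- int m - 1) (int k) $$ 0) = 0"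
    proof (cases "fst b = snd b")
      case True
      then obtain j where b: "b = (j, j)" by (cases b) auto
      have z: "(\<Sum>i\<in>UNIV. (if i = j then 1 else 0) - 1 / of_nat CARD('n) :: complex) = 0"
        by (simp add: sum_subtractf)
      then show ?thesis
        unfolding b S_diff_coeff_mod_h
      proof -
        have "(\<Sum>i\<in>UNIV. if m = Suc k then a * f i else 0) = (if m = Suc k then a * (\<Sum>i\<in>UNIV. f i) else 0)"
          for a :: complex and f :: "'n \<Rightarrow> complex"
          by (simp add: sum_distrib_left)
        from this[of _ "\<lambda>i. (if i = j then 1 else 0) - 1 / of_nat CARD('n)", unfolded z]
        show "(\<Sum>i\<in>UNIV. if m = Suc k then - c * of_nat m * (gram i j) else 0) = 0"
          by (simp only: mult_zero_right if_cancel)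
      qed
    next
      case False
      then show ?thesis by (cases b) (simp add: S_diff_coeff_offdiag)
    qed
    have "(\<Sum>i\<in>UNIV. ann (i, i) m (q * xq_gen b k)) = (\<Sum>i\<in>UNIV. ann (i, i) m q) * xq_gen b k
        - xq_scalar (\<Sum>i\<in>UNIV. S_diff_coeff c (i, i) b (- int m - 1) (int k) $$ 0) * q"
      by (simp add: ann_mult_gen sum_subtractf sum_distrib_right xq_scalar_sum)
    with step S show ?case by simp
  qed simp
  have "q \<in> xq_span UNIV" by (rule xq_span_UNIV)
  then show ?thesis
  proof (induction rule: xq_span.induct)
    case (add p q \<alpha>)
    have "(\<Sum>i\<in>UNIV. ann (i, i) m (xq_scalar \<alpha> * p + q))
      = xq_scalar \<alpha> * (\<Sum>i\<in>UNIV. ann (i, i) m p) + (\<Sum>i\<in>UNIV. ann (i, i) m q)"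
      by (simp add: ann_add ann_scale sum.distrib sum_distrib_left)
    with add mono show ?case by simp
  qed simp
qed

definition mode_op :: "'n \<Rightarrow> int \<Rightarrow> 'n x_quot \<Rightarrow> 'n x_quot" where
  "mode_op i r v = (if r < 0 then xq_gen (i, i) (nat (- r - 1)) * v else ann (i, i) (nat r) v)"

lemma mode_op_add: "mode_op i r (v + w) = mode_op i r v + mode_op i r w"
  by (simp add: mode_op_def ann_add algebra_simps)
lemma mode_op_scale: "mode_op i r (xq_scalar \<alpha> * v) = xq_scalar \<alpha> * mode_op i r v"
  by (simp add: mode_op_def ann_scale mult.left_commute)
lemma mode_op_zero [simp]: "mode_op i r 0 = 0"
  by (simp add: mode_op_def)
lemma mode_op_sum: "mode_op i r (sum f A) = (\<Sum>x\<in>A. mode_op i r (f x))"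
  by (induction A rule: infinite_finite_induct) (simp_all add: mode_op_add)
lemma mode_op_trace: "(\<Sum>i\<in>UNIV. mode_op i r v) = 0"
  by (cases "r < 0") (simp_all add: mode_op_def ann_trace xq_trace flip: sum_distrib_right)

lemma ann_gen_commutator:
  "ann (i, i) m (xq_gen (j, j) k * v) - xq_gen (j, j) k * ann (i, i) m v =
     xq_scalar (if m = Suc k then c * (gram i j) * of_nat m else 0) * v"
proof -
  let ?s = "S_diff_coeff c (i, i) (j, j) (- int m - 1) (int k) $$ 0"
  have "ann (i, i) m (xq_gen (j, j) k * v) = xq_gen (j, j) k * ann (i, i) m v - xq_scalar ?s * v"
    by (simp only: mult.commute[of "xq_gen (j, j) k"] ann_mult_gen)
  then have "ann (i, i) m (xq_gen (j, j) k * v) - xq_gen (j, j) k * ann (i, i) m v = xq_scalar (- ?s) * v"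
    by (simp add: xq_scalar_uminus)
  also have "- ?s = (if m = Suc k then c * (gram i j) * of_nat m else 0)"
    unfolding S_diff_coeff_mod_h by simp
  finally show ?thesis .
qed

lemma mode_op_commutator:
  "mode_op i r (mode_op j s v) - mode_op j s (mode_op i r v) =
     xq_scalar (if r + s = 0 then c * (gram i j) * of_int r else 0) * v"
proof -
  consider "r < 0" "s < 0" | "r \<ge> 0" "s \<ge> 0" | "r \<ge> 0" "s < 0" | "r < 0" "s \<ge> 0" by linarith
  then show ?thesis
  proof cases
    case 1
    then show ?thesis by (simp add: mode_op_def mult.left_commute)
  next
    case 2
    \<comment> \<open>If the modes cancel they are both 0, and then the factor
      \<open>of_int r\<close> kills the scalar.\<close>
    then have "r + s = 0 \<longleftrightarrow> r = 0 \<and> s = 0" by auto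
    with 2 show ?thesis by (simp add: mode_op_def ann_commute[of "(i, i)"])
  next
    case 3
    have "nat r = Suc (nat (- s - 1)) \<longleftrightarrow> r + s = 0" using 3 by linarith
    moreover have "of_nat (nat r) = (of_int r :: complex)" using 3 by simp
    ultimately show ?thesis using 3 ann_gen_commutator[of i "nat r" j "nat (- s - 1)" v]
      by (simp add: mode_op_def)
  next
    case 4
    have "nat s = Suc (nat (- r - 1)) \<longleftrightarrow> r + s = 0" using 4 by linarith
    moreover have "of_nat (nat s) = (of_int s :: complex)" using 4 by simp
    \<comment> \<open>The previous case with the two modes exchanged; the Gram matrix is symmetric,
      and \<open>s = -r\<close> absorbs the sign.\<close>
    ultimately have "mode_op j s (mode_op i r v) - mode_op i r (mode_op j s v) =
      xq_scalar (if r + s = 0 then c * (gram j i) * of_int s else 0) * v"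
      using 4 ann_gen_commutator[of j "nat s" i "nat (- r - 1)" v] by (simp add: mode_op_def)
    then have "mode_op i r (mode_op j s v) - mode_op j s (mode_op i r v) =
      xq_scalar (- (if r + s = 0 then c * (gram j i) * of_int s else 0)) * v"
      by (simp only: xq_scalar_uminus mult_minus_left minus_diff_eq[symmetric, of "mode_op i r (mode_op j s v)"])
    moreover have "- (if r + s = 0 then c * (gram j i) * of_int s else 0)
      = (if r + s = 0 then c * (gram i j) * of_int r else 0)"
    proof (cases "r + s = 0")
      case True
      then have "s = - r" by simp
      then show ?thesis by auto
    qed simp
    ultimately show ?thesis by simp
  qed
qed

section \<open>The action of the Heisenberg Lie algebra\<close>

definition vec_op :: "complex ^ 'n \<Rightarrow> int \<Rightarrow> 'n x_quot \<Rightarrow> 'n x_quot" where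
  "vec_op x r v = (\<Sum>i\<in>UNIV. xq_scalar (x $ i) * mode_op i r v)"

lemma vec_op_commutator:
  "vec_op x r (vec_op y s v) - vec_op y s (vec_op x r v) =
     xq_scalar (if r + s = 0 then c * (\<Sum>i\<in>UNIV. \<Sum>j\<in>UNIV. x $ i * y $ j *
       (gram i j)) * of_int r else 0) * v"
proof -
  let ?X = "\<lambda>i. xq_scalar (x $ i)" and ?Y = "\<lambda>j. xq_scalar (y $ j)"
  have 1: "vec_op x r (vec_op y s v) = (\<Sum>i\<in>UNIV. \<Sum>j\<in>UNIV. ?X i * ?Y j * mode_op i r (mode_op j s v))"
    by (simp add: vec_op_def mode_op_sum mode_op_scale sum_distrib_left mult.assoc)
  have "vec_op y s (vec_op x r v) = (\<Sum>j\<in>UNIV. \<Sum>i\<in>UNIV. ?Y j * ?X i * mode_op j s (mode_op i r v))"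
    by (simp add: vec_op_def mode_op_sum mode_op_scale sum_distrib_left mult.assoc)
  also have "\<dots> = (\<Sum>i\<in>UNIV. \<Sum>j\<in>UNIV. ?X i * ?Y j * mode_op j s (mode_op i r v))"
    by (subst sum.swap) (simp add: mult.commute)
  finally have "vec_op x r (vec_op y s v) - vec_op y s (vec_op x r v) =
     (\<Sum>i\<in>UNIV. \<Sum>j\<in>UNIV. ?X i * ?Y j * (mode_op i r (mode_op j s v) - mode_op j s (mode_op i r v)))"
    unfolding 1 by (simp add: right_diff_distrib sum_subtractf)
  also have "\<dots> = (\<Sum>i\<in>UNIV. \<Sum>j\<in>UNIV. xq_scalar (if r + s = 0 then c * (x $ i * y $ j *
       (gram i j)) * of_int r else 0) * v)"
  proof (intro sum.cong refl)
    fix i j :: 'n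
    have "?X i * ?Y j * (xq_scalar z * v) = xq_scalar (x $ i * y $ j * z) * v" for z
      by (simp add: xq_scalar_mult mult.assoc)
    moreover have "x $ i * y $ j * (if r + s = 0 then c * (gram i j) * of_int r else 0)
      = (if r + s = 0 then c * (x $ i * y $ j * (gram i j)) * of_int r else 0)"
      by (cases "r + s = 0") (simp_all only: simp_thms if_True if_False mult_ac mult_zero_right mult_zero_left)
    ultimately show "?X i * ?Y j * (mode_op i r (mode_op j s v) - mode_op j s (mode_op i r v)) =
      xq_scalar (if r + s = 0 then c * (x $ i * y $ j *
       (gram i j)) * of_int r else 0) * v"
      unfolding mode_op_commutator by (simp only:)
  qed
  also have "\<dots> = xq_scalar (\<Sum>i\<in>UNIV. \<Sum>j\<in>UNIV. if r + s = 0 then c * (x $ i * y $ j *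
       (gram i j)) * of_int r else 0) * v"
    by (simp only: xq_scalar_sum sum_distrib_right)
  also have "(\<Sum>i\<in>UNIV. \<Sum>j\<in>UNIV. if r + s = 0 then c * (x $ i * y $ j *
       (gram i j)) * of_int r else 0)
     = (if r + s = 0 then c * (\<Sum>i\<in>UNIV. \<Sum>j\<in>UNIV. x $ i * y $ j *
       (gram i j)) * of_int r else 0)"
    by (cases "r + s = 0") (simp_all only: simp_thms sum_distrib_left sum_distrib_right if_True if_False sum.neutral_const)
  finally show ?thesis .
qed

definition cartan_op :: "'n cartan \<Rightarrow> int \<Rightarrow> 'n x_quot \<Rightarrow> 'n x_quot" where
  "cartan_op a r v = vec_op (rep_cartan a) r v"

text \<open>Two representatives differ by a constant vector, which acts as a multiple of the sum of
  all \<open>mode_op i r\<close>, that is, by 0.\<close>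

lemma cartan_op_abs: "cartan_op (abs_cartan x) r v = vec_op x r v"
proof -
  have "abs_cartan (rep_cartan (abs_cartan x)) = abs_cartan x"
    by (rule Quotient3_abs_rep[OF Quotient3_cartan])
  then obtain t where "rep_cartan (abs_cartan x) - x = (\<chi> i. t)"
    unfolding cartan.abs_eq_iff by blast
  then have t: "rep_cartan (abs_cartan x) $ i = x $ i + t" for i
    by (auto simp: vec_eq_iff algebra_simps)
  have "cartan_op (abs_cartan x) r v = vec_op x r v + xq_scalar t * (\<Sum>i\<in>UNIV. mode_op i r v)"
    unfolding cartan_op_def vec_op_def t
    by (simp add: xq_scalar_add distrib_right sum.distrib sum_distrib_left)
  then show ?thesis by (simp add: mode_op_trace)
qed

lemma cartan_op_gen: "cartan_op (cartan_gen i) r v = mode_op i r v"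
proof -
  have "cartan_op (cartan_gen i) r v = (\<Sum>j\<in>UNIV. xq_scalar (axis i 1 $ j) * mode_op j r v)"
    by (simp add: cartan_gen.abs_eq cartan_op_abs vec_op_def)
  also have "\<dots> = (\<Sum>j\<in>UNIV. if j = i then mode_op j r v else 0)"
    by (intro sum.cong) (auto simp: axis_def)
  finally show ?thesis by simp
qed

lemma cartan_op_add_left: "cartan_op (a + b) r v = cartan_op a r v + cartan_op b r v"
  by (induction a rule: cartan.abs_induct, induction b rule: cartan.abs_induct)
    (simp add: plus_cartan.abs_eq cartan_op_abs vec_op_def xq_scalar_add distrib_right sum.distrib)

lemma cartan_op_scale_left: "cartan_op (cartan_scale \<alpha> a) r v = xq_scalar \<alpha> * cartan_op a r v"
  by (induction a rule: cartan.abs_induct)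
    (simp add: cartan_scale.abs_eq cartan_op_abs vec_op_def xq_scalar_mult sum_distrib_left mult.assoc)

lemma cartan_op_zero_left [simp]: "cartan_op 0 r v = 0"
  using cartan_op_add_left[of 0 0 r v] by simp

lemma cartan_op_add: "cartan_op a r (v + w) = cartan_op a r v + cartan_op a r w"
  by (simp add: cartan_op_def vec_op_def mode_op_add distrib_left sum.distrib)
lemma cartan_op_scale: "cartan_op a r (xq_scalar \<alpha> * v) = xq_scalar \<alpha> * cartan_op a r v"
  by (simp add: cartan_op_def vec_op_def mode_op_scale sum_distrib_left mult.left_commute)
lemma cartan_op_zero [simp]: "cartan_op a r 0 = 0"
  by (simp add: cartan_op_def vec_op_def)
lemma cartan_op_sum: "cartan_op a r (sum f A) = (\<Sum>x\<in>A. cartan_op a r (f x))"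
  by (induction A rule: infinite_finite_induct) (simp_all add: cartan_op_add)

lemma cartan_op_commutator:
  "cartan_op a r (cartan_op b s v) - cartan_op b s (cartan_op a r v) =
     xq_scalar (c * (if r + s = 0 then cartan_form a b * of_int r else 0)) * v"
  unfolding cartan_op_def vec_op_commutator cartan_form_rep by (simp add: mult.assoc)

lemma cartan_op_nonneg_one: "r \<ge> 0 \<Longrightarrow> cartan_op a r 1 = 0"
  by (simp add: cartan_op_def vec_op_def mode_op_def)

definition heis_op :: "'n heis \<Rightarrow> 'n x_quot \<Rightarrow> 'n x_quot" where
  "heis_op x v = pm_sum (\<lambda>r a. cartan_op a r v) (fst x) + xq_scalar (c * snd x) * v"

lemma heis_op_add_left: "heis_op (x + y) v = heis_op x v + heis_op y v"
proof -
  have "pm_sum (\<lambda>r a. cartan_op a r v) (fst x + fst y) =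
      pm_sum (\<lambda>r a. cartan_op a r v) (fst x) + pm_sum (\<lambda>r a. cartan_op a r v) (fst y)"
    by (rule pm_sum_add) (simp_all add: cartan_op_add_left)
  then show ?thesis by (simp add: heis_op_def distrib_left xq_scalar_add algebra_simps)
qed

lemma heis_op_scale_left: "heis_op (heis_scale \<alpha> x) v = xq_scalar \<alpha> * heis_op x v"
proof -
  have "pm_sum (\<lambda>r a. cartan_op a r v) (Poly_Mapping.mapp (\<lambda>_. cartan_scale \<alpha>) (fst x))
      = (\<Sum>r\<in>Poly_Mapping.keys (fst x). cartan_op (Poly_Mapping.lookup (Poly_Mapping.mapp (\<lambda>_. cartan_scale \<alpha>) (fst x)) r) r v)"
    by (rule pm_sum_superset) (simp_all add: keys_mapp_subset)
  also have "\<dots> = xq_scalar \<alpha> * pm_sum (\<lambda>r a. cartan_op a r v) (fst x)"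
    unfolding pm_sum_def sum_distrib_left
    by (intro sum.cong) (simp_all add: lookup_mapp cartan_op_scale_left)
  finally show ?thesis
    by (simp add: heis_op_def heis_scale_def distrib_left xq_scalar_mult mult_ac)
qed

lemma heis_op_add: "heis_op x (v + w) = heis_op x v + heis_op x w"
  by (simp add: heis_op_def pm_sum_def cartan_op_add sum.distrib algebra_simps)
lemma heis_op_scale: "heis_op x (xq_scalar \<alpha> * v) = xq_scalar \<alpha> * heis_op x v"
  by (simp add: heis_op_def pm_sum_def cartan_op_scale sum_distrib_left distrib_left mult.left_commute)
lemma heis_op_zero [simp]: "heis_op x 0 = 0"
  by (simp add: heis_op_def pm_sum_def)

lemma heis_op_mode: "heis_op (heis_mode a r) v = cartan_op a r v"
  by (simp add: heis_op_def heis_mode_def)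

lemma heis_op_bracket:
  "heis_op x (heis_op y v) - heis_op y (heis_op x v) = heis_op (heis_bracket x y) v"
proof -
  let ?K = "Poly_Mapping.keys (fst x)" and ?L = "Poly_Mapping.keys (fst y)"
  let ?a = "Poly_Mapping.lookup (fst x)" and ?b = "Poly_Mapping.lookup (fst y)"
  let ?f = "\<lambda>v. \<Sum>r\<in>?K. cartan_op (?a r) r v" and ?g = "\<lambda>v. \<Sum>s\<in>?L. cartan_op (?b s) s v"
  \<comment> \<open>The central parts act by scalars, so their contributions cancel.\<close>
  have "heis_op x (heis_op y v) - heis_op y (heis_op x v) = ?f (?g v) - ?g (?f v)"
    by (simp add: heis_op_def pm_sum_def cartan_op_add cartan_op_scale sum.distrib distrib_left
        sum_distrib_left[symmetric] mult.left_commute)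
  also have "?f (?g v) = (\<Sum>r\<in>?K. \<Sum>s\<in>?L. cartan_op (?a r) r (cartan_op (?b s) s v))"
    by (simp add: cartan_op_sum)
  also have "?g (?f v) = (\<Sum>r\<in>?K. \<Sum>s\<in>?L. cartan_op (?b s) s (cartan_op (?a r) r v))"
    by (simp add: cartan_op_sum) (rule sum.swap)
  also have "(\<Sum>r\<in>?K. \<Sum>s\<in>?L. cartan_op (?a r) r (cartan_op (?b s) s v)) -
      (\<Sum>r\<in>?K. \<Sum>s\<in>?L. cartan_op (?b s) s (cartan_op (?a r) r v))
     = (\<Sum>r\<in>?K. \<Sum>s\<in>?L. xq_scalar (c * (if r + s = 0 then cartan_form (?a r) (?b s) * of_int r else 0)) * v)"
    unfolding cartan_op_commutator[symmetric] by (simp add: sum_subtractf)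
  also have "\<dots> = xq_scalar (c * (\<Sum>r\<in>?K. \<Sum>s\<in>?L. if r + s = 0 then cartan_form (?a r) (?b s) * of_int r else 0)) * v"
    by (simp only: xq_scalar_sum sum_distrib_left sum_distrib_right)
  also have "\<dots> = heis_op (heis_bracket x y) v"
    by (simp add: heis_op_def heis_bracket_def)
  finally show ?thesis .
qed

section \<open>The action of the enveloping algebra\<close>

definition free_act :: "'n heis_free \<Rightarrow> 'n x_quot \<Rightarrow> 'n x_quot" where
  "free_act f v = pm_sum (\<lambda>w a. xq_scalar a * foldr heis_op (letters w) v) f"

lemma free_act_add: "free_act (f + g) v = free_act f v + free_act g v"
  unfolding free_act_def by (rule pm_sum_add) (simp_all add: xq_scalar_add distrib_right)
lemma free_act_zero [simp]: "free_act 0 v = 0"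
  by (simp add: free_act_def)
lemma free_act_uminus: "free_act (- f) v = - free_act f v"
  using free_act_add[of f "- f" v] by (simp add: eq_neg_iff_add_eq_0 add.commute)
lemma free_act_diff: "free_act (f - g) v = free_act f v - free_act g v"
  using free_act_add[of f "- g" v] by (simp add: free_act_uminus)
lemma free_act_single: "free_act (Poly_Mapping.single w a) v = xq_scalar a * foldr heis_op (letters w) v"
  unfolding free_act_def by (rule pm_sum_single) simp
lemma free_act_gen: "free_act (free_gen x) v = heis_op x v"
  by (simp add: free_gen_def free_act_single)
lemma foldr_heis_op_add: "foldr heis_op xs (v + w) = foldr heis_op xs v + foldr heis_op xs w"
  by (induction xs) (simp_all add: heis_op_add)
lemma foldr_heis_op_scale: "foldr heis_op xs (xq_scalar \<alpha> * v) = xq_scalar \<alpha> * foldr heis_op xs v"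
  by (induction xs) (simp_all add: heis_op_scale)
lemma foldr_heis_op_zero: "foldr heis_op xs 0 = 0"
  by (induction xs) simp_all
lemma free_act_zero_right [simp]: "free_act f 0 = 0"
  by (simp add: free_act_def pm_sum_def foldr_heis_op_zero)
lemma free_act_add_right: "free_act f (v + w) = free_act f v + free_act f w"
  by (simp add: free_act_def pm_sum_def foldr_heis_op_add distrib_left sum.distrib)
lemma free_act_mult: "free_act (f * g) v = free_act f (free_act g v)"
proof (induction f rule: poly_mapping_single_induct)
  case (add k a f)
  have "free_act (Poly_Mapping.single k a * g) v = free_act (Poly_Mapping.single k a) (free_act g v)"
  proof (induction g rule: poly_mapping_single_induct)
    case (add l b g)
    then show ?case
      by (simp add: distrib_left free_act_add free_act_add_right mult_single free_act_single
          plus_word_def foldr_heis_op_scale xq_scalar_mult mult_ac)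
  qed simp
  with add show ?case by (simp add: distrib_right free_act_add)
qed simp

text \<open>The elements acting as 0 on the whole module form a two-sided ideal that contains the
  defining relations.\<close>

lemma uea_ideal_free_act: "f \<in> uea_ideal \<Longrightarrow> free_act f v = 0"
proof -
  let ?J = "{f. \<forall>v. free_act f v = 0}"
  have "two_sided_ideal ?J"
    by (simp add: two_sided_ideal_def free_act_add free_act_mult)
  moreover have "free_gen (x + y) - free_gen x - free_gen y \<in> ?J" for x y
    by (simp add: free_act_diff free_act_gen heis_op_add_left)
  moreover have "free_gen (heis_scale \<alpha> x) - Poly_Mapping.single 0 \<alpha> * free_gen x \<in> ?J" for \<alpha> x
    by (simp add: free_act_diff free_act_mult free_act_gen free_act_single heis_op_scale_left zero_word_def)
  moreover have "free_gen x * free_gen y - free_gen y * free_gen x - free_gen (heis_bracket x y) \<in> ?J" for x y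
    by (simp add: free_act_diff free_act_mult free_act_gen heis_op_bracket)
  ultimately show "f \<in> uea_ideal \<Longrightarrow> free_act f v = 0"
    unfolding uea_ideal_def by blast
qed

definition uea_act :: "'n uea \<Rightarrow> 'n x_quot \<Rightarrow> 'n x_quot" where
  "uea_act u v = free_act (rep_uea u) v"

lemma uea_act_abs: "uea_act (abs_uea f) v = free_act f v"
proof -
  have "abs_uea (rep_uea (abs_uea f)) = abs_uea f"
    by (rule Quotient3_abs_rep[OF Quotient3_uea])
  then have "rep_uea (abs_uea f) - f \<in> uea_ideal" by (simp add: uea.abs_eq_iff)
  from uea_ideal_free_act[OF this] show ?thesis by (simp add: uea_act_def free_act_diff)
qed

lemma uea_act_add: "uea_act (u + w) v = uea_act u v + uea_act w v"
  by (induction u rule: uea.abs_induct, induction w rule: uea.abs_induct)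
    (simp add: plus_uea.abs_eq uea_act_abs free_act_add)
lemma uea_act_diff: "uea_act (u - w) v = uea_act u v - uea_act w v"
  by (induction u rule: uea.abs_induct, induction w rule: uea.abs_induct)
    (simp add: minus_uea.abs_eq uea_act_abs free_act_diff)
lemma uea_act_mult: "uea_act (u * w) v = uea_act u (uea_act w v)"
  by (induction u rule: uea.abs_induct, induction w rule: uea.abs_induct)
    (simp add: times_uea.abs_eq uea_act_abs free_act_mult)
lemma uea_act_gen: "uea_act (uea_gen x) v = heis_op x v"
  by (simp add: uea_gen.abs_eq uea_act_abs free_act_gen)
lemma uea_act_scalar: "uea_act (uea_scalar \<alpha>) v = xq_scalar \<alpha> * v"
  by (simp add: uea_scalar.abs_eq uea_act_abs free_act_single zero_word_def)
lemma uea_act_zero [simp]: "uea_act 0 v = 0"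
  by (simp add: zero_uea_def uea_act_abs)
lemma uea_act_one [simp]: "uea_act 1 v = v"
  using uea_act_scalar[of 1 v] by (simp add: one_uea_def uea_scalar.abs_eq)
lemma uea_act_zero_right [simp]: "uea_act u 0 = 0"
  by (simp add: uea_act_def)

end

section \<open>The Heisenberg vacuum module\<close>

lemma abs_uea_eq: "abs_uea f = abs_uea g \<longleftrightarrow> f - g \<in> uea_ideal"
  using uea.abs_eq_iff by blast

lemma uea_gen_add: "uea_gen (x + y) = uea_gen x + uea_gen y"
proof -
  have "free_gen (x + y) - free_gen x - free_gen y \<in> uea_ideal"
    unfolding uea_ideal_def by blast
  then show ?thesis by (simp add: uea_gen.abs_eq plus_uea.abs_eq abs_uea_eq algebra_simps)
qed

lemma uea_gen_scale: "uea_gen (heis_scale \<alpha> x) = uea_scalar \<alpha> * uea_gen x"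
proof -
  have "free_gen (heis_scale \<alpha> x) - Poly_Mapping.single 0 \<alpha> * free_gen x \<in> uea_ideal"
    unfolding uea_ideal_def by blast
  then show ?thesis by (simp add: uea_gen.abs_eq uea_scalar.abs_eq times_uea.abs_eq abs_uea_eq)
qed

lemma uea_gen_bracket: "uea_gen x * uea_gen y - uea_gen y * uea_gen x = uea_gen (heis_bracket x y)"
proof -
  have "free_gen x * free_gen y - free_gen y * free_gen x - free_gen (heis_bracket x y) \<in> uea_ideal"
    unfolding uea_ideal_def by blast
  then show ?thesis by (simp add: uea_gen.abs_eq times_uea.abs_eq minus_uea.abs_eq abs_uea_eq)
qed

lemma uea_gen_0 [simp]: "uea_gen 0 = 0"
  using uea_gen_add[of 0 0] by simp

lemma uea_gen_sum: "uea_gen (sum f A) = (\<Sum>x\<in>A. uea_gen (f x))"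
  by (induction A rule: infinite_finite_induct) (simp_all add: uea_gen_add)

lemma uea_scalar_0 [simp]: "uea_scalar 0 = 0"
  by (simp add: uea_scalar.abs_eq zero_uea_def)
lemma uea_scalar_1 [simp]: "uea_scalar 1 = 1"
  by (simp add: uea_scalar.abs_eq one_uea_def)
lemma uea_scalar_add: "uea_scalar (a + b) = uea_scalar a + uea_scalar b"
  by (simp add: uea_scalar.abs_eq plus_uea.abs_eq single_add)
lemma uea_scalar_mult: "uea_scalar (a * b) = uea_scalar a * uea_scalar b"
  by (simp add: uea_scalar.abs_eq times_uea.abs_eq mult_single)
lemma uea_scalar_uminus: "uea_scalar (- a) = - uea_scalar a"
  using uea_scalar_add[of a "- a"] by (simp add: eq_neg_iff_add_eq_0 add.commute)

lemma uea_induct [case_names scalar gen add mult]: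
  fixes u :: "'n::finite uea"
  assumes scalar: "\<And>\<alpha>. P (uea_scalar \<alpha>)" and gen: "\<And>x. P (uea_gen x)"
    and add: "\<And>u v. P u \<Longrightarrow> P v \<Longrightarrow> P (u + v)" and mult: "\<And>u v. P u \<Longrightarrow> P v \<Longrightarrow> P (u * v)"
  shows "P u"
proof (induction u rule: uea.abs_induct)
  case (1 f)
  have word: "P (abs_uea (Poly_Mapping.single (Word xs) a))" for xs :: "'n heis list" and a
  proof (induction xs)
    case Nil
    then show ?case using scalar[of a] by (simp add: uea_scalar.abs_eq zero_word_def)
  next
    case (Cons x xs)
    have "abs_uea (Poly_Mapping.single (Word (x # xs)) a) = uea_gen x * abs_uea (Poly_Mapping.single (Word xs) a)"
      by (simp add: uea_gen.abs_eq times_uea.abs_eq free_gen_def mult_single plus_word_def)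
    then show ?case using mult[OF gen Cons] by simp
  qed
  show ?case
  proof (induction f rule: poly_mapping_single_induct)
    case zero
    then show ?case using scalar[of 0] by (simp add: zero_uea_def)
  next
    case (add k a f)
    have "P (abs_uea (Poly_Mapping.single k a))" using word[of "letters k" a] by simp
    from assms(3)[OF this add] show ?case by (simp add: plus_uea.abs_eq)
  qed
qed

lemma uea_scalar_commute: "u * uea_scalar \<alpha> = uea_scalar \<alpha> * u"
proof (induction u rule: uea.abs_induct)
  case (1 f)
  have "f * Poly_Mapping.single 0 \<alpha> = Poly_Mapping.single 0 \<alpha> * f"
    by (induction f rule: poly_mapping_single_induct)
      (simp_all add: distrib_left distrib_right mult_single mult.commute)
  then show ?case by (simp add: uea_scalar.abs_eq times_uea.abs_eq)
qed

lemma uea_gen_split: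
  "uea_gen (f, z) = (\<Sum>r\<in>Poly_Mapping.keys f. uea_gen (heis_mode (Poly_Mapping.lookup f r) r)) + uea_gen (0, z)"
proof -
  have f: "f = (\<Sum>r\<in>Poly_Mapping.keys f. Poly_Mapping.single r (Poly_Mapping.lookup f r))"
    by (intro poly_mapping_eqI) (auto simp: lookup_sum lookup_single when_def in_keys_iff)
  have "(\<Sum>r\<in>A. heis_mode (g r) r) = (\<Sum>r\<in>A. Poly_Mapping.single r (g r), 0)" for A and g :: "int \<Rightarrow> 'a cartan"
    by (simp add: heis_mode_def prod_eq_iff fst_sum snd_sum)
  then have "(\<Sum>r\<in>Poly_Mapping.keys f. heis_mode (Poly_Mapping.lookup f r) r) = (f, 0)"
    by (simp only: f[symmetric])
  then have "(f, z) = (\<Sum>r\<in>Poly_Mapping.keys f. heis_mode (Poly_Mapping.lookup f r) r) + (0, z)"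
    by simp
  then show ?thesis by (simp only: uea_gen_add uea_gen_sum)
qed

lemma heis_mode_add: "heis_mode (a + b) r = heis_mode a r + heis_mode b r"
  by (simp add: heis_mode_def single_add)

lemma cartan_scale_zero: "cartan_scale \<alpha> 0 = 0"
  by (simp add: zero_cartan_def cartan_scale.abs_eq)

lemma heis_mode_scale: "heis_mode (cartan_scale \<alpha> a) r = heis_scale \<alpha> (heis_mode a r)"
  unfolding heis_mode_def heis_scale_def
  by (auto intro!: poly_mapping_eqI simp: lookup_mapp lookup_single when_def cartan_scale_zero in_keys_iff)

lemma heis_mode_zero [simp]: "heis_mode 0 r = 0"
  by (simp add: heis_mode_def zero_prod_def)

lemma heis_mode_sum: "heis_mode (sum f A) r = (\<Sum>x\<in>A. heis_mode (f x) r)"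
  by (induction A rule: infinite_finite_induct) (simp_all add: heis_mode_add)

lemma abs_cartan_sum: "abs_cartan (sum f A) = (\<Sum>x\<in>A. abs_cartan (f x))"
  by (induction A rule: infinite_finite_induct) (simp_all add: zero_cartan_def flip: plus_cartan.abs_eq)

lemma cartan_expand: "abs_cartan x = (\<Sum>i\<in>UNIV. cartan_scale (x $ i) (cartan_gen i))"
proof -
  have "x = (\<Sum>i\<in>UNIV. (x $ i) *s axis i 1)"
    by (simp add: vec_eq_iff axis_def if_distrib cong: if_cong)
  then have "abs_cartan x = abs_cartan (\<Sum>i\<in>UNIV. (x $ i) *s axis i 1)" by simp
  then show ?thesis by (simp add: abs_cartan_sum cartan_scale.abs_eq cartan_gen.abs_eq)
qed

lemma cartan_gen_sum: "(\<Sum>i\<in>UNIV. cartan_gen (i :: 'n::finite)) = 0"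
proof -
  have "(\<Sum>i\<in>UNIV. axis i 1) = ((\<chi> i. 1) :: complex ^ 'n)"
    by (simp add: vec_eq_iff axis_def)
  then have "(\<Sum>i\<in>UNIV. cartan_gen (i :: 'n)) = abs_cartan (\<chi> i. 1)"
    by (simp add: cartan_gen.abs_eq flip: abs_cartan_sum)
  also have "\<dots> = abs_cartan 0"
    unfolding cartan.abs_eq_iff by (intro exI[of _ 1]) simp
  finally show ?thesis by (simp add: zero_cartan_def)
qed

lemma uea_gen_mode_abs:
  "uea_gen (heis_mode (abs_cartan x) r) = (\<Sum>i\<in>UNIV. uea_scalar (x $ i) * uea_gen (heis_mode (cartan_gen i) r))"
  by (simp add: cartan_expand heis_mode_sum uea_gen_sum heis_mode_scale uea_gen_scale)

section \<open>The commutative algebra of negative modes\<close>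

lemma uea_negative_intros:
  shows uea_negative_one: "1 \<in> uea_negative"
    and uea_negative_add: "\<And>u v. u \<in> uea_negative \<Longrightarrow> v \<in> uea_negative \<Longrightarrow> u + v \<in> uea_negative"
    and uea_negative_mult: "\<And>u v. u \<in> uea_negative \<Longrightarrow> v \<in> uea_negative \<Longrightarrow> u * v \<in> uea_negative"
    and uea_negative_scale: "\<And>\<alpha> u. u \<in> uea_negative \<Longrightarrow> uea_scalar \<alpha> * u \<in> uea_negative"
    and uea_negative_gen: "\<And>f. Poly_Mapping.keys f \<subseteq> {..<0} \<Longrightarrow> uea_gen (f, 0) \<in> uea_negative"
  unfolding uea_negative_def by simp_all

lemma uea_negative_scalar: "uea_scalar \<alpha> \<in> uea_negative"
  using uea_negative_scale[OF uea_negative_one, of \<alpha>] by simp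

lemma uea_negative_zero: "0 \<in> uea_negative"
  using uea_negative_scalar[of 0] by simp

lemma uea_negative_uminus: "u \<in> uea_negative \<Longrightarrow> - u \<in> uea_negative"
  using uea_negative_scale[of u "- 1"] by (simp add: uea_scalar_uminus)

lemma uea_negative_diff: "u \<in> uea_negative \<Longrightarrow> v \<in> uea_negative \<Longrightarrow> u - v \<in> uea_negative"
  using uea_negative_add[of u "- v"] by (simp add: uea_negative_uminus)

lemma uea_negative_mode: "r < 0 \<Longrightarrow> uea_gen (heis_mode a r) \<in> uea_negative"
  unfolding heis_mode_def by (rule uea_negative_gen) auto

lemma uea_negative_induct [consumes 1, case_names one add mult scale gen]:
  assumes "u \<in> uea_negative" and "P 1"
    and "\<And>u v. u \<in> uea_negative \<Longrightarrow> v \<in> uea_negative \<Longrightarrow> P u \<Longrightarrow> P v \<Longrightarrow> P (u + v)"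
    and "\<And>u v. u \<in> uea_negative \<Longrightarrow> v \<in> uea_negative \<Longrightarrow> P u \<Longrightarrow> P v \<Longrightarrow> P (u * v)"
    and "\<And>\<alpha> u. u \<in> uea_negative \<Longrightarrow> P u \<Longrightarrow> P (uea_scalar \<alpha> * u)"
    and "\<And>f. Poly_Mapping.keys f \<subseteq> {..<0} \<Longrightarrow> P (uea_gen (f, 0))"
  shows "P u"
proof -
  let ?B = "{u \<in> uea_negative. P u}"
  have "1 \<in> ?B \<and> (\<forall>u\<in>?B. \<forall>v\<in>?B. u + v \<in> ?B \<and> u * v \<in> ?B) \<and> (\<forall>\<alpha>. \<forall>u\<in>?B. uea_scalar \<alpha> * u \<in> ?B) \<and>
         (\<forall>f. Poly_Mapping.keys f \<subseteq> {..<0} \<longrightarrow> uea_gen (f, 0) \<in> ?B)"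
    using assms(2-) by (auto intro: uea_negative_intros)
  then have "uea_negative \<subseteq> ?B"
    by (subst uea_negative_def, intro Inter_lower CollectI)
  then show ?thesis using assms(1) by blast
qed

lemma uea_negative_gen_commute:
  assumes "Poly_Mapping.keys f \<subseteq> {..<0}" "Poly_Mapping.keys g \<subseteq> {..<0}"
  shows "uea_gen (f, 0) * uea_gen (g, 0) = uea_gen (g, 0) * uea_gen (f, 0)"
proof -
  have "r + s \<noteq> 0" if "r \<in> Poly_Mapping.keys f" "s \<in> Poly_Mapping.keys g" for r s
  proof -
    have "r < 0" "s < 0" using assms that by auto
    then show ?thesis by simp
  qed
  then have "heis_bracket (f, 0) (g, 0) = 0"
    by (simp add: heis_bracket_def zero_prod_def)
  then show ?thesis using uea_gen_bracket[of "(f, 0)" "(g, 0)"] by simp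
qed

text \<open>Two negative modes never add up to 0, so the generators commute; commuting with a fixed
  element then passes to scalar multiples, sums and products, first on one side and then on the
  other.\<close>

lemma uea_negative_commute:
  assumes "u \<in> uea_negative" "v \<in> uea_negative"
  shows "u * v = v * u"
proof -
  have gen: "uea_gen (f, 0) * v = v * uea_gen (f, 0)" if f: "Poly_Mapping.keys f \<subseteq> {..<0}" for f
    using assms(2)
  proof (induction rule: uea_negative_induct)
    case (mult u v)
    have "uea_gen (f, 0) * (u * v) = u * (uea_gen (f, 0) * v)"
      by (simp add: mult.assoc[symmetric] mult(3))
    then show ?case by (simp add: mult(4) mult.assoc)
  next
    case (scale \<alpha> u)
    have "uea_gen (f, 0) * (uea_scalar \<alpha> * u) = uea_scalar \<alpha> * (uea_gen (f, 0) * u)"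
      by (simp add: mult.assoc[symmetric] uea_scalar_commute)
    then show ?case by (simp add: scale(2) mult.assoc)
  next
    case (gen g)
    then show ?case by (rule uea_negative_gen_commute[OF f])
  qed (simp_all add: algebra_simps)
  show ?thesis
    using assms(1)
  proof (induction rule: uea_negative_induct)
    case (mult u u')
    have "u * u' * v = u * v * u'" by (simp add: mult(4) mult.assoc)
    then show ?case by (simp add: mult(3) mult.assoc)
  next
    case (scale \<alpha> u)
    have "v * (uea_scalar \<alpha> * u) = uea_scalar \<alpha> * (v * u)"
      by (simp add: mult.assoc[symmetric] uea_scalar_commute)
    then show ?case by (simp add: scale(2) mult.assoc)
  qed (simp_all add: gen algebra_simps)
qed

text \<open>The negative part is commutative; giving it a type of its own makes evaluation of polynomials in
  it available.\<close>

typedef (overloaded) 'n uneg = "uea_negative :: 'n::finite uea set"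
  using uea_negative_one by blast

setup_lifting type_definition_uneg

instantiation uneg :: (finite) comm_ring_1
begin

lift_definition zero_uneg :: "'a uneg" is 0 by (rule uea_negative_zero)
lift_definition one_uneg :: "'a uneg" is 1 by (rule uea_negative_one)
lift_definition plus_uneg :: "'a uneg \<Rightarrow> 'a uneg \<Rightarrow> 'a uneg" is "(+)" by (rule uea_negative_add)
lift_definition minus_uneg :: "'a uneg \<Rightarrow> 'a uneg \<Rightarrow> 'a uneg" is "(-)" by (rule uea_negative_diff)
lift_definition uminus_uneg :: "'a uneg \<Rightarrow> 'a uneg" is uminus by (rule uea_negative_uminus)
lift_definition times_uneg :: "'a uneg \<Rightarrow> 'a uneg \<Rightarrow> 'a uneg" is "(*)" by (rule uea_negative_mult)

instance
  by standard (transfer; simp add: algebra_simps uea_negative_commute)+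

end

lift_definition uneg_scalar :: "complex \<Rightarrow> 'n::finite uneg" is uea_scalar
  by (rule uea_negative_scalar)

lift_definition uneg_gen :: "'n::finite \<Rightarrow> nat \<Rightarrow> 'n uneg" is
  "\<lambda>i k. uea_gen (heis_mode (cartan_gen i) (- int k - 1))"
  by (rule uea_negative_mode) simp

text \<open>Off-diagonal variables do not occur in the trace relations, so the value 0 is compatible
  with them; the diagonal ones go to the negative modes of the \<open>a_i\<close>.\<close>

definition uneg_var :: "'n \<times> 'n \<times> nat \<Rightarrow> 'n::finite uneg" where
  "uneg_var v = (case v of (i, j, k) \<Rightarrow> if i = j then uneg_gen i k else 0)"

lemma uneg_evaluation: "poly_evaluation uneg_scalar"
  by standard (transfer; simp add: uea_scalar_add uea_scalar_mult)+

definition uneg_eval :: "'n::finite x_poly \<Rightarrow> 'n uneg" where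
  "uneg_eval = poly_evaluation.eval_poly uneg_scalar uneg_var"

lemmas uneg_eval_simps =
  poly_evaluation.eval_poly_zero[OF uneg_evaluation, where s = uneg_var, folded uneg_eval_def]
  poly_evaluation.eval_poly_add[OF uneg_evaluation, where s = uneg_var, folded uneg_eval_def]
  poly_evaluation.eval_poly_mult[OF uneg_evaluation, where s = uneg_var, folded uneg_eval_def]
  poly_evaluation.eval_poly_sum[OF uneg_evaluation, where s = uneg_var, folded uneg_eval_def]

lemma uneg_eval_scalar: "uneg_eval (Poly_Mapping.single 0 a) = uneg_scalar a"
  using poly_evaluation.eval_poly_single[OF uneg_evaluation, of uneg_var 0 a, folded uneg_eval_def] by simp

lemma uneg_eval_var: "uneg_eval (x_var (i, j) k) = (if i = j then uneg_gen i k else 0)"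
  unfolding x_var_def uneg_eval_def poly_evaluation.eval_poly_single[OF uneg_evaluation] monom_eval_single
  by (simp add: uneg_var_def poly_evaluation.scalar_one[OF uneg_evaluation])

lemma uneg_gen_trace: "(\<Sum>i\<in>UNIV. uneg_gen i k) = 0"
proof -
  have "Rep_uneg (sum f A) = (\<Sum>x\<in>A. Rep_uneg (f x))" for f :: "'a \<Rightarrow> 'a uneg" and A
    by (induction A rule: infinite_finite_induct) (simp_all add: zero_uneg.rep_eq plus_uneg.rep_eq)
  then have "Rep_uneg (\<Sum>i\<in>UNIV. uneg_gen i k :: 'a uneg) = uea_gen (heis_mode (\<Sum>i\<in>UNIV. cartan_gen i) (- int k - 1))"
    by (simp add: uneg_gen.rep_eq heis_mode_sum uea_gen_sum)
  then show ?thesis by (simp add: cartan_gen_sum zero_uneg.rep_eq flip: Rep_uneg_inject)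
qed

text \<open>The kernel of the evaluation is an ideal, and it contains the traces because the classes
  \<open>a_i\<close> sum to 0.\<close>

lemma uneg_eval_trace_ideal0:
  assumes "p \<in> trace_ideal0"
  shows "uneg_eval p = 0"
proof -
  have "fps_nth (fps_const p) 0 \<in> {p. uneg_eval p = 0}"
  proof (rule trace_ideal_coeff)
    show "two_sided_ideal {p. uneg_eval p = 0}"
      by (simp add: two_sided_ideal_def uneg_eval_simps)
    show "(\<Sum>i\<in>UNIV. x_var (i, i) k) \<in> {p. uneg_eval p = 0}" for k
      by (simp add: uneg_eval_simps uneg_eval_var uneg_gen_trace)
  qed (use assms in \<open>simp add: trace_ideal0_def\<close>)
  then show ?thesis by simp
qed

section \<open>Reduction to negative elements modulo the induced relations\<close>

lemma left_ideal_induced: "left_ideal (induced_relations c)"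
  unfolding induced_relations_def left_ideal_def by auto

lemma induced_relations_gen:
  "Poly_Mapping.keys f \<subseteq> {0..} \<Longrightarrow> uea_gen (f, z) - uea_scalar (c * z) \<in> induced_relations c"
  unfolding induced_relations_def by blast

definition reducible :: "complex \<Rightarrow> 'n::finite uea set" where
  "reducible c = {u. \<exists>n\<in>uea_negative. u - n \<in> induced_relations c}"

lemma
  fixes u v a :: "'n::finite uea"
  shows induced_relations_add: "u \<in> induced_relations c \<Longrightarrow> v \<in> induced_relations c \<Longrightarrow> u + v \<in> induced_relations c"
    and induced_relations_mult: "u \<in> induced_relations c \<Longrightarrow> a * u \<in> induced_relations c"
    and induced_relations_0: "(0 :: 'n uea) \<in> induced_relations c"
  using left_ideal_induced[where 'a = 'n, of c] unfolding left_ideal_def by auto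

lemma reducible_add: "u \<in> reducible c \<Longrightarrow> v \<in> reducible c \<Longrightarrow> u + v \<in> reducible c"
proof -
  assume "u \<in> reducible c" "v \<in> reducible c"
  then obtain m n where "m \<in> uea_negative" "n \<in> uea_negative"
    "u - m \<in> induced_relations c" "v - n \<in> induced_relations c" unfolding reducible_def by blast
  then have "m + n \<in> uea_negative" "(u + v) - (m + n) \<in> induced_relations c"
    using induced_relations_add[of "u - m" c "v - n"] by (auto intro: uea_negative_add simp: algebra_simps)
  then show ?thesis unfolding reducible_def by blast
qed

lemma reducible_mult_negative: "a \<in> uea_negative \<Longrightarrow> u \<in> reducible c \<Longrightarrow> a * u \<in> reducible c"
proof -
  assume a: "a \<in> uea_negative" and "u \<in> reducible c"
  then obtain m where "m \<in> uea_negative" "u - m \<in> induced_relations c" unfolding reducible_def by blast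
  then have "a * m \<in> uea_negative" "a * u - a * m \<in> induced_relations c"
    using a induced_relations_mult[of "u - m" c a] by (auto intro: uea_negative_mult simp: algebra_simps)
  then show ?thesis unfolding reducible_def by blast
qed

lemma reducible_negative: "n \<in> uea_negative \<Longrightarrow> n \<in> reducible c"
  unfolding reducible_def by (intro CollectI bexI[of _ n]) (simp_all add: induced_relations_0)

lemma reducible_induced: "u \<in> induced_relations c \<Longrightarrow> u \<in> reducible c"
  unfolding reducible_def by (intro CollectI bexI[of _ 0]) (simp_all add: uea_negative_zero)

lemma reducible_sum: "(\<And>x. x \<in> A \<Longrightarrow> f x \<in> reducible c) \<Longrightarrow> sum f A \<in> reducible c"
  by (induction A rule: infinite_finite_induct)
    (auto intro: reducible_add reducible_negative uea_negative_zero)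

text \<open>Nonnegative modes can be moved to the right past negative ones: the commutators are multiples of
  the central element, which is itself one of the elements being moved.\<close>

lemma nonneg_mult_negative_reducible:
  fixes n :: "'n::finite uea"
  assumes n: "n \<in> uea_negative" and g: "Poly_Mapping.keys g \<subseteq> {0..}"
  shows "uea_gen (g, z) * n \<in> reducible c"
proof -
  define Q :: "'n uea set" where "Q = {n \<in> uea_negative. \<forall>g z. Poly_Mapping.keys g \<subseteq> {0..} \<longrightarrow> uea_gen (g, z) * n \<in> reducible c}"
  have QI: "n \<in> Q" if "n \<in> uea_negative"
    "\<And>g z. Poly_Mapping.keys g \<subseteq> {0..} \<Longrightarrow> uea_gen (g, z) * n \<in> reducible c" for n
    using that unfolding Q_def by blast
  have QD: "n \<in> uea_negative" "Poly_Mapping.keys g \<subseteq> {0..} \<Longrightarrow> uea_gen (g, z) * n \<in> reducible c" if "n \<in> Q" for n g z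
    using that unfolding Q_def by blast+
  have one: "1 \<in> Q"
  proof (rule QI[OF uea_negative_one])
    show "uea_gen (g, z) * 1 \<in> reducible c" if "Poly_Mapping.keys g \<subseteq> {0..}" for g z
      using uea_negative_scalar induced_relations_gen[OF that] unfolding reducible_def by auto
  qed
  \<comment> \<open>Stated as stability of \<open>Q\<close> under left multiplication by
    \<open>n\<close>: in this form the induction passes through products, and applying it to 1 gives
    the claim.\<close>
  have "\<forall>m\<in>Q. n * m \<in> Q"
    using n
  proof (induction rule: uea_negative_induct)
    case (add u v)
    show ?case
    proof
      fix m assume m: "m \<in> Q"
      from add m have uv: "u * m \<in> Q" "v * m \<in> Q" by blast+
      show "(u + v) * m \<in> Q"
        unfolding distrib_right
      proof (rule QI)
        show "u * m + v * m \<in> uea_negative" using QD(1)[OF uv(1)] QD(1)[OF uv(2)] by (rule uea_negative_add)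
        show "uea_gen (g, z) * (u * m + v * m) \<in> reducible c" if "Poly_Mapping.keys g \<subseteq> {0..}" for g z
          unfolding distrib_left by (rule reducible_add[OF QD(2)[OF uv(1) that] QD(2)[OF uv(2) that]])
      qed
    qed
  next
    case (mult u v)
    then show ?case by (simp add: mult.assoc)
  next
    case (scale \<alpha> u)
    show ?case
    proof
      fix m assume "m \<in> Q"
      with scale have m: "u * m \<in> Q" by blast
      show "uea_scalar \<alpha> * u * m \<in> Q"
        unfolding mult.assoc
      proof (rule QI)
        show "uea_scalar \<alpha> * (u * m) \<in> uea_negative" by (rule uea_negative_scale[OF QD(1)[OF m]])
        fix g z assume g: "Poly_Mapping.keys (g :: int \<Rightarrow>\<^sub>0 'n cartan) \<subseteq> {0..}"
        have "uea_gen (g, z) * (uea_scalar \<alpha> * (u * m)) = uea_scalar \<alpha> * (uea_gen (g, z) * (u * m))"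
          by (simp only: mult.assoc[symmetric] uea_scalar_commute)
        then show "uea_gen (g, z) * (uea_scalar \<alpha> * (u * m)) \<in> reducible c"
          using reducible_mult_negative[OF uea_negative_scalar QD(2)[OF m g]] by simp
      qed
    qed
  next
    case (gen f)
    show ?case
    proof
      fix m assume m: "m \<in> Q"
      show "uea_gen (f, 0) * m \<in> Q"
      proof (rule QI)
        show "uea_gen (f, 0) * m \<in> uea_negative"
          by (rule uea_negative_mult[OF uea_negative_gen[OF gen] QD(1)[OF m]])
        fix g z assume g: "Poly_Mapping.keys (g :: int \<Rightarrow>\<^sub>0 'n cartan) \<subseteq> {0..}"
        obtain t where t: "heis_bracket (g, z) (f, 0) = (0, t)"
          by (simp add: heis_bracket_def)
        have "uea_gen (g, z) * uea_gen (f, 0) = uea_gen (f, 0) * uea_gen (g, z) + uea_gen (0, t)"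
          using uea_gen_bracket[of "(g, z)" "(f, 0)"] unfolding t by (simp add: algebra_simps)
        then have "uea_gen (g, z) * (uea_gen (f, 0) * m)
          = uea_gen (f, 0) * (uea_gen (g, z) * m) + uea_gen (0, t) * m"
          by (simp only: mult.assoc[symmetric] distrib_right)
        then show "uea_gen (g, z) * (uea_gen (f, 0) * m) \<in> reducible c"
          using reducible_add[OF reducible_mult_negative[OF uea_negative_gen[OF gen] QD(2)[OF m g]] QD(2)[OF m]]
          by simp
      qed
    qed
  qed simp
  with one have "n * 1 \<in> Q" by blast
  then show ?thesis using QD(2)[OF _ g] by simp
qed

text \<open>Again a statement about left multiplication: negative modes preserve reducible elements
  trivially, nonnegative modes and the centre by the preceding lemma, and this stability is
  inherited by products.\<close>

lemma reducible_all: "u \<in> reducible c"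
proof -
  have "\<forall>v\<in>reducible c. u * v \<in> reducible c"
  proof (induction u rule: uea_induct)
    case (scalar \<alpha>)
    then show ?case by (auto intro: reducible_mult_negative uea_negative_scalar)
  next
    case (gen x)
    have nonneg: "uea_gen (g, z) * v \<in> reducible c"
      if v: "v \<in> reducible c" and g: "Poly_Mapping.keys g \<subseteq> {0..}" for v g z
    proof -
      obtain n where n: "n \<in> uea_negative" "v - n \<in> induced_relations c"
        using v unfolding reducible_def by blast
      have "uea_gen (g, z) * (v - n) \<in> reducible c"
        by (rule reducible_induced[OF induced_relations_mult[OF n(2)]])
      then have "uea_gen (g, z) * (v - n) + uea_gen (g, z) * n \<in> reducible c"
        using nonneg_mult_negative_reducible[OF n(1) g] by (rule reducible_add)
      then show ?thesis by (simp add: algebra_simps)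
    qed
    have "uea_gen (heis_mode a r) * v \<in> reducible c" if "v \<in> reducible c" for a r v
    proof (cases "r < 0")
      case True
      then show ?thesis using that by (intro reducible_mult_negative uea_negative_mode)
    next
      case False
      then show ?thesis unfolding heis_mode_def using that by (intro nonneg) auto
    qed
    then show ?case
      using nonneg[of _ 0 "snd x"] uea_gen_split[of "fst x" "snd x"]
      by (auto simp: distrib_right sum_distrib_right intro!: reducible_add reducible_sum)
  next
    case (add u v)
    then show ?case by (auto simp: distrib_right intro: reducible_add)
  next
    case (mult u v)
    then show ?case by (simp add: mult.assoc)
  qed
  from bspec[OF this reducible_negative[OF uea_negative_one]] show ?thesis by simp
qed

section \<open>The value of an element on the vacuum\<close>

context x_minus
begin

text \<open>Links a negative element to a polynomial in both directions: \<open>n\<close> acts as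
  multiplication by \<open>p\<close>, and evaluating \<open>p\<close> recovers \<open>n\<close>. The
  second direction is the left inverse behind injectivity; the last clause places the value on the
  vacuum in the diagonal span.\<close>

definition represents :: "'n x_poly \<Rightarrow> 'n uea \<Rightarrow> bool" where
  "represents p n \<longleftrightarrow> Rep_uneg (uneg_eval p) = n \<and> (\<forall>v. uea_act n v = abs_x_quot p * v) \<and>
     abs_x_quot p \<in> xq_span diag"

lemma represents_scalar: "represents (Poly_Mapping.single 0 \<alpha>) (uea_scalar \<alpha>)"
  using xq_span_scale[OF xq_span_one[OF diag_nonempty], of \<alpha>]
  by (simp add: represents_def uneg_eval_scalar uneg_scalar.rep_eq uea_act_scalar xq_scalar.abs_eq)

lemma represents_add: "represents p n \<Longrightarrow> represents q m \<Longrightarrow> represents (p + q) (n + m)"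
  by (auto simp: represents_def uneg_eval_simps plus_uneg.rep_eq uea_act_add abs_x_quot_add distrib_right
      intro: xq_span_add)

lemma represents_mult: "represents p n \<Longrightarrow> represents q m \<Longrightarrow> represents (p * q) (n * m)"
  by (auto simp: represents_def uneg_eval_simps times_uneg.rep_eq uea_act_mult abs_x_quot_mult mult.assoc
      intro: xq_span_mult)

lemma represents_gen: "represents (x_var (i, i) k) (uea_gen (heis_mode (cartan_gen i) (- int k - 1)))"
proof -
  have "xq_gen (i, i) k \<in> xq_span diag" by (rule xq_span_gen) (simp add: diag_def)
  then show ?thesis
    by (simp add: represents_def uneg_eval_var uneg_gen.rep_eq uea_act_gen heis_op_mode cartan_op_gen
        mode_op_def xq_gen.abs_eq)
qed

lemma represents_sum:
  assumes "\<And>x. x \<in> A \<Longrightarrow> \<exists>p. represents p (f x)"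
  shows "\<exists>p. represents p (sum f A)"
  using assms
proof (induction A rule: infinite_finite_induct)
  case (insert x A)
  obtain q where q: "represents q (sum f A)" using insert.IH insert.prems by blast
  obtain p where p: "represents p (f x)" using insert.prems[of x] by blast
  from represents_add[OF p q] insert.hyps show ?case by auto
next
  case (infinite A)
  then show ?case using represents_scalar[of 0] by auto
next
  case empty
  then show ?case using represents_scalar[of 0] by auto
qed

lemma represents_mode: "r < 0 \<Longrightarrow> \<exists>p. represents p (uea_gen (heis_mode a r))"
proof (induction a rule: cartan.abs_induct)
  case (1 x)
  have "\<exists>p. represents p (uea_scalar (x $ i) * uea_gen (heis_mode (cartan_gen i) r))" for i
    using represents_mult[OF represents_scalar represents_gen[of i "nat (- r - 1)"]] 1 by auto
  then show ?case unfolding uea_gen_mode_abs by (intro represents_sum) auto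
qed

lemma represents_exists: "n \<in> uea_negative \<Longrightarrow> \<exists>p. represents p n"
proof (induction rule: uea_negative_induct)
  case one
  then show ?case using represents_scalar[of 1] by auto
next
  case (gen f)
  have "uea_gen (f, 0) = (\<Sum>r\<in>Poly_Mapping.keys f. uea_gen (heis_mode (Poly_Mapping.lookup f r) r))"
    using uea_gen_split[of f 0] by (simp flip: zero_prod_def)
  also have "\<exists>p. represents p \<dots>"
    using gen by (intro represents_sum represents_mode) auto
  finally show ?case .
qed (use represents_add represents_mult represents_scalar in blast)+

definition vacuum_value :: "'n uea \<Rightarrow> 'n x_quot" where
  "vacuum_value u = uea_act u 1"

lemma uea_act_negative: "n \<in> uea_negative \<Longrightarrow> uea_act n v = vacuum_value n * v"
  using represents_exists[of n] by (auto simp: represents_def vacuum_value_def)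

lemma vacuum_value_negative_span: "n \<in> uea_negative \<Longrightarrow> vacuum_value n \<in> xq_span diag"
  using represents_exists[of n] by (auto simp: represents_def vacuum_value_def)

text \<open>If a representing polynomial lies in the trace ideal, then its evaluation is 0; but this
  evaluation is \<open>n\<close>.\<close>

lemma vacuum_value_negative_inj:
  assumes "n \<in> uea_negative" "vacuum_value n = 0"
  shows "n = 0"
proof -
  obtain p where p: "represents p n" using represents_exists[OF assms(1)] by blast
  with assms(2) have "abs_x_quot p = abs_x_quot 0" by (simp add: represents_def vacuum_value_def)
  then have "uneg_eval p = 0" using uneg_eval_trace_ideal0 by (simp only: abs_x_quot_eq diff_0_right)
  with p show ?thesis by (simp add: represents_def zero_uneg.rep_eq)
qed

lemma vacuum_value_surj:
  assumes "q \<in> xq_span diag"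
  shows "\<exists>n\<in>uea_negative. vacuum_value n = q"
proof -
  have mono: "\<exists>n\<in>uea_negative. vacuum_value n = m" if "m \<in> xq_monoms diag" for m
    using that
  proof (induction rule: xq_monoms_induct)
    case one
    show ?case using uea_negative_one by (intro bexI[of _ 1]) (simp_all add: vacuum_value_def)
  next
    case (step m a k)
    from step.IH obtain n where n: "n \<in> uea_negative" "vacuum_value n = m" by blast
    from step.hyps(2) obtain i where a: "a = (i, i)" by (auto simp: diag_def)
    let ?g = "uea_gen (heis_mode (cartan_gen i) (- int k - 1))"
    have "uea_act ?g 1 = xq_gen a k"
      by (simp add: uea_act_gen heis_op_mode cartan_op_gen mode_op_def a)
    then have "vacuum_value (n * ?g) = m * xq_gen a k"
      using uea_act_negative[OF n(1), of "xq_gen a k"] n(2)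
      by (simp add: vacuum_value_def[of "n * _"] uea_act_mult)
    moreover have "n * ?g \<in> uea_negative"
      by (rule uea_negative_mult[OF n(1) uea_negative_mode]) simp
    ultimately show ?case by (rule bexI)
  qed
  show ?thesis
    using assms
  proof (induction rule: xq_span.induct)
    case zero
    show ?case using uea_negative_zero by (intro bexI[of _ 0]) (simp_all add: vacuum_value_def)
  next
    case (add m q \<alpha>)
    obtain u v where u: "u \<in> uea_negative" "vacuum_value u = m" and v: "v \<in> uea_negative" "vacuum_value v = q"
      using mono[OF add(1)] add(3) by blast
    have "vacuum_value (uea_scalar \<alpha> * u + v) = xq_scalar \<alpha> * m + q"
      using u(2) v(2) by (simp add: vacuum_value_def uea_act_add uea_act_mult uea_act_scalar)
    moreover have "uea_scalar \<alpha> * u + v \<in> uea_negative"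
      using u(1) v(1) by (intro uea_negative_add uea_negative_scale)
    ultimately show ?case by (rule bexI)
  qed
qed

lemma vacuum_value_simps:
  "vacuum_value 0 = 0" "vacuum_value 1 = 1" "vacuum_value (u + v) = vacuum_value u + vacuum_value v"
  "vacuum_value (u - v) = vacuum_value u - vacuum_value v"
  "vacuum_value (uea_scalar \<alpha> * u) = xq_scalar \<alpha> * vacuum_value u"
  by (simp_all add: vacuum_value_def uea_act_add uea_act_diff uea_act_mult uea_act_scalar)

lemma vacuum_value_mult_negative: "n \<in> uea_negative \<Longrightarrow> vacuum_value (n * v) = vacuum_value n * vacuum_value v"
  using uea_act_negative[of n "vacuum_value v"] by (simp add: vacuum_value_def uea_act_mult)

text \<open>Nonnegative modes kill 1 and the central element acts by \<open>c\<close>, so the kernel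
  is a left ideal containing the generating relations. Conversely \<open>u\<close> is congruent to a
  negative element, which vanishes by injectivity if \<open>u\<close> kills the vacuum.\<close>

lemma induced_relations_iff: "u \<in> induced_relations c \<longleftrightarrow> vacuum_value u = 0"
proof -
  have sub: "vacuum_value u = 0" if "u \<in> induced_relations c" for u
  proof -
    let ?K = "{u. vacuum_value u = 0}"
    have "left_ideal ?K"
      by (simp add: left_ideal_def vacuum_value_def uea_act_add uea_act_mult)
    moreover have "uea_gen (f, z) - uea_scalar (c * z) \<in> ?K" if "Poly_Mapping.keys f \<subseteq> {0..}" for f z
    proof -
      have "pm_sum (\<lambda>r a. cartan_op a r 1) f = 0"
        unfolding pm_sum_def using that by (intro sum.neutral ballI cartan_op_nonneg_one) auto
      then show ?thesis
        by (simp add: vacuum_value_def uea_act_diff uea_act_gen uea_act_scalar heis_op_def)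
    qed
    ultimately show ?thesis using that unfolding induced_relations_def by blast
  qed
  obtain n where n: "n \<in> uea_negative" "u - n \<in> induced_relations c"
    using reducible_all[of u c] unfolding reducible_def by blast
  from sub[OF n(2)] have "vacuum_value u = vacuum_value n" by (simp add: vacuum_value_simps)
  with n vacuum_value_negative_inj[OF n(1)] sub show ?thesis by auto
qed

lemma vacuum_value_span: "vacuum_value u \<in> xq_span diag"
proof -
  obtain n where n: "n \<in> uea_negative" "u - n \<in> induced_relations c"
    using reducible_all[of u c] unfolding reducible_def by blast
  then have "vacuum_value u = vacuum_value n" by (simp add: induced_relations_iff vacuum_value_simps)
  with vacuum_value_negative_span[OF n(1)] show ?thesis by simp
qed

end

section \<open>Quotient algebras embedded in \<open>x_quot\<close>\<close>

lemma complex_field_simps [simp]: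
  "carrier complex_field = UNIV" "\<one>\<^bsub>complex_field\<^esub> = 1" "\<zero>\<^bsub>complex_field\<^esub> = 0"
  "a \<otimes>\<^bsub>complex_field\<^esub> b = a * b" "a \<oplus>\<^bsub>complex_field\<^esub> b = a + b"
  by (simp_all add: complex_field_def)

lemma cring_complex_field: "cring complex_field"
proof (rule cringI)
  show "abelian_group complex_field"
  proof (rule abelian_groupI)
    show "\<exists>y\<in>carrier complex_field. y \<oplus>\<^bsub>complex_field\<^esub> x = \<zero>\<^bsub>complex_field\<^esub>" for x
      by (rule bexI[of _ "- x"]) simp_all
  qed simp_all
  show "Group.comm_monoid complex_field" by (rule comm_monoidI) simp_all
qed (simp add: distrib_right)

lemma coset_eq_fiber:
  fixes g :: "'a::ab_group_add \<Rightarrow> 'b::ab_group_add"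
  assumes "\<And>x y. x \<in> V \<Longrightarrow> y \<in> V \<Longrightarrow> x + y \<in> V \<and> x - y \<in> V \<and> g (x + y) = g x + g y \<and> g (x - y) = g x - g y"
    and "K = {x \<in> V. g x = 0}" and x: "x \<in> V"
  shows "coset K x = {y \<in> V. g y = g x}"
proof (intro equalityI subsetI)
  fix y
  show "y \<in> coset K x \<Longrightarrow> y \<in> {y \<in> V. g y = g x}"
    using assms by (auto simp: coset_def)
  assume "y \<in> {y \<in> V. g y = g x}"
  then have "y - x \<in> K" using assms by simp
  then show "y \<in> coset K x" unfolding coset_def by (rule rev_image_eqI) simp
qed

text \<open>Serves both \<open>VH_limit\<close> and \<open>heis_space\<close>: a linear map into
  \<open>x_quot\<close> with kernel \<open>K\<close> reduces all ring and module laws to those of a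
  commutative ring. The product is given on cosets only, since on the Heisenberg side it is formed
  from negative representatives and not from arbitrary ones.\<close>

locale quotient_embedding =
  fixes s :: "complex \<Rightarrow> 'a \<Rightarrow> 'a::ab_group_add" and V K :: "'a set"
    and mul :: "'a set \<Rightarrow> 'a set \<Rightarrow> 'a set" and e :: "'a set" and g :: "'a \<Rightarrow> 'n::finite x_quot"
  assumes V_zero: "0 \<in> V"
    and V_add: "x \<in> V \<Longrightarrow> y \<in> V \<Longrightarrow> x + y \<in> V"
    and V_diff: "x \<in> V \<Longrightarrow> y \<in> V \<Longrightarrow> x - y \<in> V"
    and V_scale: "x \<in> V \<Longrightarrow> s \<alpha> x \<in> V"
    and g_add: "x \<in> V \<Longrightarrow> y \<in> V \<Longrightarrow> g (x + y) = g x + g y"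
    and g_diff: "x \<in> V \<Longrightarrow> y \<in> V \<Longrightarrow> g (x - y) = g x - g y"
    and g_scale: "x \<in> V \<Longrightarrow> g (s \<alpha> x) = xq_scalar \<alpha> * g x"
    and K_eq: "K = {x \<in> V. g x = 0}"
    and unit: "\<exists>x\<in>V. e = coset K x \<and> g x = 1"
    and mul: "x \<in> V \<Longrightarrow> y \<in> V \<Longrightarrow> \<exists>z\<in>V. mul (coset K x) (coset K y) = coset K z \<and> g z = g x * g y"
begin

definition M :: "(complex, 'a set) module" where
  "M = quotient_algebra s V K mul e"

definition emb :: "'a set \<Rightarrow> 'n x_quot" where
  "emb A = g (SOME x. x \<in> A)"

lemma coset_eq: "x \<in> V \<Longrightarrow> coset K x = {y \<in> V. g y = g x}"
  by (rule coset_eq_fiber[OF _ K_eq]) (simp_all add: V_add V_diff g_add g_diff)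

lemma emb_coset: "x \<in> V \<Longrightarrow> emb (coset K x) = g x"
  unfolding emb_def coset_eq by (rule someI2[of _ x]) auto

lemma coset_in_carrier: "x \<in> V \<Longrightarrow> coset K x \<in> carrier M"
  by (simp add: M_def quotient_algebra_def)

lemma carrierE:
  assumes "A \<in> carrier M"
  obtains x where "x \<in> V" "A = coset K x" "emb A = g x"
  using assms emb_coset by (auto simp: M_def quotient_algebra_def)

lemma emb_inj: "A \<in> carrier M \<Longrightarrow> B \<in> carrier M \<Longrightarrow> emb A = emb B \<Longrightarrow> A = B"
  by (elim carrierE) (simp add: coset_eq)

lemma zero_eq: "\<zero>\<^bsub>M\<^esub> = coset K 0"
proof -
  have g0: "g 0 = 0" using g_diff[OF V_zero V_zero] by simp
  have "coset K 0 = K" unfolding coset_eq[OF V_zero] g0 by (rule K_eq[symmetric])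
  then show ?thesis by (simp add: M_def quotient_algebra_def)
qed

lemma zero_carrier: "\<zero>\<^bsub>M\<^esub> \<in> carrier M"
  unfolding zero_eq by (rule coset_in_carrier[OF V_zero])

lemma emb_zero: "emb \<zero>\<^bsub>M\<^esub> = 0"
  unfolding zero_eq emb_coset[OF V_zero] using g_diff[OF V_zero V_zero] by simp

lemma one_carrier: "\<one>\<^bsub>M\<^esub> \<in> carrier M" and emb_one: "emb \<one>\<^bsub>M\<^esub> = 1"
  using unit coset_in_carrier emb_coset by (auto simp: M_def quotient_algebra_def)

lemma add_coset: "x \<in> V \<Longrightarrow> y \<in> V \<Longrightarrow> coset K x \<oplus>\<^bsub>M\<^esub> coset K y = coset K (x + y)"
proof -
  assume x: "x \<in> V" and y: "y \<in> V"
  have "(\<Union>a\<in>coset K x. \<Union>b\<in>coset K y. coset K (a + b)) = coset K (x + y)"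
  proof (intro SUP_eq_const)
    show "coset K x \<noteq> {}" "coset K y \<noteq> {}" using x y by (auto simp: coset_eq)
    fix a b assume "a \<in> coset K x" "b \<in> coset K y"
    then show "coset K (a + b) = coset K (x + y)"
      using x y by (simp add: coset_eq V_add g_add)
  qed
  then show ?thesis by (simp add: M_def quotient_algebra_def)
qed

lemma smult_coset: "x \<in> V \<Longrightarrow> \<alpha> \<odot>\<^bsub>M\<^esub> coset K x = coset K (s \<alpha> x)"
proof -
  assume x: "x \<in> V"
  have "(\<Union>a\<in>coset K x. coset K (s \<alpha> a)) = coset K (s \<alpha> x)"
  proof (intro SUP_eq_const)
    show "coset K x \<noteq> {}" using x by (auto simp: coset_eq)
    fix a assume "a \<in> coset K x"
    then show "coset K (s \<alpha> a) = coset K (s \<alpha> x)"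
      using x by (simp add: coset_eq V_scale g_scale)
  qed
  then show ?thesis by (simp add: M_def quotient_algebra_def)
qed

lemma add_carrier: "A \<in> carrier M \<Longrightarrow> B \<in> carrier M \<Longrightarrow> A \<oplus>\<^bsub>M\<^esub> B \<in> carrier M"
  by (elim carrierE) (simp add: add_coset coset_in_carrier V_add)
lemma emb_add: "A \<in> carrier M \<Longrightarrow> B \<in> carrier M \<Longrightarrow> emb (A \<oplus>\<^bsub>M\<^esub> B) = emb A + emb B"
  by (elim carrierE) (simp add: add_coset emb_coset V_add g_add)
lemma smult_carrier: "A \<in> carrier M \<Longrightarrow> \<alpha> \<odot>\<^bsub>M\<^esub> A \<in> carrier M"
  by (elim carrierE) (simp add: smult_coset coset_in_carrier V_scale)
lemma emb_smult: "A \<in> carrier M \<Longrightarrow> emb (\<alpha> \<odot>\<^bsub>M\<^esub> A) = xq_scalar \<alpha> * emb A"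
  by (elim carrierE) (simp add: smult_coset emb_coset V_scale g_scale)

lemma
  assumes "A \<in> carrier M" "B \<in> carrier M"
  shows mult_carrier: "A \<otimes>\<^bsub>M\<^esub> B \<in> carrier M" and emb_mult: "emb (A \<otimes>\<^bsub>M\<^esub> B) = emb A * emb B"
proof -
  obtain x where x: "x \<in> V" "A = coset K x" "emb A = g x" by (rule carrierE[OF assms(1)])
  obtain y where y: "y \<in> V" "B = coset K y" "emb B = g y" by (rule carrierE[OF assms(2)])
  obtain z where z: "z \<in> V" "mul A B = coset K z" "g z = g x * g y"
    using mul[OF x(1) y(1)] x y by blast
  have "A \<otimes>\<^bsub>M\<^esub> B = coset K z" using z by (simp add: M_def quotient_algebra_def)
  then show "A \<otimes>\<^bsub>M\<^esub> B \<in> carrier M" "emb (A \<otimes>\<^bsub>M\<^esub> B) = emb A * emb B"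
    using x y z by (simp_all add: coset_in_carrier emb_coset)
qed

lemmas carriers = zero_carrier one_carrier add_carrier smult_carrier mult_carrier
lemmas embs = emb_zero emb_one emb_add emb_smult emb_mult

lemma abelian_group_M: "abelian_group M"
proof (rule abelian_groupI)
  fix A assume A: "A \<in> carrier M"
  have "(- 1) \<odot>\<^bsub>M\<^esub> A \<oplus>\<^bsub>M\<^esub> A = \<zero>\<^bsub>M\<^esub>"
    using A by (intro emb_inj) (simp_all add: carriers embs xq_scalar_uminus)
  then show "\<exists>B\<in>carrier M. B \<oplus>\<^bsub>M\<^esub> A = \<zero>\<^bsub>M\<^esub>" using smult_carrier[OF A] by blast
qed ((rule emb_inj)?; simp add: carriers embs algebra_simps)+

lemma cring_M: "cring M"
proof (rule cringI[OF abelian_group_M])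
  show "Group.comm_monoid M"
    by (rule comm_monoidI; (rule emb_inj)?; simp add: carriers embs algebra_simps)
qed ((rule emb_inj)?; simp add: carriers embs algebra_simps)+

lemma algebra_M: "algebra complex_field M"
  by (rule algebraI[OF cring_complex_field cring_M]; (rule emb_inj)?;
      simp add: carriers embs algebra_simps xq_scalar_add xq_scalar_mult)

lemma module_M: "Module.module complex_field M"
  by (rule algebra.module[OF algebra_M])

lemma finsum_emb:
  assumes "finite A" "\<And>x. x \<in> A \<Longrightarrow> f x \<in> carrier M"
  shows "finsum M f A \<in> carrier M \<and> emb (finsum M f A) = (\<Sum>x\<in>A. emb (f x))"
proof -
  interpret abelian_group M by (rule abelian_group_M)
  show ?thesis
    using assms
  proof (induction A rule: finite_induct)
    case (insert x A)
    then have "finsum M f (insert x A) = f x \<oplus>\<^bsub>M\<^esub> finsum M f A"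
      by (intro finsum_insert) auto
    with insert show ?case by (simp add: carriers embs)
  qed (simp add: zero_carrier emb_zero)
qed

end


section \<open>The classical limit\<close>

locale classical_limit = quantum_vertex c xm Y
  for c :: complex and xm :: "'n::finite \<times> 'n \<Rightarrow> nat \<Rightarrow> 'n hplus \<Rightarrow> 'n hplus"
    and Y :: "'n hplus \<Rightarrow> int \<Rightarrow> 'n hplus \<Rightarrow> 'n hplus" +
  fixes Yheis :: "'n uea set \<Rightarrow> int \<Rightarrow> 'n uea set \<Rightarrow> 'n uea set"
  assumes heis_map: "is_heisenberg_vertex_map c Yheis"
begin

abbreviation Hsp :: "(complex, 'n uea set) module" where "Hsp \<equiv> heis_space c"

abbreviation Qsp :: "(complex, 'n hplus set) module" where "Qsp \<equiv> VH_limit"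

text \<open>An element of \<open>VH\<close> divisible by \<open>h\<close> in \<open>H+\<close> is
  divisible by \<open>h\<close> within \<open>VH\<close>, so no element outside \<open>h VH\<close>
  is lost under reduction.\<close>

lemma h_times_VH: "h_times 1 (VH :: 'n hplus set) = {v \<in> VH. reduce v = 0}"
  unfolding VH_eq h_times_h_span using reduce_eq_0_iff by auto

declare One_nat_def [simp del]

lemma VH_embedding:
  "quotient_embedding (\<lambda>\<alpha> v. hscalar (fps_const \<alpha>) * v) VH (h_times 1 VH)
     (\<lambda>A B. \<Union>a\<in>A. \<Union>b\<in>B. VH_class (a * b)) (VH_class 1) (reduce :: 'n hplus \<Rightarrow> 'n x_quot)"
proof
  let ?K = "h_times 1 VH :: 'n hplus set"
  show "\<exists>x\<in>VH. VH_class 1 = coset ?K x \<and> reduce x = 1"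
    by (intro bexI[of _ 1]) (simp_all add: VH_eq h_span_1)
  fix x y :: "'n hplus" assume xy: "x \<in> VH" "y \<in> VH"
  have coset: "coset ?K x = {y \<in> VH. reduce y = reduce x}" if "x \<in> VH" for x
    using h_times_VH that
    by (rule coset_eq_fiber[rotated]) (simp add: VH_eq h_span_add h_span_diff reduce_add reduce_diff)
  have "(\<Union>a\<in>coset ?K x. \<Union>b\<in>coset ?K y. VH_class (a * b)) = coset ?K (x * y)"
  proof (intro SUP_eq_const)
    show "coset ?K x \<noteq> {}" "coset ?K y \<noteq> {}" using xy by (auto simp: coset)
    fix a b assume "a \<in> coset ?K x" "b \<in> coset ?K y"
    then have ab: "a \<in> VH" "b \<in> VH" "reduce a = reduce x" "reduce b = reduce y"
      using xy by (simp_all add: coset)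
    have "a * b \<in> VH" "x * y \<in> VH" using ab xy by (simp_all add: VH_eq h_span_mult)
    then show "VH_class (a * b) = coset ?K (x * y)" using ab by (simp add: coset reduce_mult)
  qed
  moreover have "x * y \<in> VH" using xy by (simp add: VH_eq h_span_mult)
  ultimately show "\<exists>z\<in>VH. (\<Union>a\<in>coset ?K x. \<Union>b\<in>coset ?K y. VH_class (a * b)) = coset ?K z \<and> reduce z = reduce x * reduce y"
    by (intro bexI[of _ "x * y"]) (simp_all add: reduce_mult)
qed (simp_all add: VH_eq h_span_0 h_span_add h_span_diff h_span_scale reduce_add reduce_diff reduce_scale
    h_times_VH[unfolded VH_eq, simplified])

lemma heis_coset: "heis_class c x = {y. vacuum_value y = vacuum_value x}"
proof -
  have "induced_relations c = {x \<in> UNIV. vacuum_value x = 0}" by (auto simp: induced_relations_iff)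
  from coset_eq_fiber[OF _ this, of x] show ?thesis by (simp add: vacuum_value_simps)
qed

text \<open>Every coset contains a negative representative by \<open>vacuum_value_surj\<close>, and
  for negative left factors the vacuum value is multiplicative; hence the product does not depend on
  the negative representatives.\<close>

lemma heis_embedding:
  "quotient_embedding (\<lambda>\<alpha> u. uea_scalar \<alpha> * u) UNIV (induced_relations c)
     (\<lambda>A B. \<Union>u\<in>A \<inter> uea_negative. \<Union>v\<in>B \<inter> uea_negative. heis_class c (u * v)) (heis_class c 1) vacuum_value"
proof
  show "\<exists>x\<in>UNIV. heis_class c 1 = heis_class c x \<and> vacuum_value x = 1"
    by (intro bexI[of _ 1]) (simp_all add: vacuum_value_simps)
  fix x y :: "'n uea"
  obtain m where m: "m \<in> uea_negative" "vacuum_value m = vacuum_value x"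
    using vacuum_value_surj[OF vacuum_value_span[of x]] by blast
  obtain n where n: "n \<in> uea_negative" "vacuum_value n = vacuum_value y"
    using vacuum_value_surj[OF vacuum_value_span[of y]] by blast
  have "(\<Union>u\<in>heis_class c x \<inter> uea_negative. \<Union>v\<in>heis_class c y \<inter> uea_negative. heis_class c (u * v))
     = heis_class c (m * n)"
  proof (intro SUP_eq_const)
    show "heis_class c x \<inter> uea_negative \<noteq> {}" "heis_class c y \<inter> uea_negative \<noteq> {}"
      using m n by (auto simp: heis_coset)
    fix u v assume "u \<in> heis_class c x \<inter> uea_negative" "v \<in> heis_class c y \<inter> uea_negative"
    then have "vacuum_value (u * v) = vacuum_value (m * n)"
      using m n by (simp add: heis_coset vacuum_value_mult_negative)
    then show "heis_class c (u * v) = heis_class c (m * n)" by (simp add: heis_coset)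
  qed
  then show "\<exists>z\<in>UNIV. (\<Union>u\<in>heis_class c x \<inter> uea_negative. \<Union>v\<in>heis_class c y \<inter> uea_negative. heis_class c (u * v))
     = heis_class c z \<and> vacuum_value z = vacuum_value x * vacuum_value y"
    using m n by (intro bexI[of _ "m * n"]) (simp_all add: vacuum_value_mult_negative)
qed (simp_all add: vacuum_value_simps induced_relations_iff set_eq_iff)

interpretation q: quotient_embedding "\<lambda>\<alpha> v. hscalar (fps_const \<alpha>) * v" VH "h_times 1 VH"
  "\<lambda>A B. \<Union>a\<in>A. \<Union>b\<in>B. VH_class (a * b)" "VH_class 1" "reduce :: 'n hplus \<Rightarrow> 'n x_quot"
  rewrites "q.M = Qsp"
proof -
  interpret q: quotient_embedding "\<lambda>\<alpha> v. hscalar (fps_const \<alpha>) * v" VH "h_times 1 VH"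
    "\<lambda>A B. \<Union>a\<in>A. \<Union>b\<in>B. VH_class (a * b)" "VH_class 1" "reduce :: 'n hplus \<Rightarrow> 'n x_quot"
    by (rule VH_embedding)
  show "quotient_embedding (\<lambda>\<alpha> v. hscalar (fps_const \<alpha>) * v) VH (h_times 1 VH)
    (\<lambda>A B. \<Union>a\<in>A. \<Union>b\<in>B. VH_class (a * b)) (VH_class 1) (reduce :: 'n hplus \<Rightarrow> 'n x_quot)"
    by (rule VH_embedding)
  show "q.M = Qsp" by (simp add: q.M_def VH_limit_def)
qed

interpretation heis: quotient_embedding "\<lambda>\<alpha> u. uea_scalar \<alpha> * u" UNIV "induced_relations c"
  "\<lambda>A B. \<Union>u\<in>A \<inter> uea_negative. \<Union>v\<in>B \<inter> uea_negative. heis_class c (u * v)" "heis_class c 1" vacuum_value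
  rewrites "heis.M = Hsp"
proof -
  interpret heis: quotient_embedding "\<lambda>\<alpha> u. uea_scalar \<alpha> * u" UNIV "induced_relations c"
    "\<lambda>A B. \<Union>u\<in>A \<inter> uea_negative. \<Union>v\<in>B \<inter> uea_negative. heis_class c (u * v)" "heis_class c 1" vacuum_value
    by (rule heis_embedding)
  show "quotient_embedding (\<lambda>\<alpha> u. uea_scalar \<alpha> * u) UNIV (induced_relations c)
    (\<lambda>A B. \<Union>u\<in>A \<inter> uea_negative. \<Union>v\<in>B \<inter> uea_negative. heis_class c (u * v)) (heis_class c 1) vacuum_value"
    by (rule heis_embedding)
  show "heis.M = Hsp" by (simp add: heis.M_def heis_space_def)
qed

lemma heis_class_carrier: "heis_class c u \<in> carrier (Hsp)"
  by (rule heis.coset_in_carrier) simp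

lemma heis_emb_class: "heis.emb (heis_class c u) = vacuum_value u"
  by (rule heis.emb_coset) simp

lemma heis_emb_span: "A \<in> carrier (Hsp) \<Longrightarrow> heis.emb A \<in> xq_span diag"
  by (elim heis.carrierE) (simp add: vacuum_value_span)

lemma heis_emb_surj:
  assumes "x \<in> xq_span diag"
  obtains A where "A \<in> carrier (Hsp)" "heis.emb A = x"
  using vacuum_value_surj[OF assms] heis_class_carrier heis_emb_class by metis

lemma q_emb_span: "A \<in> carrier Qsp \<Longrightarrow> q.emb A \<in> xq_span diag"
  by (elim q.carrierE) (simp add: VH_eq reduce_h_span)

section \<open>The axioms on the Heisenberg side and the comparison of vertex operators\<close>

lemma heis_vertex_algebra: "vertex_algebra (Hsp) (heis_class c 1) Yheis"
  using heis_map unfolding is_heisenberg_vertex_map_def by (rule conjunct1)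

lemma Yheis_mode:
  "Yheis (heis_class c (uea_gen (heis_mode a (- 1)))) r (heis_class c u) = heis_class c (uea_gen (heis_mode a r) * u)"
  using heis_map unfolding is_heisenberg_vertex_map_def by (elim conjE allE)

lemmas heis_axioms = heis_vertex_algebra[unfolded vertex_algebra_def, THEN conjunct2, THEN conjunct2]

lemmas Yheis_carrier = heis_axioms[THEN conjunct1, THEN bspec, THEN bspec, THEN spec]

lemmas Yheis_linear = heis_axioms[THEN conjunct2, THEN conjunct1, THEN spec, THEN bspec, THEN bspec, THEN bspec, THEN spec]

lemmas Yheis_truncation = heis_axioms[THEN conjunct2, THEN conjunct2, THEN conjunct1, THEN bspec, THEN bspec]

lemmas Yheis_vacuum = heis_axioms[THEN conjunct2, THEN conjunct2, THEN conjunct2, THEN conjunct1, THEN bspec, THEN spec]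

lemmas Yheis_creation =
  heis_axioms[THEN conjunct2, THEN conjunct2, THEN conjunct2, THEN conjunct2, THEN conjunct1, THEN bspec]

lemma Yheis_borcherds:
  assumes "A \<in> carrier Hsp" "B \<in> carrier Hsp" "D \<in> carrier Hsp"
  shows "\<exists>J0 :: nat. \<forall>J\<ge>J0.
    (\<Sum>j\<in>{..J}. xq_scalar (of_int m gchoose j) * heis.emb (Yheis (Yheis A (l + int j) B) (m + n - int j) D)) =
    (\<Sum>j\<in>{..J}. xq_scalar ((- 1) ^ j * (of_int l gchoose j)) *
       (heis.emb (Yheis A (m + l - int j) (Yheis B (n + int j) D)) +
        xq_scalar (- ((- 1) powi l)) * heis.emb (Yheis B (n + l - int j) (Yheis A (m + int j) D))))"
  by (rule ex_forward[OF heis_axioms[THEN conjunct2, THEN conjunct2, THEN conjunct2, THEN conjunct2, THEN conjunct2,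
        THEN bspec, OF assms(1), THEN bspec, OF assms(2), THEN bspec, OF assms(3), THEN spec, THEN spec, THEN spec, of m l n]],
      elim all_forward imp_forward, assumption, drule arg_cong[where f = heis.emb])
    (simp add: assms heis.finsum_emb heis.carriers heis.embs Yheis_carrier)

text \<open>Both vertex operator maps satisfy the same recursion on monomials: on the quantum side by
  peeling off the last factor of the normally ordered product, on the Heisenberg side by the
  Borcherds identity for \<open>(a_(-k-1) b)_r\<close>.\<close>

lemma Yheis_monom:
  assumes "\<And>l. e l \<in> diag" "w \<in> VH" "A \<in> carrier (Hsp)" "W \<in> carrier (Hsp)"
    and "heis.emb A = reduce (h_monom e q {1..n})" "heis.emb W = reduce w"
  shows "heis.emb (Yheis A r W) = reduce (Y (h_monom e q {1..n}) r w)"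
  using assms(2-)
proof (induction n arbitrary: r w A W)
  case 0
  have "A = heis_class c 1"
    using 0 by (intro heis.emb_inj) (simp_all add: heis_class_carrier heis_emb_class vacuum_value_simps)
  then show ?case using 0 by (simp add: Yheis_vacuum reduce_Y_one heis.emb_zero)
next
  case (Suc n)
  let ?b = "h_monom e q {1..n}" and ?a = "e (Suc n)" and ?k = "q (Suc n)"
  obtain i where a: "?a = (i, i)" using assms(1)[of "Suc n"] by (auto simp: diag_def)
  have prod: "(h_monom e q {1..Suc n}) = ?b * hgen ?a ?k"
    by (simp add: prod.nat_ivl_Suc' mult.commute)
  have "reduce ?b \<in> xq_span diag"
    using assms(1) by (intro reduce_h_span h_span_prod h_span_gen) simp_all
  then obtain B where B: "B \<in> carrier (Hsp)" "heis.emb B = reduce ?b" by (rule heis_emb_surj)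
  \<comment> \<open>The vector \<open>a_i(-1) 1\<close>, whose modes are known from
    \<open>Yheis_mode\<close>; all other vertex operators are built from it.\<close>
  define A' where "A' = heis_class c (uea_gen (heis_mode (cartan_gen i) (- 1)))"
  have A': "A' \<in> carrier (Hsp)" unfolding A'_def by (rule heis_class_carrier)
  have mode: "heis.emb (Yheis A' r D) = mode_op i r (heis.emb D)" if "D \<in> carrier (Hsp)" for r D
    using that
  proof (rule heis.carrierE)
    fix u assume "D = heis_class c u" "heis.emb D = vacuum_value u"
    then show ?thesis
      by (simp add: A'_def Yheis_mode heis_emb_class)
        (simp add: vacuum_value_def uea_act_mult uea_act_gen heis_op_mode cartan_op_gen)
  qed
  \<comment> \<open>Multiplication by the last generator is the action of \<open>a_i(-k-1)\<close>,
    so the monomial is a product \<open>a_(-k-1) b\<close> in the vertex algebra.\<close>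
  have A: "A = Yheis A' (- int ?k - 1) B"
    using Suc.prems(2,4) B A' unfolding prod
    by (intro heis.emb_inj) (simp_all add: Yheis_carrier mode mode_op_def reduce_mult a mult.commute)
  \<comment> \<open>Both sides of the Borcherds identity at \<open>m = 0\<close>,
    \<open>l = -k-1\<close>, \<open>n = r\<close>. Terms such as \<open>0 + r - int j\<close> are
    left unsimplified so that they match it literally.\<close>
  let ?lhs = "\<lambda>J. \<Sum>j\<in>{..J::nat}. xq_scalar (of_int 0 gchoose j) *
    heis.emb (Yheis (Yheis A' (- int ?k - 1 + int j) B) (0 + r - int j) W)"
  let ?h = "\<lambda>J. \<Sum>j\<in>{..J::nat}. xq_scalar ((- 1) ^ j * (of_int (- int ?k - 1) gchoose j)) *
       (heis.emb (Yheis A' (0 + (- int ?k - 1) - int j) (Yheis B (r + int j) W)) +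
        xq_scalar (- ((- 1) powi (- int ?k - 1))) * heis.emb (Yheis B (r + (- int ?k - 1) - int j) (Yheis A' (0 + int j) W)))"
  let ?q = "\<lambda>J. \<Sum>j\<in>{..J::nat}. xq_scalar ((- 1) ^ j * (of_int (- int ?k - 1) gchoose j)) *
       (xq_gen ?a (?k + j) * reduce (Y ?b (r + int j) w) +
        xq_scalar ((- 1) ^ ?k) * reduce (Y ?b (r - int ?k - 1 - int j) (xm ?a j w)))"
  obtain J0 where J0: "\<And>J. J \<ge> J0 \<Longrightarrow> reduce (Y (?b * hgen ?a ?k) r w) = ?q J"
    by (rule reduce_Y_Suc[where n = n and e = e and q = q and r = r and w = w]) blast
  obtain J1 where J1: "\<And>J. J \<ge> J1 \<Longrightarrow> ?lhs J = ?h J"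
    using Yheis_borcherds[OF A' B(1) Suc.prems(3), of 0 "- int ?k - 1" r] by blast
  define J where "J = max J0 J1"
  \<comment> \<open>The binomial coefficient of 0 over \<open>j\<close> leaves only the summand
    \<open>j = 0\<close>.\<close>
  have "?lhs J = (\<Sum>j\<in>{..J}. if j = 0 then heis.emb (Yheis A r W) else 0)"
  proof (rule sum.cong[OF refl])
    fix j
    show "xq_scalar (of_int 0 gchoose j) * heis.emb (Yheis (Yheis A' (- int ?k - 1 + int j) B) (0 + r - int j) W)
      = (if j = 0 then heis.emb (Yheis A r W) else 0)"
      by (cases j) (simp_all add: A)
  qed
  also have "\<dots> = heis.emb (Yheis A r W)" by simp
  finally have "heis.emb (Yheis A r W) = ?h J"
    using J1[of J] by (simp add: J_def)
  also have "\<dots> = ?q J"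
  proof (intro sum.cong refl arg_cong2[where f = "(*)"] arg_cong2[where f = "(+)"])
    fix j
    \<comment> \<open>The mode \<open>-k-1-j\<close> is negative, hence acts as multiplication by
      the variable with index \<open>k + j\<close>.\<close>
    have "nat (- (0 + (- int ?k - 1) - int j) - 1) = ?k + j" by simp
    then show "heis.emb (Yheis A' (0 + (- int ?k - 1) - int j) (Yheis B (r + int j) W))
      = xq_gen ?a (?k + j) * reduce (Y ?b (r + int j) w)"
      using Suc.IH[OF Suc.prems(1) B(1) Suc.prems(3) B(2) Suc.prems(5)] B(1) Suc.prems(3)
      by (simp add: mode Yheis_carrier mode_op_def a)
    have "- int ?k - 1 = - int (Suc ?k)" by simp
    then have "(- 1 :: complex) powi (- int ?k - 1) = inverse ((- 1) ^ Suc ?k)"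
      by (simp only: power_int_minus power_int_of_nat)
    also have "\<dots> = - ((- 1) ^ ?k)" by (cases "even ?k") simp_all
    finally have "- ((- 1 :: complex) powi (- int ?k - 1)) = (- 1) ^ ?k" by simp
    then show "xq_scalar (- ((- 1) powi (- int ?k - 1))) = xq_scalar ((- 1) ^ ?k)" by (simp only:)
    \<comment> \<open>Here the induction hypothesis is applied to \<open>xm ?a j w\<close> in place
      of \<open>w\<close>, which is why \<open>w\<close> and \<open>W\<close> are
      generalised.\<close>
    have "xm ?a j w \<in> VH" using Suc.prems(1) assms(1) by (simp add: VH_eq xm_diag_h_span)
    moreover have "heis.emb (Yheis A' (0 + int j) W) = reduce (xm ?a j w)"
      using Suc.prems(3,5) by (simp add: mode mode_op_def reduce_xm a)
    moreover have eq: "r + (- int ?k - 1) - int j = r - int ?k - 1 - int j" by simp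
    ultimately show "heis.emb (Yheis B (r + (- int ?k - 1) - int j) (Yheis A' (0 + int j) W))
      = reduce (Y ?b (r - int ?k - 1 - int j) (xm ?a j w))"
      unfolding eq using Suc.IH[OF _ B(1) Yheis_carrier[OF A' Suc.prems(3)] B(2)] by simp
  qed
  also have "\<dots> = reduce (Y (?b * hgen ?a ?k) r w)"
    using J0[of J] by (simp add: J_def)
  finally show ?case unfolding prod .
qed

lemma reduce_Y_cong:
  assumes "reduce v = reduce v'" "reduce w = reduce w'"
  shows "reduce (Y v r w) = reduce (Y v' r w')"
  using reduce_hlinear_cong[OF Y_hlinear_left assms(1), of r w] reduce_hlinear_cong[OF Y_hlinear_right assms(2), of v' r]
  by simp

text \<open>Both sides depend only on the common image of \<open>A\<close> and \<open>v\<close> in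
  \<open>x_quot\<close>, linearly. The induction therefore runs over this image, with all its lifts
  at once.\<close>

lemma Yheis_intertwine:
  assumes "v \<in> VH" "w \<in> VH" "A \<in> carrier (Hsp)" "W \<in> carrier (Hsp)"
    and "heis.emb A = reduce v" "heis.emb W = reduce w"
  shows "heis.emb (Yheis A r W) = reduce (Y v r w)"
proof -
  have "\<forall>v A. A \<in> carrier (Hsp) \<longrightarrow> heis.emb A = x \<longrightarrow> reduce v = x \<longrightarrow>
      heis.emb (Yheis A r W) = reduce (Y v r w)" if "x \<in> xq_span diag" for x
    using that
  proof (induction rule: xq_span.induct)
    case zero
    have "heis.emb (Yheis \<zero>\<^bsub>Hsp\<^esub> r W) = 0"
    proof -
      let ?Z = "\<zero>\<^bsub>Hsp\<^esub>" and ?M = "Hsp"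
      \<comment> \<open>Linearity is only available for combinations \<open>\<alpha> a + a'\<close>;
        vanishing at 0 follows from writing 0 as \<open>1 0 + 0\<close>.\<close>
      have "1 \<odot>\<^bsub>?M\<^esub> ?Z \<oplus>\<^bsub>?M\<^esub> ?Z = ?Z"
        by (intro heis.emb_inj) (simp_all add: heis.carriers heis.embs)
      then have "heis.emb (Yheis ?Z r W) = heis.emb (1 \<odot>\<^bsub>?M\<^esub> Yheis ?Z r W \<oplus>\<^bsub>?M\<^esub> Yheis ?Z r W)"
        using Yheis_linear[OF heis.zero_carrier heis.zero_carrier assms(4), of 1 r] by simp
      then show ?thesis using assms(4) by (simp add: heis.carriers heis.embs Yheis_carrier)
    qed
    moreover have "A = \<zero>\<^bsub>Hsp\<^esub>" if "A \<in> carrier (Hsp)" "heis.emb A = 0" for A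
      using that by (intro heis.emb_inj) (simp_all add: heis.carriers heis.embs)
    moreover have "reduce (Y v r w) = 0" if "reduce v = 0" for v
      using reduce_Y_cong[of v 0 w w r] that by (simp add: hlinearD(1)[OF Y_hlinear_left])
    ultimately show ?case by metis
  next
    case (add m x \<alpha>)
    obtain n :: nat and e q where e: "\<And>l. e l \<in> diag" and m: "m = (\<Prod>l\<in>{1..n}. xq_gen (e l) (q l))"
      using add(1) unfolding xq_monoms_def by blast
    define m' where "m' = h_monom e q {1..n}"
    have m': "reduce m' = m" by (simp add: m'_def m reduce_prod)
    obtain A1 where A1: "A1 \<in> carrier (Hsp)" "heis.emb A1 = m"
      using xq_span_monom[OF add(1)] by (rule heis_emb_surj)
    obtain A2 where A2: "A2 \<in> carrier (Hsp)" "heis.emb A2 = x"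
      using add(2) by (rule heis_emb_surj)
    show ?case
    proof (intro allI impI)
      fix v A assume A: "A \<in> carrier (Hsp)" "heis.emb A = xq_scalar \<alpha> * m + x"
        and v: "reduce v = xq_scalar \<alpha> * m + x"
      have "A = \<alpha> \<odot>\<^bsub>Hsp\<^esub> A1 \<oplus>\<^bsub>Hsp\<^esub> A2"
        using A A1 A2 by (intro heis.emb_inj) (simp_all add: heis.carriers heis.embs)
      then have "heis.emb (Yheis A r W) = xq_scalar \<alpha> * heis.emb (Yheis A1 r W) + heis.emb (Yheis A2 r W)"
        using A1(1) A2(1) assms(4) by (simp add: Yheis_linear heis.carriers heis.embs Yheis_carrier)
      also have "heis.emb (Yheis A1 r W) = reduce (Y m' r w)"
        unfolding m'_def using e assms(2,4,6) A1 m' by (intro Yheis_monom) (simp_all add: m'_def)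
      also have "heis.emb (Yheis A2 r W) = reduce (Y (h_const x) r w)"
        using add.IH A2 by simp
      also have "xq_scalar \<alpha> * reduce (Y m' r w) + reduce (Y (h_const x) r w)
        = reduce (Y (hscalar (fps_const \<alpha>) * m' + h_const x) r w)"
        by (simp add: hlinearD[OF Y_hlinear_left] reduce_add reduce_scale)
      also have "\<dots> = reduce (Y v r w)"
        by (rule reduce_Y_cong) (simp_all add: v m' reduce_add reduce_scale)
      finally show "heis.emb (Yheis A r W) = reduce (Y v r w)" .
    qed
  qed
  moreover have "reduce v \<in> xq_span diag" using assms(1) by (simp add: VH_eq reduce_h_span)
  ultimately show ?thesis using assms by blast
qed

section \<open>Passage to cosets, the identification, and transport of the axioms\<close>

lemma limit_vertex_map_coset:
  assumes "v \<in> VH" "w \<in> VH"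
  shows "limit_vertex_map Y (VH_class v) r (VH_class w) = VH_class (Y v r w)"
  unfolding limit_vertex_map_def
proof (intro SUP_eq_const)
  show "VH_class v \<noteq> {}" "VH_class w \<noteq> {}" using assms by (auto simp: q.coset_eq)
  fix a b assume "a \<in> VH_class v" "b \<in> VH_class w"
  then have ab: "a \<in> VH" "b \<in> VH" "reduce a = reduce v" "reduce b = reduce w"
    using assms by (auto simp: q.coset_eq)
  have "Y a r b \<in> VH" "Y v r w \<in> VH" using ab assms Y_h_span by (simp_all add: VH_eq)
  then show "VH_class (Y a r b) = VH_class (Y v r w)"
    using reduce_Y_cong[OF ab(3,4)] by (simp add: q.coset_eq)
qed

text \<open>A fibre of the vacuum value over a point of its image is exactly one coset of the
  induced relations, so no representative has to be chosen.\<close>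

definition identification :: "'n hplus set \<Rightarrow> 'n uea set" where
  "identification A = {u. vacuum_value u = q.emb A}"

lemma
  assumes "A \<in> carrier Qsp"
  shows identification_carrier: "identification A \<in> carrier (Hsp)"
    and emb_identification: "heis.emb (identification A) = q.emb A"
proof -
  obtain u where u: "vacuum_value u = q.emb A"
    using vacuum_value_surj[OF q_emb_span[OF assms]] by blast
  then have "identification A = heis_class c u" by (simp add: identification_def heis_coset)
  then show "identification A \<in> carrier (Hsp)" "heis.emb (identification A) = q.emb A"
    using u by (simp_all add: heis_class_carrier heis_emb_class)
qed

lemma bij_identification: "bij_betw identification (carrier Qsp) (carrier (Hsp))"
  unfolding bij_betw_def
proof (intro conjI equalityI subsetI)
  show "inj_on identification (carrier Qsp)"
    by (rule inj_onI) (metis emb_identification q.emb_inj)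
  show "B \<in> carrier (Hsp)" if "B \<in> identification ` carrier Qsp" for B
    using that identification_carrier by blast
  fix B assume B: "B \<in> carrier (Hsp)"
  have const: "h_const (heis.emb B) \<in> VH" using heis_emb_span[OF B] by (simp add: VH_eq h_span_const)
  then have A: "VH_class (h_const (heis.emb B)) \<in> carrier Qsp" by (rule q.coset_in_carrier)
  have "identification (VH_class (h_const (heis.emb B))) = B"
    using emb_identification[OF A] q.emb_coset[OF const]
    by (intro heis.emb_inj identification_carrier A B) simp
  with A show "B \<in> identification ` carrier Qsp" by blast
qed

lemma identification_linear:
  assumes "A \<in> carrier Qsp" "B \<in> carrier Qsp"
  shows "identification (\<alpha> \<odot>\<^bsub>Qsp\<^esub> A \<oplus>\<^bsub>Qsp\<^esub> B) =
    \<alpha> \<odot>\<^bsub>Hsp\<^esub> identification A \<oplus>\<^bsub>Hsp\<^esub> identification B"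
  using assms
  by (intro heis.emb_inj)
    (simp_all add: identification_carrier emb_identification q.carriers q.embs heis.carriers heis.embs)

lemma is_identification: "is_identification c identification"
proof -
  have "identification \<in> ring_iso Qsp (Hsp)"
    unfolding ring_iso_def
  proof (intro CollectI conjI ring_hom_memI bij_identification)
    fix A B assume "A \<in> carrier Qsp" "B \<in> carrier Qsp"
    then show "identification (A \<otimes>\<^bsub>Qsp\<^esub> B) = identification A \<otimes>\<^bsub>Hsp\<^esub> identification B"
      "identification (A \<oplus>\<^bsub>Qsp\<^esub> B) = identification A \<oplus>\<^bsub>Hsp\<^esub> identification B"
      by (intro heis.emb_inj; simp add: identification_carrier emb_identification q.carriers q.embs heis.carriers heis.embs)+
  next
    show "identification \<one>\<^bsub>Qsp\<^esub> = \<one>\<^bsub>Hsp\<^esub>"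
      by (intro heis.emb_inj) (simp_all add: identification_carrier emb_identification q.carriers q.embs heis.carriers heis.embs)
  qed (rule identification_carrier)
  moreover have "identification (\<alpha> \<odot>\<^bsub>Qsp\<^esub> A) = \<alpha> \<odot>\<^bsub>Hsp\<^esub> identification A" if "A \<in> carrier Qsp" for \<alpha> A
    using that by (intro heis.emb_inj)
      (simp_all add: identification_carrier emb_identification q.carriers q.embs heis.carriers heis.embs)
  moreover have "identification (VH_class (hgen (i, i) k)) = heis_class c (uea_gen (heis_mode (cartan_gen i) (- int k - 1)))" for i k
  proof -
    have gen: "hgen (i, i) k \<in> (VH :: 'n hplus set)"
      unfolding VH_eq by (rule h_span_gen) (simp add: diag_def)
    then have "VH_class (hgen (i, i) k) \<in> carrier Qsp" by (rule q.coset_in_carrier)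
    moreover have "vacuum_value (uea_gen (heis_mode (cartan_gen i) (- int k - 1))) = xq_gen (i, i) k"
      by (simp add: vacuum_value_def uea_act_gen heis_op_mode cartan_op_gen mode_op_def)
    ultimately show ?thesis
      using gen by (intro heis.emb_inj)
        (simp_all add: identification_carrier emb_identification heis_class_carrier heis_emb_class q.emb_coset)
  qed
  ultimately show ?thesis
    unfolding is_identification_def algebra_iso_def using q.algebra_M heis.algebra_M by blast
qed

lemma limit_vertex_map_carrier:
  assumes "A \<in> carrier Qsp" "B \<in> carrier Qsp"
  shows "limit_vertex_map Y A r B \<in> carrier Qsp"
proof -
  obtain v where v: "v \<in> VH" "A = VH_class v" by (rule q.carrierE[OF assms(1)])
  obtain w where w: "w \<in> VH" "B = VH_class w" by (rule q.carrierE[OF assms(2)])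
  have "Y v r w \<in> VH" using v w Y_h_span by (simp add: VH_eq)
  then show ?thesis using v w by (simp add: limit_vertex_map_coset q.coset_in_carrier)
qed

lemma identification_vertex_map:
  assumes "A \<in> carrier Qsp" "B \<in> carrier Qsp"
  shows "identification (limit_vertex_map Y A r B) = Yheis (identification A) r (identification B)"
proof -
  obtain v where v: "v \<in> VH" "A = VH_class v" "q.emb A = reduce v" by (rule q.carrierE[OF assms(1)])
  obtain w where w: "w \<in> VH" "B = VH_class w" "q.emb B = reduce w" by (rule q.carrierE[OF assms(2)])
  have "Y v r w \<in> VH" using v w Y_h_span by (simp add: VH_eq)
  then have "q.emb (limit_vertex_map Y A r B) = reduce (Y v r w)"
    using v w by (simp add: limit_vertex_map_coset q.emb_coset)
  also have "\<dots> = heis.emb (Yheis (identification A) r (identification B))"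
    using v w assms by (intro Yheis_intertwine[symmetric]) (simp_all add: identification_carrier emb_identification)
  finally show ?thesis
    using assms by (intro heis.emb_inj)
      (simp_all add: identification_carrier emb_identification limit_vertex_map_carrier Yheis_carrier)
qed

lemma emb_limit_vertex_map:
  assumes "A \<in> carrier Qsp" "B \<in> carrier Qsp"
  shows "q.emb (limit_vertex_map Y A r B) = heis.emb (Yheis (identification A) r (identification B))"
  using assms by (simp add: identification_vertex_map[symmetric] emb_identification limit_vertex_map_carrier)

lemma identification_vacuum: "identification (VH_class 1) = heis_class c 1"
proof -
  have "1 \<in> (VH :: 'n hplus set)" by (simp add: VH_eq h_span_1)
  then show ?thesis by (simp add: identification_def heis_coset q.emb_coset vacuum_value_simps)
qed

lemma vacuum_carrier: "VH_class 1 \<in> carrier Qsp"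
  by (rule q.coset_in_carrier) (simp add: VH_eq h_span_1)

text \<open>Since \<open>q.emb\<close> is injective, each axiom may be checked after embedding.
  There \<open>emb_limit_vertex_map\<close> replaces the limit map by \<open>Yheis\<close> on
  identified elements, and the bounds for truncation and for the Borcherds sums carry over
  unchanged.\<close>

lemma vertex_algebra_limit: "vertex_algebra Qsp (VH_class 1) (limit_vertex_map Y)"
  unfolding vertex_algebra_def
proof (intro conjI ballI allI)
  let ?M = "Qsp" and ?L = "limit_vertex_map Y"
  let ?H = "Hsp" and ?\<phi> = identification
  note simps = identification_carrier emb_identification limit_vertex_map_carrier Yheis_carrier
    identification_vertex_map identification_linear identification_vacuum vacuum_carrier
    q.carriers q.embs heis.carriers heis.embs emb_limit_vertex_map
  show "Module.module complex_field ?M" by (rule q.module_M)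
  show "VH_class 1 \<in> carrier ?M" by (rule vacuum_carrier)
  show "?L A n B \<in> carrier ?M" if "A \<in> carrier ?M" "B \<in> carrier ?M" for A B n
    using that by (rule limit_vertex_map_carrier)
  fix A assume A: "A \<in> carrier ?M"
  show "?L (VH_class 1) n A = (if n = - 1 then A else \<zero>\<^bsub>?M\<^esub>)" for n
    using A by (intro q.emb_inj) (simp_all add: simps Yheis_vacuum)
  show "?L A (- 1) (VH_class 1) = A" "0 \<le> n \<longrightarrow> ?L A n (VH_class 1) = \<zero>\<^bsub>?M\<^esub>" for n
  proof -
    have "Yheis (?\<phi> A) (- 1) (heis_class c 1) = ?\<phi> A" "\<forall>n\<ge>0. Yheis (?\<phi> A) n (heis_class c 1) = \<zero>\<^bsub>?H\<^esub>"
      using Yheis_creation[OF identification_carrier[OF A]] by blast+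
    then show "?L A (- 1) (VH_class 1) = A" "0 \<le> n \<longrightarrow> ?L A n (VH_class 1) = \<zero>\<^bsub>?M\<^esub>"
      using A by (intro impI q.emb_inj; simp add: simps)+
  qed
  fix B assume B: "B \<in> carrier ?M"
  show "\<exists>n0. \<forall>n\<ge>n0. ?L A n B = \<zero>\<^bsub>?M\<^esub>"
  proof -
    have "\<exists>n0. \<forall>n\<ge>n0. Yheis (?\<phi> A) n (?\<phi> B) = \<zero>\<^bsub>?H\<^esub>"
      by (rule Yheis_truncation[OF identification_carrier[OF A] identification_carrier[OF B]])
    then obtain n0 where n0: "\<And>n. n \<ge> n0 \<Longrightarrow> Yheis (?\<phi> A) n (?\<phi> B) = \<zero>\<^bsub>?H\<^esub>" by blast
    have "?L A n B = \<zero>\<^bsub>?M\<^esub>" if "n \<ge> n0" for n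
      using A B n0[OF that] by (intro q.emb_inj) (simp_all add: simps)
    then show ?thesis by blast
  qed
  fix D assume D: "D \<in> carrier ?M"
  show "?L (\<alpha> \<odot>\<^bsub>?M\<^esub> A \<oplus>\<^bsub>?M\<^esub> B) n D = \<alpha> \<odot>\<^bsub>?M\<^esub> ?L A n D \<oplus>\<^bsub>?M\<^esub> ?L B n D"
    "?L D n (\<alpha> \<odot>\<^bsub>?M\<^esub> A \<oplus>\<^bsub>?M\<^esub> B) = \<alpha> \<odot>\<^bsub>?M\<^esub> ?L D n A \<oplus>\<^bsub>?M\<^esub> ?L D n B" for \<alpha> n
    using A B D by (intro q.emb_inj; simp add: simps Yheis_linear)+
  fix l m n :: int
  show "\<exists>J0 :: nat. \<forall>J\<ge>J0.
          (\<Oplus>\<^bsub>?M\<^esub>j\<in>{..J}. (of_int m gchoose j) \<odot>\<^bsub>?M\<^esub> ?L (?L A (l + int j) B) (m + n - int j) D) =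
          (\<Oplus>\<^bsub>?M\<^esub>j\<in>{..J}. ((- 1) ^ j * (of_int l gchoose j)) \<odot>\<^bsub>?M\<^esub>
             (?L A (m + l - int j) (?L B (n + int j) D) \<oplus>\<^bsub>?M\<^esub>
              (- ((- 1) powi l)) \<odot>\<^bsub>?M\<^esub> ?L B (n + l - int j) (?L A (m + int j) D)))"
    by (rule ex_forward[OF Yheis_borcherds[OF identification_carrier[OF A] identification_carrier[OF B]
          identification_carrier[OF D], of m l n]], elim all_forward imp_forward, assumption)
      (rule q.emb_inj; simp add: A B D q.finsum_emb simps)
qed

lemma identification_iso:
  "is_identification c identification \<and>
    vertex_algebra_iso Qsp (VH_class 1) (limit_vertex_map Y) Hsp (heis_class c 1) Yheis identification"
  unfolding vertex_algebra_iso_def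
  by (intro conjI is_identification vertex_algebra_limit heis_vertex_algebra bij_identification ballI allI
      identification_linear identification_vacuum identification_vertex_map)

end

theorem proposition2p14:
  fixes c :: complex
    and xm :: "'n::finite \<times> 'n \<Rightarrow> nat \<Rightarrow> 'n hplus \<Rightarrow> 'n hplus"
    and Y :: "'n hplus \<Rightarrow> int \<Rightarrow> 'n hplus \<Rightarrow> 'n hplus"
    and Yheis :: "'n uea set \<Rightarrow> int \<Rightarrow> 'n uea set \<Rightarrow> 'n uea set"
  assumes "CARD('n) \<ge> 2"
    and "is_x_minus c xm"
    and "is_vertex_operator_map c xm Y"
    and "is_heisenberg_vertex_map c Yheis"
  shows "\<exists>\<phi>. is_identification c \<phi> \<and>
    vertex_algebra_iso
      VH_limit (VH_class 1) (limit_vertex_map Y)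
      (heis_space c) (heis_class c 1) Yheis \<phi>"
proof -
  interpret classical_limit c xm Y Yheis
    using assms(2-4) by unfold_locales
  show ?thesis using identification_iso by blast
qed

end
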